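(* Let $1\le p_1\le\dots\le p_N$ (with $p_1>1$), $\bar p<N$, $T>0$, and for $\sigma\in[1,\bar p^*]$ set $\bar p_\sigma=\bar p(1+\sigma/N)$. Then $$L^{p_N}(0,T;L^{p_N}_{\rm loc}(\mathbb{R}^N))\cap L^{\bf p}(0,T;W^{1,{\bf p}}_{\rm loc}(\mathbb{R}^N))\cap L^\infty(0,T;L^\sigma_{\rm loc}(\mathbb{R}^N))\hookrightarrow L^{\bar p_\sigma}(0,T;L^{\bar p_\sigma}_{\rm loc}(\mathbb{R}^N)).$$ Moreover, if $\bar p_\sigma>p_N=\max\{p_1,\dots,p_N\}$, then $$L^{\bf p}(0,T;W^{1,{\bf p}}_{\rm loc}(\mathbb{R}^N))\cap L^\infty(0,T;L^\sigma_{\rm loc}(\mathbb{R}^N))\hookrightarrow L^{\bar p_\sigma}(0,T;L^{\bar p_\sigma}_{\rm loc}(\mathbb{R}^N)).$$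
   Context: $\bar p=\big(\frac1N\sum_{i=1}^N\frac1{p_i}\big)^{-1}$, $\bar p^*=\frac{N\bar p}{N-\bar p}$. $L^{\bf p}(0,T;W^{1,{\bf p}}_{\rm loc}(\mathbb{R}^N))$ is the set of $u\in L^1(0,T;L^1_{\rm loc}(\mathbb{R}^N))$ whose weak derivatives satisfy $D_iu\in L^{p_i}(0,T;L^{p_i}_{\rm loc}(\mathbb{R}^N))$ for $i=1,\dots,N$. $L^q(0,T;L^q_{\rm loc}(\mathbb{R}^N))$ consists of $u$ with $\int_0^T\int_K|u|^q<\infty$ for every compact $K$, and $L^\infty(0,T;L^\sigma_{\rm loc}(\mathbb{R}^N))$ of $u$ with $\sup_{t}\int_K|u(x,t)|^\sigma dx<\infty$ for every compact $K$. The symbol $\hookrightarrow$ denotes (continuous) inclusion. *)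

theory Defs
  imports "HOL-Analysis.Analysis"
begin

text \<open>Space-time points are pairs (x,t) with x in R^N (N = CARD('n)) and t real.
  Functions u are real-valued on R^N x R; only their values on R^N x (0,T) matter.\<close>

fun deriv_iter :: "'a::euclidean_space list \<Rightarrow> ('a \<Rightarrow> real) \<Rightarrow> ('a \<Rightarrow> real)" where
  "deriv_iter [] f = f"
| "deriv_iter (v # vs) f = (\<lambda>z. frechet_derivative (deriv_iter vs f) (at z) v)"

definition smooth_fun :: "('a::euclidean_space \<Rightarrow> real) \<Rightarrow> bool" where
  "smooth_fun f \<longleftrightarrow> (\<forall>vs. set vs \<subseteq> Basis \<longrightarrow>
      (\<forall>z. deriv_iter vs f differentiable at z) \<and> continuous_on UNIV (deriv_iter vs f))"

definition test_fun :: "real \<Rightarrow> ((real^'n::finite) \<times> real \<Rightarrow> real) \<Rightarrow> bool" where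
  "test_fun T \<phi> \<longleftrightarrow> smooth_fun \<phi> \<and> compact (closure {z. \<phi> z \<noteq> 0})
      \<and> closure {z. \<phi> z \<noteq> 0} \<subseteq> UNIV \<times> {0<..<T}"

definition partial_x :: "'n \<Rightarrow> ((real^'n::finite) \<times> real \<Rightarrow> real) \<Rightarrow> (real^'n::finite) \<times> real \<Rightarrow> real" where
  "partial_x i \<phi> z = frechet_derivative \<phi> (at z) (axis i 1, 0)"

definition meas_slab :: "real \<Rightarrow> ((real^'n::finite) \<times> real \<Rightarrow> real) \<Rightarrow> bool" where
  "meas_slab T u \<longleftrightarrow>
     (\<lambda>z. indicator (UNIV \<times> {0<..<T}) z * u z) \<in> borel_measurable lebesgue"

definition Lq_loc :: "real \<Rightarrow> real \<Rightarrow> ((real^'n::finite) \<times> real \<Rightarrow> real) \<Rightarrow> bool" where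
  "Lq_loc T q u \<longleftrightarrow> meas_slab T u \<and>
     (\<forall>K. compact K \<longrightarrow>
        (\<integral>\<^sup>+ z \<in> K \<times> {0<..<T}. ennreal (\<bar>u z\<bar> powr q) \<partial>lebesgue) < \<infinity>)"

definition Lq_norm :: "(real^'n::finite) set \<Rightarrow> real \<Rightarrow> real \<Rightarrow> ((real^'n::finite) \<times> real \<Rightarrow> real) \<Rightarrow> real" where
  "Lq_norm K T q u =
     enn2real (\<integral>\<^sup>+ z \<in> K \<times> {0<..<T}. ennreal (\<bar>u z\<bar> powr q) \<partial>lebesgue) powr (1 / q)"

definition Linf_loc :: "real \<Rightarrow> real \<Rightarrow> ((real^'n::finite) \<times> real \<Rightarrow> real) \<Rightarrow> bool" where
  "Linf_loc T \<sigma> u \<longleftrightarrow> meas_slab T u \<and>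
     (\<forall>K. compact K \<longrightarrow>
        (SUP t \<in> {0<..<T}. \<integral>\<^sup>+ x \<in> K. ennreal (\<bar>u (x, t)\<bar> powr \<sigma>) \<partial>lebesgue) < \<infinity>)"

definition Linf_norm :: "(real^'n::finite) set \<Rightarrow> real \<Rightarrow> real \<Rightarrow> ((real^'n::finite) \<times> real \<Rightarrow> real) \<Rightarrow> real" where
  "Linf_norm K T \<sigma> u =
     enn2real (SUP t \<in> {0<..<T}. \<integral>\<^sup>+ x \<in> K. ennreal (\<bar>u (x, t)\<bar> powr \<sigma>) \<partial>lebesgue)
       powr (1 / \<sigma>)"

definition weak_dx :: "real \<Rightarrow> 'n \<Rightarrow> ((real^'n::finite) \<times> real \<Rightarrow> real) \<Rightarrow> ((real^'n::finite) \<times> real \<Rightarrow> real) \<Rightarrow> bool" where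
  "weak_dx T i u g \<longleftrightarrow> (\<forall>\<phi>. test_fun T \<phi> \<longrightarrow>
     (\<integral> z. u z * partial_x i \<phi> z \<partial>lebesgue) = - (\<integral> z. g z * \<phi> z \<partial>lebesgue))"

definition aniso_W :: "('n \<Rightarrow> real) \<Rightarrow> real \<Rightarrow> ((real^'n::finite) \<times> real \<Rightarrow> real)
    \<Rightarrow> ('n \<Rightarrow> (real^'n::finite) \<times> real \<Rightarrow> real) \<Rightarrow> bool" where
  "aniso_W p T u g \<longleftrightarrow> Lq_loc T 1 u \<and> (\<forall>i. weak_dx T i u (g i) \<and> Lq_loc T (p i) (g i))"

definition aniso_W_space :: "('n \<Rightarrow> real) \<Rightarrow> real \<Rightarrow> ((real^'n::finite) \<times> real \<Rightarrow> real) \<Rightarrow> bool" where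
  "aniso_W_space p T u \<longleftrightarrow> (\<exists>g. aniso_W p T u g)"

definition pbar :: "('n::finite \<Rightarrow> real) \<Rightarrow> real" where
  "pbar p = inverse ((1 / real CARD('n)) * (\<Sum>i\<in>UNIV. 1 / p i))"

definition pbar_star :: "('n::finite \<Rightarrow> real) \<Rightarrow> real" where
  "pbar_star p = real CARD('n) * pbar p / (real CARD('n) - pbar p)"

end

theory Submission
  imports Defs "HOL-Computational_Algebra.Polynomial"
begin

text \<open>At almost every time Troisi's anisotropic Sobolev inequality bounds the norm of a compactly
  supported function \<open>w\<close> of exponent \<open>pbar_star p\<close> by the geometric mean of the norms of the
  \<open>D\<^sub>i w\<close> of exponents \<open>p i\<close>. Interpolating with the norm of exponent \<open>\<sigma>\<close> and integrating in time
  with Hoelder's inequality gives the exponent \<open>ps\<close>, because \<open>pbar p / pbar_star p + pbar p / N = 1\<close>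
  and the numbers \<open>pbar p / (N * p i)\<close> add up to 1. This is applied to \<open>w = \<zeta>\<^sup>m * u\<^sub>r\<close>, where \<open>\<zeta>\<close> is a
  cutoff in space and \<open>u\<^sub>r\<close> a mollification of \<open>u\<close> in space and time, and Fatou's lemma removes the
  mollification. The cutoff produces the term \<open>\<zeta>\<^sup>m\<^sup>-\<^sup>1 * u\<^sub>r\<close>, measured with the exponents \<open>p i\<close>. It is
  controlled by the norm of \<open>u\<close> of exponent \<open>pN\<close>; if \<open>ps > pN\<close> and \<open>m\<close> is large, it is also
  controlled by interpolation between \<open>w\<close> with exponent \<open>ps\<close> and \<open>u\<close> with exponent 1, with a
  small factor in front of the former, which is finite because \<open>u\<^sub>r\<close> is bounded.\<close>

text \<open>Weak derivatives are tested in space and time jointly, so at a fixed time nothing is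
  differentiable a priori. Mollifying in both variables gives functions that are continuously
  differentiable in space at every time, and the bound on almost all slices in the norm of exponent
  \<open>\<sigma>\<close> survives the averaging over nearby times. The price is that the derivative
  of \<open>u\<^sub>r\<close> is known to be the mollified weak derivative only at times farther
  than \<open>r\<close> from 0 and \<open>T\<close>; therefore the estimates carry a set
  \<open>S\<close> of times. The cutoff enters as a power because
  \<open>\<zeta>\<^sup>m\<^sup>-\<^sup>1 * u\<^sub>r\<close> is, in absolute value, the product of
  the powers (m - 1) / m of \<open>w\<close> and 1 / m of \<open>u\<^sub>r\<close>; for large
  \<open>m\<close> the Hoelder exponents leave room for the finite measure of the slab. Integrals
  and norms are extended reals, which spares most finiteness conditions. Finiteness matters where a
  factor is cancelled or a term absorbed; the absorption uses a bound that may depend on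
  \<open>r\<close>, whereas all constants are uniform in \<open>r\<close>.\<close>

section \<open>Hoelder's inequality for nonnegative extended functions\<close>

text \<open>Meant for \<open>a > 0\<close>: for \<open>a = 0\<close> the value is 0 at 0 and \<open>top\<close> at \<open>top\<close>.\<close>

definition epow :: "ennreal \<Rightarrow> real \<Rightarrow> ennreal" where
  "epow x a = (if x = top then top else ennreal (enn2real x powr a))"

lemma epow_ennreal: "0 \<le> r \<Longrightarrow> epow (ennreal r) a = ennreal (r powr a)"
  by (simp add: epow_def)

lemma epow_top [simp]: "epow top a = top"
  by (simp add: epow_def)

lemma epow_0 [simp]: "epow 0 a = 0"
  by (simp add: epow_def)

lemma epow_1 [simp]: "epow 1 a = 1"
  by (simp add: epow_def)

lemma epow_one [simp]: "epow x 1 = x"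
  by (cases x) (auto simp: epow_def)

lemma measurable_epow [measurable (raw)]:
  assumes [measurable]: "f \<in> borel_measurable M"
  shows "(\<lambda>x. epow (f x) a) \<in> borel_measurable M"
  unfolding epow_def by measurable

lemma epow_eq_0_iff [simp]: "epow x a = 0 \<longleftrightarrow> x = 0"
  by (cases x) (auto simp: epow_def)

lemma epow_eq_top_iff [simp]: "epow x a = top \<longleftrightarrow> x = top"
  by (cases x) (auto simp: epow_def)

lemma epow_mono: "x \<le> y \<Longrightarrow> 0 \<le> a \<Longrightarrow> epow x a \<le> epow y a"
  by (cases x; cases y) (auto simp: epow_def top_unique intro!: ennreal_leI powr_mono2)

lemma epow_mult: "epow (x * y) a = epow x a * epow y a"
proof (cases "x = top \<or> y = top")
  case True
  then show ?thesis
    by (auto simp: ennreal_mult_top ennreal_top_mult)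
next
  case False
  then obtain r s where rs: "x = ennreal r" "y = ennreal s" "0 \<le> r" "0 \<le> s"
    by (cases x; cases y) auto
  have "epow (x * y) a = epow (ennreal (r * s)) a"
    using rs by (simp add: ennreal_mult)
  also have "\<dots> = ennreal (r powr a * s powr a)"
    using rs by (simp add: epow_ennreal powr_mult del: ennreal_mult'')
  finally show ?thesis
    using rs by (simp add: epow_ennreal ennreal_mult)
qed

lemma epow_epow: "epow (epow x a) b = epow x (a * b)"
  by (cases x) (auto simp: epow_def powr_powr)

lemma epow_add: "0 < a \<Longrightarrow> 0 < b \<Longrightarrow> epow x (a + b) = epow x a * epow x b"
  by (cases x) (auto simp: epow_def powr_add ennreal_mult'')

lemma epow_prod: "epow (prod f I) a = (\<Prod>i\<in>I. epow (f i) a)"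
  by (induction I rule: infinite_finite_induct) (auto simp: epow_mult)

lemma epow_sum: "finite I \<Longrightarrow> I \<noteq> {} \<Longrightarrow> (\<And>i. i \<in> I \<Longrightarrow> 0 < a i) \<Longrightarrow>
    epow x (sum a I) = (\<Prod>i\<in>I. epow x (a i))"
  by (induction I rule: finite_ne_induct) (auto simp: epow_add sum_pos)

text \<open>Jensen's inequality for \<open>exp\<close> at the points \<open>ln (x i)\<close>. A
  vanishing \<open>x i\<close> has no useful logarithm, but then the product is 0.\<close>

lemma weighted_amgm_real:
  fixes x a :: "'i \<Rightarrow> real"
  assumes "finite I" "\<And>i. i \<in> I \<Longrightarrow> 0 < a i" "sum a I = 1" "\<And>i. i \<in> I \<Longrightarrow> 0 \<le> x i"
  shows "(\<Prod>i\<in>I. x i powr a i) \<le> (\<Sum>i\<in>I. a i * x i)"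
proof (cases "\<exists>i\<in>I. x i = 0")
  case True
  then have "(\<Prod>i\<in>I. x i powr a i) = 0"
    using assms(1) by force
  moreover have "0 \<le> (\<Sum>i\<in>I. a i * x i)"
    using assms by (intro sum_nonneg mult_nonneg_nonneg) (auto simp: less_imp_le)
  ultimately show ?thesis by simp
next
  case False
  then have pos: "x i > 0" if "i \<in> I" for i
    using assms(4) that by fastforce
  have ne: "I \<noteq> {}" using assms(3) by auto
  have "(\<Prod>i\<in>I. x i powr a i) = exp (\<Sum>i\<in>I. a i * ln (x i))"
    using assms(1) pos by (simp add: exp_sum powr_def less_imp_neq[symmetric])
  also have "\<dots> \<le> (\<Sum>i\<in>I. a i * exp (ln (x i)))"
    using convex_on_sum[OF assms(1) ne exp_convex assms(3), of "\<lambda>i. ln (x i)"] assms(2)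
    by (simp add: less_imp_le)
  finally show ?thesis using pos by simp
qed

lemma weighted_amgm:
  assumes "finite I" "\<And>i. i \<in> I \<Longrightarrow> 0 < a i" "sum a I = 1"
  shows "(\<Prod>i\<in>I. epow (x i) (a i)) \<le> (\<Sum>i\<in>I. ennreal (a i) * x i)"
proof (cases "\<exists>i\<in>I. x i = top")
  case True
  then obtain i where i: "i \<in> I" "x i = top" by auto
  then have "ennreal (a i) * x i = top"
    using assms(2)[OF i(1)] by (simp add: ennreal_mult_top)
  then have "(\<Sum>i\<in>I. ennreal (a i) * x i) = top"
    by (simp add: sum.remove[OF assms(1) i(1)])
  then show ?thesis by simp
next
  case False
  define y where "y i = enn2real (x i)" for i
  have y: "x i = ennreal (y i)" if "i \<in> I" for i
    using False that by (auto simp: y_def top.not_eq_extremum)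
  have y0: "0 \<le> y i" for i
    by (simp add: y_def)
  have "(\<Prod>i\<in>I. epow (x i) (a i)) = ennreal (\<Prod>i\<in>I. y i powr a i)"
    by (simp add: y epow_ennreal y0 prod_ennreal cong: prod.cong)
  also have "\<dots> \<le> ennreal (\<Sum>i\<in>I. a i * y i)"
    using assms by (intro ennreal_leI weighted_amgm_real) (auto simp: y_def)
  also have "\<dots> = (\<Sum>i\<in>I. ennreal (a i * y i))"
    using assms(2) by (intro sum_ennreal[symmetric]) (auto simp: y_def less_imp_le)
  also have "\<dots> = (\<Sum>i\<in>I. ennreal (a i) * x i)"
    using assms(2) by (intro sum.cong) (auto simp: y ennreal_mult less_imp_le y0)
  finally show ?thesis .
qed

text \<open>After division of each \<open>f i\<close> by its integral \<open>F i\<close>, the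
  weighted arithmetic-geometric mean applies pointwise, and its right side integrates to the sum of
  the weights, which is 1.\<close>

lemma holder_nn_integral:
  assumes fin: "finite I" and a: "\<And>i. i \<in> I \<Longrightarrow> 0 < a i" "sum a I = 1"
    and [measurable]: "\<And>i. i \<in> I \<Longrightarrow> f i \<in> borel_measurable M"
  shows "(\<integral>\<^sup>+x. (\<Prod>i\<in>I. epow (f i x) (a i)) \<partial>M) \<le> (\<Prod>i\<in>I. epow (\<integral>\<^sup>+x. f i x \<partial>M) (a i))"
proof -
  define F where "F i = (\<integral>\<^sup>+x. f i x \<partial>M)" for i
  \<comment> \<open>A vanishing \<open>F i\<close> is treated before an infinite one: it makes the
    left side 0, whereas an infinite \<open>F i\<close> makes the right side infinite only if no
    other factor is 0.\<close>
  consider (zero) i where "i \<in> I" "F i = 0"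
    | (inf) i where "i \<in> I" "F i = top" "\<forall>i\<in>I. F i \<noteq> 0"
    | (fin) "\<forall>i\<in>I. F i \<noteq> 0 \<and> F i \<noteq> top" by auto
  then show ?thesis
  proof cases
    case zero
    then have "AE x in M. f i x = 0"
      unfolding F_def by (subst (asm) nn_integral_0_iff_AE) auto
    then have "AE x in M. (\<Prod>i\<in>I. epow (f i x) (a i)) = 0"
      by eventually_elim (use fin zero(1) in \<open>auto intro!: prod_zero bexI[of _ i]\<close>)
    then have "(\<integral>\<^sup>+x. (\<Prod>i\<in>I. epow (f i x) (a i)) \<partial>M) = (\<integral>\<^sup>+x. 0 \<partial>M)"
      by (intro nn_integral_cong_AE)
    then show ?thesis by simp
  next
    case inf
    then have "(\<Prod>i\<in>I. epow (F i) (a i)) = top"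
      using fin by (subst ennreal_prod_eq_top) auto
    then show ?thesis by (simp add: F_def)
  next
    case fin
    have "(\<integral>\<^sup>+x. (\<Prod>i\<in>I. epow (f i x) (a i)) \<partial>M)
        = (\<integral>\<^sup>+x. (\<Prod>i\<in>I. epow (F i) (a i)) * (\<Prod>i\<in>I. epow (f i x / F i) (a i)) \<partial>M)"
    proof (intro nn_integral_cong)
      fix x
      have "epow (f i x) (a i) = epow (F i) (a i) * epow (f i x / F i) (a i)" if "i \<in> I" for i
        using fin that
        by (simp add: epow_mult[symmetric] ennreal_times_divide ennreal_mult_divide_eq mult.commute[of "F i"])
      then show "(\<Prod>i\<in>I. epow (f i x) (a i)) =
          (\<Prod>i\<in>I. epow (F i) (a i)) * (\<Prod>i\<in>I. epow (f i x / F i) (a i))"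
        by (simp add: prod.distrib[symmetric] cong: prod.cong)
    qed
    also have "\<dots> = (\<Prod>i\<in>I. epow (F i) (a i)) * (\<integral>\<^sup>+x. (\<Prod>i\<in>I. epow (f i x / F i) (a i)) \<partial>M)"
      by (intro nn_integral_cmult) measurable
    also have "\<dots> \<le> (\<Prod>i\<in>I. epow (F i) (a i)) * (\<integral>\<^sup>+x. (\<Sum>i\<in>I. ennreal (a i) * (f i x / F i)) \<partial>M)"
      using \<open>finite I\<close> a by (intro mult_left_mono nn_integral_mono weighted_amgm) auto
    also have "(\<integral>\<^sup>+x. (\<Sum>i\<in>I. ennreal (a i) * (f i x / F i)) \<partial>M) = (\<Sum>i\<in>I. ennreal (a i))"
    proof -
      have "(\<integral>\<^sup>+x. (\<Sum>i\<in>I. ennreal (a i) * (f i x / F i)) \<partial>M)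
          = (\<Sum>i\<in>I. ennreal (a i) * (F i / F i))"
        by (subst nn_integral_sum)
           (auto simp: nn_integral_cmult nn_integral_divide F_def intro!: sum.cong)
      then show ?thesis
        using fin by (auto simp: ennreal_divide_self top.not_eq_extremum intro!: sum.cong)
    qed
    also have "\<dots> = 1"
      using a by (subst sum_ennreal) (auto simp: less_imp_le)
    finally show ?thesis by (simp add: F_def)
  qed
qed

lemma holder2_nn_integral:
  assumes "0 < a" "0 < b" "a + b = 1"
    and [measurable]: "f \<in> borel_measurable M" "g \<in> borel_measurable M"
  shows "(\<integral>\<^sup>+x. epow (f x) a * epow (g x) b \<partial>M) \<le> epow (\<integral>\<^sup>+x. f x \<partial>M) a * epow (\<integral>\<^sup>+x. g x \<partial>M) b"
  using holder_nn_integral[of "{True, False}" "\<lambda>i. if i then a else b" "\<lambda>i. if i then f else g" M] assms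
  by simp

section \<open>The Loomis--Whitney inequality\<close>

text \<open>Points are functions on the index set, so that a single coordinate can be changed by
  \<open>x(i := s)\<close>; the results are carried over to \<open>real^'n\<close>
  afterwards.\<close>

abbreviation coord_measure :: "('n::finite \<Rightarrow> real) measure" where
  "coord_measure \<equiv> PiM UNIV (\<lambda>_. lborel)"

text \<open>Kept as a function of the full point \<open>x\<close> that ignores the coordinate
  \<open>i\<close>. Integrations over different coordinates can thus be iterated, and no projections
  to lower dimensional spaces are needed.\<close>

definition line_int :: "'n \<Rightarrow> (('n \<Rightarrow> real) \<Rightarrow> ennreal) \<Rightarrow> ('n \<Rightarrow> real) \<Rightarrow> ennreal" where
  "line_int i f x = (\<integral>\<^sup>+s. f (x(i := s)) \<partial>lborel)"

lemma measurable_line_upd [measurable]: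
  "(\<lambda>(x, s). x(i := s)) \<in> (coord_measure :: ('n::finite \<Rightarrow> real) measure) \<Otimes>\<^sub>M lborel \<rightarrow>\<^sub>M coord_measure"
  unfolding case_prod_beta'
  by (rule measurable_fun_upd[where J=UNIV]) auto

lemma measurable_line_int [measurable]:
  assumes [measurable]: "f \<in> borel_measurable (coord_measure :: ('n::finite \<Rightarrow> real) measure)"
  shows "line_int i f \<in> borel_measurable coord_measure"
proof -
  have "(\<lambda>(x, s). f (x(i := s))) = f \<circ> (\<lambda>(x, s). x(i := s))" by auto
  then have [measurable]: "(\<lambda>(x, s). f (x(i := s))) \<in> borel_measurable (coord_measure \<Otimes>\<^sub>M lborel)"
    using measurable_comp[OF measurable_line_upd assms] by simp
  then show ?thesis
    unfolding line_int_def[abs_def] by (rule lborel.borel_measurable_nn_integral)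
qed

lemma measurable_upd_const:
  assumes [measurable]: "f \<in> borel_measurable (coord_measure :: ('n::finite \<Rightarrow> real) measure)"
  shows "(\<lambda>s. f (x(i := s))) \<in> borel_measurable lborel"
proof -
  have "(\<lambda>s. x(i := s)) \<in> lborel \<rightarrow>\<^sub>M coord_measure"
    by (rule measurable_fun_upd[where J=UNIV]) (auto simp: space_PiM)
  then show ?thesis
    by (rule measurable_compose) (rule assms)
qed

lemma line_int_upd [simp]: "line_int i f (x(i := s)) = line_int i f x"
  by (simp add: line_int_def)

lemma line_int_commute:
  assumes [measurable]: "f \<in> borel_measurable (coord_measure :: ('n::finite \<Rightarrow> real) measure)"
  shows "line_int i (line_int j f) = line_int j (line_int i f)"
proof (cases "i = j")
  case False
  show ?thesis
  proof
    fix x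
    have "(\<lambda>z. (x(i := fst z))(j := snd z)) \<in> lborel \<Otimes>\<^sub>M lborel \<rightarrow>\<^sub>M coord_measure"
      by (rule measurable_fun_upd[where J=UNIV], simp, rule measurable_fun_upd[where J=UNIV])
         (auto simp: space_PiM)
    then have "(\<lambda>(s, r). f (x(i := s, j := r))) \<in> borel_measurable (lborel \<Otimes>\<^sub>M lborel)"
      unfolding case_prod_beta' by (rule measurable_compose) (rule assms)
    from lborel_pair.Fubini'[OF this]
    show "line_int i (line_int j f) x = line_int j (line_int i f) x"
      using False by (simp add: line_int_def fun_upd_twist)
  qed
qed simp

lemma measurable_foldr_line_int [measurable]:
  assumes [measurable]: "f \<in> borel_measurable (coord_measure :: ('n::finite \<Rightarrow> real) measure)"
  shows "foldr line_int js f \<in> borel_measurable coord_measure"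
  by (induction js) auto

lemma foldr_line_int_commute:
  assumes [measurable]: "f \<in> borel_measurable (coord_measure :: ('n::finite \<Rightarrow> real) measure)"
  shows "foldr line_int js (line_int j f) = line_int j (foldr line_int js f)"
  by (induction js) (auto simp: line_int_commute)

text \<open>Tonelli's theorem for the product measure, one coordinate at a time. Coordinates outside
  \<open>js\<close> keep the values of the base point, and each integration moves that point; hence
  the induction is over all \<open>x\<close>.\<close>

lemma foldr_line_int_eq:
  assumes [measurable]: "f \<in> borel_measurable (coord_measure :: ('n::finite \<Rightarrow> real) measure)"
    and "distinct js"
  shows "foldr line_int js f x =
    (\<integral>\<^sup>+y. f (\<lambda>i. if i \<in> set js then y i else x i) \<partial>PiM (set js) (\<lambda>_. lborel))"
  using assms(2)
proof (induction js arbitrary: x)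
  case Nil
  then show ?case by (simp add: PiM_empty nn_integral_count_space_finite)
next
  case (Cons j js)
  interpret product_sigma_finite "\<lambda>_::'n. lborel :: real measure" ..
  have m: "(\<lambda>y. f (\<lambda>i. if i = j \<or> i \<in> set js then y i else x i))
      \<in> borel_measurable (PiM (insert j (set js)) (\<lambda>_. lborel))"
  proof (rule measurable_compose[OF _ assms(1)])
    show "(\<lambda>y i. if i = j \<or> i \<in> set js then y i else x i)
        \<in> PiM (insert j (set js)) (\<lambda>_. lborel) \<rightarrow>\<^sub>M coord_measure"
    proof (rule measurable_PiM_single', goal_cases)
      case (1 i)
      then show ?case by (cases "i = j \<or> i \<in> set js") auto
    qed (auto simp: space_PiM)
  qed
  have "foldr line_int (j # js) f x = (\<integral>\<^sup>+s. foldr line_int js f (x(j := s)) \<partial>lborel)"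
    by (simp add: line_int_def)
  also have "\<dots> = (\<integral>\<^sup>+s. (\<integral>\<^sup>+y. f (\<lambda>i. if i \<in> set js then y i else (x(j := s)) i)
      \<partial>PiM (set js) (\<lambda>_. lborel)) \<partial>lborel)"
    using Cons by simp
  also have "\<dots> = (\<integral>\<^sup>+s. (\<integral>\<^sup>+y. f (\<lambda>i. if i = j \<or> i \<in> set js then (y(j := s)) i else x i)
      \<partial>PiM (set js) (\<lambda>_. lborel)) \<partial>lborel)"
    using Cons.prems by (intro nn_integral_cong arg_cong[where f=f]) auto
  also have "\<dots> = (\<integral>\<^sup>+y. f (\<lambda>i. if i = j \<or> i \<in> set js then y i else x i)
      \<partial>PiM (insert j (set js)) (\<lambda>_. lborel))"
    using Cons.prems m by (subst product_nn_integral_insert_rev) auto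
  finally show ?case by simp
qed

lemma foldr_line_int_UNIV:
  assumes "f \<in> borel_measurable (coord_measure :: ('n::finite \<Rightarrow> real) measure)"
    and "distinct js" "set js = UNIV"
  shows "foldr line_int js f x = integral\<^sup>N coord_measure f"
  using foldr_line_int_eq[OF assms(1,2), of x] assms(3) by simp

text \<open>Integrating out one more coordinate \<open>j\<close>, the factor with index \<open>j\<close> is constant and Hoelder's
  inequality applies to the other \<open>CARD('n) - 1\<close> factors.\<close>

lemma foldr_line_int_loomis_whitney:
  fixes G :: "'n::finite \<Rightarrow> ('n \<Rightarrow> real) \<Rightarrow> ennreal"
  assumes [measurable]: "\<And>i. G i \<in> borel_measurable coord_measure"
    and N: "CARD('n) \<ge> 2" and "distinct js"
  defines "a \<equiv> 1 / (real CARD('n) - 1)"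
  shows "foldr line_int js (\<lambda>x. \<Prod>i\<in>UNIV. epow (line_int i (G i) x) a) x
    \<le> (\<Prod>i\<in>UNIV. epow (if i \<in> set js then foldr line_int js (G i) x
                       else foldr line_int js (line_int i (G i)) x) a)"
  using assms(3)
proof (induction js arbitrary: x)
  case Nil
  then show ?case by simp
next
  case (Cons j js)
  define H where "H i = (if i \<in> set js then foldr line_int js (G i)
    else foldr line_int js (line_int i (G i)))" for i
  have [measurable]: "H i \<in> borel_measurable coord_measure" for i
    by (auto simp: H_def)
  have IH: "foldr line_int js (\<lambda>x. \<Prod>i\<in>UNIV. epow (line_int i (G i) x) a) x
      \<le> (\<Prod>i\<in>UNIV. epow (H i x) a)" for x
    using Cons by (simp add: H_def if_distrib[of "\<lambda>f. f x"] cong: if_cong)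
  \<comment> \<open>With the integration over \<open>j\<close> moved outermost, \<open>H j\<close>
    does not depend on the coordinate \<open>j\<close> and can leave the integral over it.\<close>
  have Hj: "H j = line_int j (foldr line_int js (G j))"
    using Cons.prems by (simp add: H_def foldr_line_int_commute)
  have "foldr line_int (j # js) (\<lambda>x. \<Prod>i\<in>UNIV. epow (line_int i (G i) x) a) x
      \<le> (\<integral>\<^sup>+s. (\<Prod>i\<in>UNIV. epow (H i (x(j := s))) a) \<partial>lborel)"
    using IH by (auto simp: line_int_def intro!: nn_integral_mono)
  also have "\<dots> = (\<integral>\<^sup>+s. epow (H j x) a * (\<Prod>i\<in>UNIV - {j}. epow (H i (x(j := s))) a) \<partial>lborel)"
    by (subst prod.remove[of UNIV j]) (auto simp: Hj)
  also have "\<dots> = epow (H j x) a * (\<integral>\<^sup>+s. (\<Prod>i\<in>UNIV - {j}. epow (H i (x(j := s))) a) \<partial>lborel)"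
    by (intro nn_integral_cmult borel_measurable_prod_ennreal measurable_epow measurable_upd_const)
       measurable
  also have "\<dots> \<le> epow (H j x) a * (\<Prod>i\<in>UNIV - {j}. epow (\<integral>\<^sup>+s. H i (x(j := s)) \<partial>lborel) a)"
    using N by (intro mult_left_mono holder_nn_integral measurable_upd_const)
       (auto simp: a_def card_Diff_singleton of_nat_diff)
  also have "\<dots> = (\<Prod>i\<in>UNIV. epow (if i = j then H j x else line_int j (H i) x) a)"
    by (subst prod.remove[of UNIV j]) (auto simp: line_int_def intro!: arg_cong2[where f="(*)"] prod.cong)
  also have "\<dots> = (\<Prod>i\<in>UNIV. epow (if i \<in> set (j # js) then foldr line_int (j # js) (G i) x
                       else foldr line_int (j # js) (line_int i (G i)) x) a)"
  proof (intro prod.cong refl arg_cong[where f="\<lambda>y. epow y a"])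
    fix i
    have "H j x = foldr line_int (j # js) (G j) x"
      using Hj by simp
    then show "(if i = j then H j x else line_int j (H i) x) =
        (if i \<in> set (j # js) then foldr line_int (j # js) (G i) x
         else foldr line_int (j # js) (line_int i (G i)) x)"
      by (auto simp: H_def)
  qed
  finally show ?case .
qed

text \<open>Once every coordinate is integrated out, each factor has become the integral over the
  full space. The version with line integrals is the one that fits the proof of Sobolev inequalities
  by the fundamental theorem of calculus on lines.\<close>

theorem loomis_whitney:
  fixes G :: "'n::finite \<Rightarrow> ('n \<Rightarrow> real) \<Rightarrow> ennreal"
  assumes [measurable]: "\<And>i. G i \<in> borel_measurable coord_measure" and N: "CARD('n) \<ge> 2"
  shows "(\<integral>\<^sup>+x. (\<Prod>i\<in>UNIV. epow (line_int i (G i) x) (1 / (real CARD('n) - 1))) \<partial>coord_measure)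
    \<le> (\<Prod>i\<in>UNIV. epow (integral\<^sup>N coord_measure (G i)) (1 / (real CARD('n) - 1)))"
proof -
  obtain js :: "'n list" where js: "distinct js" "set js = UNIV"
    using finite_distinct_list[of "UNIV :: 'n set"] by auto
  show ?thesis
    using foldr_line_int_loomis_whitney[OF assms js(1), where x=undefined]
    by (simp add: js foldr_line_int_UNIV)
qed

section \<open>Lebesgue measure on vectors as a product measure\<close>

lemma measurable_vec_lambda_coord [measurable]:
  "(\<lambda>f. \<chi> i. f i) \<in> (coord_measure :: ('n::finite \<Rightarrow> real) measure) \<rightarrow>\<^sub>M borel"
  by (subst borel_measurable_euclidean_space)
     (auto simp: Basis_vec_def inner_axis cart_eq_inner_axis[symmetric])

text \<open>A Borel measure that gives every box its volume is Lebesgue measure.\<close>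

lemma lborel_vec_eq: "(lborel :: (real^'n::finite) measure) = distr coord_measure borel (\<lambda>f. \<chi> i. f i)"
proof (rule lborel_eqI)
  fix l u :: "real^'n" assume lu: "\<And>b. b \<in> Basis \<Longrightarrow> l \<bullet> b \<le> u \<bullet> b"
  interpret finite_product_sigma_finite "\<lambda>_::'n. lborel :: real measure" UNIV by standard auto
  have lu': "l $ i \<le> u $ i" for i
    using lu[of "axis i 1"] by (simp add: cart_eq_inner_axis)
  have "emeasure (distr coord_measure borel (\<lambda>f. \<chi> i. f i)) (box l u)
      = emeasure coord_measure (Pi\<^sub>E UNIV (\<lambda>i. {l $ i<..<u $ i}))"
    by (subst emeasure_distr) (auto simp: mem_box_cart space_PiM PiE_iff intro!: arg_cong[where f="emeasure _"])
  also have "\<dots> = (\<Prod>i\<in>UNIV. ennreal (u $ i - l $ i))"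
    by (subst measure_times) (auto simp: lu')
  also have "\<dots> = ennreal (\<Prod>i\<in>UNIV. (u - l) \<bullet> axis i 1)"
    using lu' by (subst prod_ennreal) (auto simp: inner_axis)
  also have "(\<Prod>i\<in>UNIV. (u - l) \<bullet> axis i 1) = (\<Prod>b\<in>Basis. (u - l) \<bullet> b)"
    unfolding Basis_vec_def
    by (simp add: UNION_singleton_eq_range prod.reindex inj_on_def axis_eq_axis)
  finally show "emeasure (distr coord_measure borel (\<lambda>f. \<chi> i. f i)) (box l u)
      = (\<Prod>b\<in>Basis. (u - l) \<bullet> b)" .
qed simp

lemma nn_integral_lborel_vec:
  assumes [measurable]: "f \<in> borel_measurable (borel :: (real^'n::finite) measure)"
  shows "(\<integral>\<^sup>+x. f x \<partial>lborel) = (\<integral>\<^sup>+x. f (\<chi> i. x i) \<partial>coord_measure)"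
  by (subst lborel_vec_eq) (simp add: nn_integral_distr)

section \<open>Troisi's inequality\<close>

text \<open>Only the point 0 is delicate: there the difference quotient has size
  \<open>\<bar>h\<bar> powr (c - 1)\<close>, which tends to 0 because \<open>c > 1\<close>.\<close>

lemma abs_powr_has_real_derivative:
  fixes y c :: real
  assumes "c > 1"
  shows "((\<lambda>y. \<bar>y\<bar> powr c) has_real_derivative c * \<bar>y\<bar> powr (c - 1) * sgn y) (at y)"
proof -
  consider "y > 0" | "y < 0" | "y = 0" by linarith
  then show ?thesis
  proof cases
    case 1
    have "((\<lambda>y. y powr c) has_real_derivative c * \<bar>y\<bar> powr (c - 1) * sgn y) (at y)"
      using 1 by (auto intro!: derivative_eq_intros)
    then show ?thesis
      by (rule has_field_derivative_transform_within_open[of _ _ _ "{0<..}"]) (use 1 in auto)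
  next
    case 2
    have "((\<lambda>y. (- y) powr c) has_real_derivative c * \<bar>y\<bar> powr (c - 1) * sgn y) (at y)"
      using 2 by (auto intro!: derivative_eq_intros)
    then show ?thesis
      by (rule has_field_derivative_transform_within_open[of _ _ _ "{..<0}"]) (use 2 in auto)
  next
    case 3
    have "((\<lambda>h. \<bar>h::real\<bar> powr (c - 1)) \<longlongrightarrow> 0) (at 0)"
      using assms by (intro tendsto_zero_powrI[where b="c - 1"]) (auto intro!: tendsto_eq_intros)
    then have "((\<lambda>h. \<bar>h\<bar> powr c / h) \<longlongrightarrow> 0) (at 0)"
    proof (rule tendsto_0_le[where K=1], intro always_eventually allI)
      fix h :: real
      show "norm (\<bar>h\<bar> powr c / h) \<le> norm (\<bar>h\<bar> powr (c - 1)) * 1"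
        by (cases "h = 0") (auto simp: powr_diff abs_mult)
    qed
    then show ?thesis
      using 3 by (simp add: DERIV_def)
  qed
qed

text \<open>The fundamental theorem of calculus for \<open>\<bar>v\<bar> powr c\<close>, started at
  a point where \<open>v\<close> vanishes.\<close>

lemma abs_powr_le_line_integral:
  fixes v v' :: "real \<Rightarrow> real"
  assumes c: "c > 1" and v: "\<And>s. (v has_real_derivative v' s) (at s)"
    and v': "continuous_on UNIV v'" and supp: "\<And>s. s \<le> a \<Longrightarrow> v s = 0"
  shows "ennreal (\<bar>v s\<bar> powr c)
    \<le> (\<integral>\<^sup>+r. ennreal (c * \<bar>v r\<bar> powr (c - 1) * \<bar>v' r\<bar>) \<partial>lborel)"
proof -
  \<comment> \<open>A point where \<open>v\<close> vanishes and which is not to the right of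
    \<open>s\<close>; for \<open>s \<le> a\<close> the interval of integration degenerates.\<close>
  define b where "b = min a s"
  define f where "f r = c * \<bar>v r\<bar> powr (c - 1) * \<bar>v' r\<bar>" for r
  define F' where "F' r = c * \<bar>v r\<bar> powr (c - 1) * sgn (v r) * v' r" for r
  have vc: "continuous_on UNIV v"
    using v by (meson DERIV_isCont continuous_at_imp_continuous_on)
  have fc: "continuous_on A f" for A
    unfolding f_def using c
    by (intro continuous_intros continuous_on_powr' continuous_on_subset[OF vc]
        continuous_on_subset[OF v']) auto
  have "(F' has_integral (\<bar>v s\<bar> powr c - \<bar>v b\<bar> powr c)) {b..s}"
  proof (rule fundamental_theorem_of_calculus)
    show "b \<le> s" by (simp add: b_def)
    fix r
    have "((\<lambda>r. \<bar>v r\<bar> powr c) has_real_derivative F' r) (at r)"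
      unfolding F'_def by (rule DERIV_chain2[OF abs_powr_has_real_derivative[OF c] v])
    then show "((\<lambda>r. \<bar>v r\<bar> powr c) has_vector_derivative F' r) (at r within {b..s})"
      by (simp add: has_real_derivative_iff_has_vector_derivative has_vector_derivative_at_within)
  qed
  moreover have "v b = 0"
    by (rule supp) (simp add: b_def)
  ultimately have F': "(F' has_integral (\<bar>v s\<bar> powr c)) {b..s}" by simp
  have fi: "(f has_integral integral {b..s} f) {b..s}"
    by (intro integrable_integral integrable_continuous_real fc)
  have "\<bar>v s\<bar> powr c \<le> integral {b..s} f"
  proof (rule has_integral_le[OF F' fi])
    fix r show "F' r \<le> f r"
      using c by (auto simp: F'_def f_def sgn_if mult_left_mono mult_nonneg_nonneg
        intro!: mult_left_mono order_trans[OF mult_left_mono[OF abs_ge_minus_self]] )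
  qed
  then have "ennreal (\<bar>v s\<bar> powr c) \<le> ennreal (integral {b..s} f)"
    by (rule ennreal_leI)
  also have "ennreal (integral {b..s} f) = (\<integral>\<^sup>+r. ennreal (if r \<in> {b..s} then f r else 0) \<partial>lborel)"
  proof (rule nn_integral_has_integral_lborel[symmetric])
    have "f \<in> borel_measurable borel"
      by (intro borel_measurable_continuous_onI fc)
    then show "(\<lambda>r. if r \<in> {b..s} then f r else 0) \<in> borel_measurable borel"
      by measurable
    show "((\<lambda>r. if r \<in> {b..s} then f r else 0) has_integral integral {b..s} f) UNIV"
      by (subst has_integral_restrict_UNIV) (rule fi)
  qed (use c in \<open>auto simp: f_def\<close>)
  also have "\<dots> \<le> (\<integral>\<^sup>+r. ennreal (f r) \<partial>lborel)"
    using c by (intro nn_integral_mono) (auto simp: f_def)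
  finally show ?thesis by (simp add: f_def)
qed

text \<open>An empty index set is excluded because \<open>0 powr 0 = 0\<close>, while the empty
  product is 1.\<close>

lemma powr_sum_nonempty:
  fixes y :: real
  assumes "finite I" "I \<noteq> {}"
  shows "y powr (\<Sum>i\<in>I. f i) = (\<Prod>i\<in>I. y powr f i)"
  using assms by (induction I rule: finite_ne_induct) (simp_all add: powr_add)

lemma sum_inverse_pbar:
  fixes p :: "'n::finite \<Rightarrow> real"
  assumes "\<forall>i. p i > 1"
  shows "(\<Sum>i\<in>UNIV. 1 / p i) = real CARD('n) / pbar p"
  using assms by (simp add: pbar_def field_simps)

lemma pbar_gt_1:
  fixes p :: "'n::finite \<Rightarrow> real"
  assumes "\<forall>i. p i > 1"
  shows "pbar p > 1"
proof -
  have "(\<Sum>i\<in>UNIV. 1 / p i) < (\<Sum>i\<in>(UNIV::'n set). 1)"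
    using assms by (intro sum_strict_mono) (auto simp: less_trans[OF zero_less_one] divide_less_eq)
  moreover have "(\<Sum>i\<in>UNIV. 1 / p i) > 0"
    using assms by (intro sum_pos) (auto intro: less_trans[of 0 1])
  ultimately show ?thesis
    by (simp add: pbar_def field_simps)
qed

text \<open>Derivatives are asked for along the coordinate directions only: this is all that the
  fundamental theorem of calculus on lines uses. The condition at parameter 0 is imposed at every
  \<open>x\<close> and so covers all points of every line.\<close>

definition lines_C1 :: "(real^'n \<Rightarrow> real) \<Rightarrow> ('n \<Rightarrow> real^'n::finite \<Rightarrow> real) \<Rightarrow> bool" where
  "lines_C1 w D \<longleftrightarrow> continuous_on UNIV w \<and> (\<exists>R. \<forall>x. norm x > R \<longrightarrow> w x = 0) \<and>
     (\<forall>i. continuous_on UNIV (D i) \<and>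
       (\<forall>x. ((\<lambda>s. w (x + s *\<^sub>R axis i 1)) has_real_derivative D i x) (at 0)))"

lemma lines_C1_line:
  assumes "lines_C1 w D"
  shows "((\<lambda>s. w (x + s *\<^sub>R axis i 1)) has_real_derivative D i (x + r *\<^sub>R axis i 1)) (at r)"
proof -
  have "((\<lambda>s. w (x + r *\<^sub>R axis i 1 + s *\<^sub>R axis i 1)) has_real_derivative D i (x + r *\<^sub>R axis i 1)) (at (r - r))"
    using assms by (simp add: lines_C1_def)
  then have "((\<lambda>s. w (x + r *\<^sub>R axis i 1 + (s - r) *\<^sub>R axis i 1)) has_real_derivative
      D i (x + r *\<^sub>R axis i 1) * 1) (at r)"
    by (rule DERIV_chain2) (auto intro!: derivative_eq_intros)
  then show ?thesis by (simp add: algebra_simps)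
qed

lemma lines_C1_line_int:
  fixes w :: "real^'n::finite \<Rightarrow> real"
  assumes w: "lines_C1 w D" and c: "c > 1"
  shows "ennreal (\<bar>w (\<chi> j. x j)\<bar> powr c) \<le>
    line_int i (\<lambda>x. ennreal (c * \<bar>w (\<chi> j. x j)\<bar> powr (c - 1) * \<bar>D i (\<chi> j. x j)\<bar>)) x"
proof -
  obtain R where R: "\<And>x. norm x > R \<Longrightarrow> w x = 0"
    using w by (auto simp: lines_C1_def)
  \<comment> \<open>With the \<open>i\<close>-th coordinate set to 0, the norm of
    \<open>z + s *\<^sub>R axis i 1\<close> is at least \<open>\<bar>s\<bar>\<close>, so that
    \<open>w\<close> vanishes on the line for very negative \<open>s\<close>.\<close>
  define z :: "real^'n" where "z = (\<chi> j. (x(i := 0)) j)"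
  have eq: "(\<chi> j. (x(i := s)) j) = z + s *\<^sub>R axis i 1" for s
    by (auto simp: z_def vec_eq_iff axis_def)
  have "ennreal (\<bar>w (z + x i *\<^sub>R axis i 1)\<bar> powr c)
      \<le> (\<integral>\<^sup>+r. ennreal (c * \<bar>w (z + r *\<^sub>R axis i 1)\<bar> powr (c - 1) * \<bar>D i (z + r *\<^sub>R axis i 1)\<bar>) \<partial>lborel)"
  proof (rule abs_powr_le_line_integral[OF c lines_C1_line[OF w]])
    have "continuous_on UNIV (D i)"
      using w by (auto simp: lines_C1_def)
    then show "continuous_on UNIV (\<lambda>r. D i (z + r *\<^sub>R axis i 1))"
      by (rule continuous_on_compose2) (auto intro!: continuous_intros)
    fix s assume s: "s \<le> - (\<bar>R\<bar> + 1)"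
    have "\<bar>s\<bar> \<le> norm (z + s *\<^sub>R axis i 1)"
      using component_le_norm_cart[of "z + s *\<^sub>R axis i 1" i] by (simp add: z_def axis_def)
    with s show "w (z + s *\<^sub>R axis i 1) = 0"
      by (intro R) auto
  qed
  then show ?thesis
    using eq[of "x i"] by (simp add: line_int_def eq)
qed

lemma lines_C1_measurable:
  assumes "lines_C1 w D"
  shows "w \<in> borel_measurable borel" "D i \<in> borel_measurable borel"
  using assms by (auto simp: lines_C1_def intro!: borel_measurable_continuous_onI)

text \<open>Justifies the cancellation of a power of this integral in the proof of Troisi's
  inequality.\<close>

lemma lines_C1_integral_finite:
  fixes w :: "real^'n::finite \<Rightarrow> real"
  assumes w: "lines_C1 w D" and "c \<ge> 0"
  shows "(\<integral>\<^sup>+x. ennreal (\<bar>w x\<bar> powr c) \<partial>lborel) < top"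
proof -
  obtain R where R: "\<And>x. norm x > R \<Longrightarrow> w x = 0"
    using w by (auto simp: lines_C1_def)
  have "compact (w ` cball 0 R)"
    using w by (intro compact_continuous_image) (auto simp: lines_C1_def intro: continuous_on_subset)
  then obtain M where M: "\<And>x. x \<in> cball 0 R \<Longrightarrow> \<bar>w x\<bar> \<le> M"
    using compact_imp_bounded by (force simp: bounded_iff)
  have "(\<integral>\<^sup>+x. ennreal (\<bar>w x\<bar> powr c) \<partial>lborel) \<le>
      (\<integral>\<^sup>+x. ennreal (\<bar>M\<bar> powr c) * indicator (cball 0 R) (x :: real^'n) \<partial>lborel)"
  proof (intro nn_integral_mono)
    fix x :: "real^'n"
    show "ennreal (\<bar>w x\<bar> powr c) \<le> ennreal (\<bar>M\<bar> powr c) * indicator (cball 0 R) x"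
    proof (cases "x \<in> cball 0 R")
      case True
      then show ?thesis
        using M[OF True] \<open>c \<ge> 0\<close> by (auto intro!: ennreal_leI powr_mono2)
    qed (use R[of x] in auto)
  qed
  also have "\<dots> < top"
    using emeasure_lborel_cball_finite[of "0 :: real^'n" R]
    by (subst nn_integral_cmult_indicator) (auto simp: ennreal_mult_less_top)
  finally show ?thesis .
qed

text \<open>Gagliardo's argument with a separate exponent \<open>c i\<close> for each direction.
  Loomis--Whitney reduces the integral \<open>I\<close> of \<open>\<bar>w\<bar> powr q\<close> to
  integrals of \<open>\<bar>w\<bar> powr (c i - 1) * \<bar>D i\<bar>\<close>. By the choice of
  \<open>c i\<close>, Hoelder's inequality with exponent \<open>p i\<close> splits each of them into
  a power of the same \<open>I\<close> and a power of the integral \<open>J i\<close> of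
  \<open>\<bar>D i\<bar> powr p i\<close>.\<close>

theorem troisi_inequality:
  fixes p :: "'n::finite \<Rightarrow> real"
  assumes p: "\<forall>i. p i > 1" and pN: "pbar p < real CARD('n)"
  obtains C where "0 \<le> C" and "\<And>w D. lines_C1 w D \<Longrightarrow>
    epow (\<integral>\<^sup>+x. ennreal (\<bar>w x\<bar> powr pbar_star p) \<partial>lborel) (pbar p / pbar_star p)
     \<le> ennreal C * (\<Prod>i\<in>UNIV. epow (\<integral>\<^sup>+x. ennreal (\<bar>D i x\<bar> powr p i) \<partial>lborel)
          (pbar p / (real CARD('n) * p i)))"
proof -
  define N where "N = real CARD('n)"
  define m where "m = N - 1"
  define P where "P = pbar p"
  define q where "q = pbar_star p"
  \<comment> \<open>chosen such that \<open>(c i - 1) * p i / (p i - 1) = q\<close> and \<open>(\<Sum>i\<in>UNIV. c i) = (N - 1) * q\<close>\<close>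
  define c where "c i = 1 + q * (1 - 1 / p i)" for i
  have P1: "P > 1" using pbar_gt_1[OF p] by (simp add: P_def)
  have PN: "P < N" using pN by (simp add: P_def N_def)
  have m0: "m > 0" using P1 PN by (simp add: m_def)
  have N2: "CARD('n) \<ge> 2" using m0 by (simp add: m_def N_def)
  have q: "q = N * P / (N - P)" by (simp add: q_def pbar_star_def N_def P_def)
  have q0: "q > 0" using q P1 PN by simp
  have sump: "(\<Sum>i\<in>UNIV. 1 / p i) = N / P"
    using sum_inverse_pbar[OF p] by (simp add: N_def P_def)
  have p1: "p i > 1" for i using p by simp
  have c1: "c i > 1" for i
    using p1[of i] q0 by (simp add: c_def)
  \<comment> \<open>The total power of \<open>I\<close> that Hoelder's inequality produces on the
    right. It is smaller than 1 because \<open>P < N\<close>, so a positive power of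
    \<open>I\<close> remains on the left.\<close>
  define \<alpha> where "\<alpha> = (\<Sum>i\<in>UNIV. (1 - 1 / p i) / m)"
  have \<alpha>: "\<alpha> = (N - N / P) / m"
    by (simp add: \<alpha>_def sum_divide_distrib[symmetric] sum_subtractf sump N_def)
  have \<alpha>0: "\<alpha> > 0"
    unfolding \<alpha> using P1 PN m0 by (simp add: field_simps)
  have \<alpha>1: "1 - \<alpha> = (N - P) / (P * m)"
    unfolding \<alpha> using P1 m0 by (simp add: field_simps) (simp add: m_def algebra_simps)
  have sumc: "(\<Sum>i\<in>UNIV. c i / m) = q"
  proof -
    have "(\<Sum>i\<in>UNIV. c i) = N + q * (N - N / P)"
      by (simp add: c_def sum.distrib sum_distrib_left[symmetric] sum_subtractf sump N_def)
    also have "\<dots> = q * m"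
      using P1 PN by (simp add: q m_def field_simps)
    finally show ?thesis
      using m0 by (simp add: sum_divide_distrib[symmetric])
  qed
  \<comment> \<open>Raising to this power turns the exponent \<open>1 - \<alpha>\<close> of
    \<open>I\<close> into \<open>P / q\<close> and the exponents of the \<open>J i\<close> into
    \<open>P / (N * p i)\<close>. The latter add up to 1, as needed for Hoelder's inequality in
    time.\<close>
  define \<beta> where "\<beta> = P * m / N"
  have \<beta>0: "\<beta> > 0" using P1 PN m0 by (simp add: \<beta>_def)
  define C1 where "C1 = (\<Prod>i\<in>UNIV. c i powr (1 / m))"
  have main: "epow (\<integral>\<^sup>+x. ennreal (\<bar>w x\<bar> powr q) \<partial>lborel) (P / q)
     \<le> ennreal (C1 powr \<beta>) * (\<Prod>i\<in>UNIV. epow (\<integral>\<^sup>+x. ennreal (\<bar>D i x\<bar> powr p i) \<partial>lborel) (P / (N * p i)))"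
    if w: "lines_C1 w D" for w :: "real^'n \<Rightarrow> real" and D
  proof -
    note [measurable] = lines_C1_measurable[OF w]
    define I where "I = (\<integral>\<^sup>+x. ennreal (\<bar>w x\<bar> powr q) \<partial>lborel)"
    define J where "J i = (\<integral>\<^sup>+x. ennreal (\<bar>D i x\<bar> powr p i) \<partial>lborel)" for i
    define g where "g i x = ennreal (c i * \<bar>w x\<bar> powr (c i - 1) * \<bar>D i x\<bar>)" for i x
    define G where "G i x = g i (\<chi> j. x j)" for i x
    have [measurable]: "g i \<in> borel_measurable borel" for i
      unfolding g_def by measurable
    have [measurable]: "G i \<in> borel_measurable coord_measure" for i
      unfolding G_def by measurable
    have I_fin: "I < top"
      unfolding I_def using q0 by (intro lines_C1_integral_finite[OF w]) auto
    \<comment> \<open>The exponents \<open>c i / m\<close> add up to \<open>q\<close>, so the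
      product of the bounds on the \<open>N\<close> lines through a point bounds
      \<open>\<bar>w\<bar> powr q\<close> there.\<close>
    have pt: "ennreal (\<bar>w (\<chi> j. x j)\<bar> powr q) \<le> (\<Prod>i\<in>UNIV. epow (line_int i (G i) x) (1 / m))" for x
    proof -
      define y where "y = \<bar>w (\<chi> j. x j)\<bar>"
      have "ennreal (y powr q) = (\<Prod>i\<in>UNIV. epow (ennreal (y powr c i)) (1 / m))"
        by (simp add: epow_ennreal powr_powr prod_ennreal sumc[symmetric] powr_sum_nonempty)
      also have "\<dots> \<le> (\<Prod>i\<in>UNIV. epow (line_int i (G i) x) (1 / m))"
        unfolding y_def G_def g_def using m0
        by (intro prod_mono_ennreal epow_mono lines_C1_line_int[OF w c1]) auto
      finally show ?thesis by (simp add: y_def)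
    qed
    have "I = (\<integral>\<^sup>+x. ennreal (\<bar>w (\<chi> j. x j)\<bar> powr q) \<partial>coord_measure)"
      unfolding I_def by (rule nn_integral_lborel_vec) measurable
    also have "\<dots> \<le> (\<integral>\<^sup>+x. (\<Prod>i\<in>UNIV. epow (line_int i (G i) x) (1 / m)) \<partial>coord_measure)"
      by (intro nn_integral_mono pt)
    also have "\<dots> \<le> (\<Prod>i\<in>UNIV. epow (integral\<^sup>N coord_measure (G i)) (1 / m))"
      unfolding m_def N_def by (rule loomis_whitney) (auto simp: N2)
    also have "\<dots> = (\<Prod>i\<in>UNIV. epow (\<integral>\<^sup>+x. g i x \<partial>lborel) (1 / m))"
      by (simp add: nn_integral_lborel_vec G_def[abs_def])
    also have "\<dots> \<le> (\<Prod>i\<in>UNIV. epow (ennreal (c i) * (epow I (1 - 1 / p i) * epow (J i) (1 / p i))) (1 / m))"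
    proof (intro prod_mono_ennreal epow_mono)
      fix i
      have "(\<integral>\<^sup>+x. g i x \<partial>lborel) = (\<integral>\<^sup>+x. ennreal (c i) *
          (epow (ennreal (\<bar>w x\<bar> powr q)) (1 - 1 / p i) * epow (ennreal (\<bar>D i x\<bar> powr p i)) (1 / p i)) \<partial>lborel)"
        using p1[of i] c1[of i] unfolding g_def
        by (intro nn_integral_cong)
           (simp add: epow_ennreal powr_powr ennreal_mult[symmetric] c_def algebra_simps)
      also have "\<dots> = ennreal (c i) * (\<integral>\<^sup>+x.
          epow (ennreal (\<bar>w x\<bar> powr q)) (1 - 1 / p i) * epow (ennreal (\<bar>D i x\<bar> powr p i)) (1 / p i) \<partial>lborel)"
        by (intro nn_integral_cmult) measurable
      also have "\<dots> \<le> ennreal (c i) * (epow I (1 - 1 / p i) * epow (J i) (1 / p i))"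
        unfolding I_def J_def using p1[of i]
        by (intro mult_left_mono holder2_nn_integral) auto
      finally show "(\<integral>\<^sup>+x. g i x \<partial>lborel) \<le> ennreal (c i) * (epow I (1 - 1 / p i) * epow (J i) (1 / p i))" .
    qed (use m0 in auto)
    also have "\<dots> = ennreal C1 * (epow I \<alpha> * (\<Prod>i\<in>UNIV. epow (J i) (1 / (p i * m))))"
    proof -
      have "epow I \<alpha> = (\<Prod>i\<in>UNIV. epow I ((1 - 1 / p i) / m))"
        unfolding \<alpha>_def using m0 p1
        by (intro epow_sum divide_pos_pos) (auto simp: divide_less_eq less_trans[OF zero_less_one p1])
      moreover have "ennreal C1 = (\<Prod>i\<in>UNIV. epow (ennreal (c i)) (1 / m))"
        using c1 by (simp add: C1_def prod_ennreal epow_ennreal less_imp_le[OF less_trans[OF zero_less_one]])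
      ultimately show ?thesis
        by (simp add: epow_mult epow_epow prod.distrib)
    qed
    finally have I_le: "I \<le> ennreal C1 * (epow I \<alpha> * (\<Prod>i\<in>UNIV. epow (J i) (1 / (p i * m))))" .
    \<comment> \<open>Cancelling \<open>epow I \<alpha>\<close> is legitimate since \<open>I\<close>
      is finite and, in the remaining case, nonzero.\<close>
    have red: "epow I (1 - \<alpha>) \<le> ennreal C1 * (\<Prod>i\<in>UNIV. epow (J i) (1 / (p i * m)))"
    proof (cases "I = 0")
      case False
      have pos: "1 - \<alpha> > 0"
        unfolding \<alpha>1 using P1 PN m0 by simp
      have "I = epow I \<alpha> * epow I (1 - \<alpha>)"
        using epow_add[of \<alpha> "1 - \<alpha>" I] \<alpha>0 pos by simp
      with I_le have "epow I \<alpha> * epow I (1 - \<alpha>)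
          \<le> epow I \<alpha> * (ennreal C1 * (\<Prod>i\<in>UNIV. epow (J i) (1 / (p i * m))))"
        by (simp add: mult_ac)
      then show ?thesis
        using False I_fin by (subst (asm) ennreal_mult_le_mult_iff) auto
    qed simp
    have "(1 - \<alpha>) * \<beta> = P / q"
      unfolding \<alpha>1 \<beta>_def q using P1 PN m0 by (simp add: field_simps)
    then have "epow I (P / q) = epow (epow I (1 - \<alpha>)) \<beta>"
      by (simp add: epow_epow)
    also have "\<dots> \<le> epow (ennreal C1 * (\<Prod>i\<in>UNIV. epow (J i) (1 / (p i * m)))) \<beta>"
      using \<beta>0 by (intro epow_mono red) auto
    also have "\<dots> = ennreal (C1 powr \<beta>) * (\<Prod>i\<in>UNIV. epow (J i) (P / (N * p i)))"
    proof -
      have "1 / (p i * m) * \<beta> = P / (N * p i)" for i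
        using m0 p1[of i] by (simp add: \<beta>_def)
      moreover have "C1 \<ge> 0"
        by (auto simp: C1_def intro!: prod_nonneg)
      ultimately show ?thesis
        by (simp add: epow_mult epow_prod epow_epow epow_ennreal)
    qed
    finally show ?thesis by (simp add: I_def J_def)
  qed
  show ?thesis
    by (rule that[of "C1 powr \<beta>", OF _ main[unfolded P_def q_def N_def]]) simp
qed

section \<open>From fixed times to space-time\<close>

lemma nn_integral_slab:
  fixes f :: "'a::euclidean_space \<times> 'b::euclidean_space \<Rightarrow> ennreal"
  assumes [measurable]: "f \<in> borel_measurable borel" "S \<in> sets borel"
  shows "(\<integral>\<^sup>+z\<in>UNIV \<times> S. f z \<partial>lborel) = (\<integral>\<^sup>+t\<in>S. (\<integral>\<^sup>+x. f (x, t) \<partial>lborel) \<partial>lborel)"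
proof -
  have [measurable]: "f \<in> borel_measurable (lborel \<Otimes>\<^sub>M lborel)"
    by (simp add: lborel_prod)
  have "UNIV \<times> S \<in> sets (lborel \<Otimes>\<^sub>M lborel)"
    by (intro pair_measureI) auto
  then have [measurable]: "(\<lambda>z. f z * indicator (UNIV \<times> S) z) \<in> borel_measurable (lborel \<Otimes>\<^sub>M lborel)"
    by measurable
  have "(\<integral>\<^sup>+z\<in>UNIV \<times> S. f z \<partial>lborel) = (\<integral>\<^sup>+z\<in>UNIV \<times> S. f z \<partial>(lborel \<Otimes>\<^sub>M lborel))"
    by (simp add: lborel_prod)
  also have "\<dots> = (\<integral>\<^sup>+t. (\<integral>\<^sup>+x. f (x, t) * indicator (UNIV \<times> S) (x, t) \<partial>lborel) \<partial>lborel)"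
    by (rule lborel_pair.nn_integral_snd[symmetric]) measurable
  also have "\<dots> = (\<integral>\<^sup>+t\<in>S. (\<integral>\<^sup>+x. f (x, t) \<partial>lborel) \<partial>lborel)"
    by (intro nn_integral_cong) (auto simp: indicator_def)
  finally show ?thesis .
qed

text \<open>\<open>S\<close> is left free because the spatial derivatives will be controlled only
  away from the ends of the time interval. The bound \<open>B\<close> is uniform over
  \<open>S\<close>, so it leaves the time integral as a constant.\<close>

theorem slab_interpolation:
  fixes p :: "'n::finite \<Rightarrow> real"
  assumes p: "\<forall>i. p i > 1" and pN: "pbar p < real CARD('n)" and \<sigma>: "\<sigma> \<ge> 1"
  obtains C where "0 \<le> C" and "\<And>w D (S :: real set) B.
    \<lbrakk>w \<in> borel_measurable borel; \<And>i. D i \<in> borel_measurable borel; S \<in> sets borel;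
     \<And>t. t \<in> S \<Longrightarrow> lines_C1 (\<lambda>x. w (x, t)) (\<lambda>i x. D i (x, t));
     \<And>t. t \<in> S \<Longrightarrow> (\<integral>\<^sup>+x. ennreal (\<bar>w (x, t)\<bar> powr \<sigma>) \<partial>lborel) \<le> B\<rbrakk> \<Longrightarrow>
    (\<integral>\<^sup>+z\<in>UNIV \<times> S. ennreal (\<bar>w z\<bar> powr (pbar p * (1 + \<sigma> / real CARD('n)))) \<partial>lborel)
     \<le> ennreal C * (epow B (pbar p / real CARD('n)) *
          (\<Prod>i\<in>UNIV. epow (\<integral>\<^sup>+z\<in>UNIV \<times> S. ennreal (\<bar>D i z\<bar> powr p i) \<partial>lborel)
            (pbar p / (real CARD('n) * p i))))"
proof (rule troisi_inequality[OF p pN], goal_cases)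
  case (1 C)
  note C = 1(2)
  define N where "N = real CARD('n)"
  define P where "P = pbar p"
  define q where "q = pbar_star p"
  define a where "a i = P / (N * p i)" for i
  have P1: "P > 1" using pbar_gt_1[OF p] by (simp add: P_def)
  have PN: "P < N" using pN by (simp add: P_def N_def)
  have q: "q = N * P / (N - P)" by (simp add: q_def pbar_star_def N_def P_def)
  have q0: "q > 0" using q P1 PN by simp
  have p1: "p i > 1" for i using p by simp
  have a0: "a i > 0" for i
    using P1 PN less_trans[OF zero_less_one p1[of i]] by (simp add: a_def)
  have suma: "sum a UNIV = 1"
  proof -
    have "sum a UNIV = P / N * (\<Sum>i\<in>UNIV. 1 / p i)"
      by (simp add: a_def sum_distrib_left)
    then show ?thesis
      using sum_inverse_pbar[OF p] P1 PN by (simp add: N_def P_def)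
  qed
  have exps: "P / q + P / N = 1"
    unfolding q using P1 PN by (simp add: field_simps)
  note sob = 1(3)[folded N_def P_def q_def, folded a_def]
  have main: "(\<integral>\<^sup>+z\<in>UNIV \<times> S. ennreal (\<bar>w z\<bar> powr (P * (1 + \<sigma> / N))) \<partial>lborel)
     \<le> ennreal C * (epow B (P / N) *
          (\<Prod>i\<in>UNIV. epow (\<integral>\<^sup>+z\<in>UNIV \<times> S. ennreal (\<bar>D i z\<bar> powr p i) \<partial>lborel) (a i)))"
    if [measurable]: "w \<in> borel_measurable borel" "\<And>i. D i \<in> borel_measurable borel" "S \<in> sets borel"
      and slice: "\<And>t. t \<in> S \<Longrightarrow> lines_C1 (\<lambda>x. w (x, t)) (\<lambda>i x. D i (x, t))"
      and B: "\<And>t. t \<in> S \<Longrightarrow> (\<integral>\<^sup>+x. ennreal (\<bar>w (x, t)\<bar> powr \<sigma>) \<partial>lborel) \<le> B"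
    for w D B and S :: "real set"
  proof -
    define J where "J i t = (\<integral>\<^sup>+x. ennreal (\<bar>D i (x, t)\<bar> powr p i) \<partial>lborel)" for i t
    have [measurable]: "D i \<in> borel_measurable (lborel \<Otimes>\<^sub>M lborel)" for i
      by (simp add: lborel_prod)
    have "(\<lambda>(t, x). ennreal (\<bar>D i (x, t)\<bar> powr p i)) \<in> borel_measurable (lborel \<Otimes>\<^sub>M lborel)" for i
      by measurable
    then have [measurable]: "J i \<in> borel_measurable borel" for i
      unfolding J_def[abs_def] using lborel.borel_measurable_nn_integral by fastforce
    \<comment> \<open>The exponent is \<open>q * (P / q) + \<sigma> * (P / N)\<close>. Hoelder's
      inequality with the weights \<open>P / q\<close> and \<open>P / N\<close> produces exactly the
      power of the integral that Troisi's inequality bounds, next to a power of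
      \<open>B\<close>.\<close>
    have pt: "(\<integral>\<^sup>+x. ennreal (\<bar>w (x, t)\<bar> powr (P * (1 + \<sigma> / N))) \<partial>lborel)
        \<le> ennreal C * epow B (P / N) * (\<Prod>i\<in>UNIV. epow (J i t) (a i))" if t: "t \<in> S" for t
    proof -
      have "(\<integral>\<^sup>+x. ennreal (\<bar>w (x, t)\<bar> powr (P * (1 + \<sigma> / N))) \<partial>lborel)
        = (\<integral>\<^sup>+x. epow (ennreal (\<bar>w (x, t)\<bar> powr q)) (P / q) *
            epow (ennreal (\<bar>w (x, t)\<bar> powr \<sigma>)) (P / N) \<partial>lborel)"
        using q0 by (intro nn_integral_cong)
          (simp add: epow_ennreal powr_powr ennreal_mult[symmetric] powr_add[symmetric] distrib_left mult_ac)
      also have "\<dots> \<le> epow (\<integral>\<^sup>+x. ennreal (\<bar>w (x, t)\<bar> powr q) \<partial>lborel) (P / q) *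
            epow (\<integral>\<^sup>+x. ennreal (\<bar>w (x, t)\<bar> powr \<sigma>) \<partial>lborel) (P / N)"
        using P1 PN q0 exps by (intro holder2_nn_integral) auto
      also have "\<dots> \<le> (ennreal C * (\<Prod>i\<in>UNIV. epow (J i t) (a i))) * epow B (P / N)"
        unfolding J_def using P1 PN by (intro mult_mono sob[OF slice[OF t]] epow_mono B[OF t]) auto
      finally show ?thesis by (simp add: mult_ac)
    qed
    have "(\<integral>\<^sup>+z\<in>UNIV \<times> S. ennreal (\<bar>w z\<bar> powr (P * (1 + \<sigma> / N))) \<partial>lborel)
      = (\<integral>\<^sup>+t\<in>S. (\<integral>\<^sup>+x. ennreal (\<bar>w (x, t)\<bar> powr (P * (1 + \<sigma> / N))) \<partial>lborel) \<partial>lborel)"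
      by (intro nn_integral_slab) measurable
    also have "\<dots> \<le> (\<integral>\<^sup>+t. ennreal C * epow B (P / N) * (\<Prod>i\<in>UNIV. epow (J i t * indicator S t) (a i)) \<partial>lborel)"
      using pt by (intro nn_integral_mono) (auto simp: indicator_def)
    also have "\<dots> = ennreal C * epow B (P / N) * (\<integral>\<^sup>+t. (\<Prod>i\<in>UNIV. epow (J i t * indicator S t) (a i)) \<partial>lborel)"
      by (intro nn_integral_cmult) measurable
    also have "\<dots> \<le> ennreal C * epow B (P / N) * (\<Prod>i\<in>UNIV. epow (\<integral>\<^sup>+t. J i t * indicator S t \<partial>lborel) (a i))"
      using a0 suma by (intro mult_left_mono holder_nn_integral) auto
    also have "\<dots> = ennreal C * (epow B (P / N) *
          (\<Prod>i\<in>UNIV. epow (\<integral>\<^sup>+z\<in>UNIV \<times> S. ennreal (\<bar>D i z\<bar> powr p i) \<partial>lborel) (a i)))"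
      by (subst nn_integral_slab) (simp_all add: J_def mult_ac)
    finally show ?thesis .
  qed
  show ?case
    by (rule that[OF C main[unfolded P_def N_def a_def]])
qed

section \<open>Mollifiers\<close>

text \<open>For \<open>s > 0\<close> the \<open>k\<close>-th derivative of \<open>exp (- 1 / s)\<close> is \<open>flat_poly k\<close> at \<open>1 / s\<close> times
  \<open>exp (- 1 / s)\<close>.\<close>

fun flat_poly :: "nat \<Rightarrow> real poly" where
  "flat_poly 0 = 1"
| "flat_poly (Suc k) = [:0, 0, 1:] * (flat_poly k - pderiv (flat_poly k))"

definition flat :: "nat \<Rightarrow> real \<Rightarrow> real" where
  "flat k s = (if s > 0 then poly (flat_poly k) (1 / s) * exp (- (1 / s)) else 0)"

lemma poly_times_exp_minus_tendsto_0:
  "((\<lambda>y. poly p y * exp (- y)) \<longlongrightarrow> (0::real)) at_top"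
proof -
  have "((\<lambda>y. \<Sum>i\<le>degree p. coeff p i * (y ^ i / exp y)) \<longlongrightarrow> (0::real)) at_top"
    by (intro tendsto_null_sum tendsto_mult_right_zero tendsto_power_div_exp_0)
  then show ?thesis
    by (simp add: poly_altdef sum_distrib_right exp_minus divide_inverse mult.assoc)
qed

lemma flat_has_real_derivative: "(flat k has_real_derivative flat (Suc k) s) (at s)"
proof -
  consider "s > 0" | "s < 0" | "s = 0" by linarith
  then show ?thesis
  proof cases
    case 1
    have "((\<lambda>s. poly (flat_poly k) (1 / s) * exp (- (1 / s))) has_real_derivative flat (Suc k) s) (at s)"
      using 1 by (auto simp: flat_def field_simps power2_eq_square
          intro!: derivative_eq_intros DERIV_chain2[OF poly_DERIV])
    then show ?thesis
      by (rule has_field_derivative_transform_within_open[of _ _ _ "{0<..}"])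
        (use 1 in \<open>auto simp: flat_def\<close>)
  next
    case 2
    have "((\<lambda>_. 0) has_real_derivative flat (Suc k) s) (at s)"
      using 2 by (simp add: flat_def)
    then show ?thesis
      by (rule has_field_derivative_transform_within_open[of _ _ _ "{..<0}"])
        (use 2 in \<open>auto simp: flat_def\<close>)
  next
    case 3
    \<comment> \<open>With \<open>y = 1 / h\<close>, the additional factor \<open>y\<close> is the
      denominator of the difference quotient \<open>flat k h / h\<close>.\<close>
    have "((\<lambda>y. poly ([:0, 1:] * flat_poly k) y * exp (- y)) \<longlongrightarrow> 0) at_top"
      by (rule poly_times_exp_minus_tendsto_0)
    then have "((\<lambda>h. poly ([:0, 1:] * flat_poly k) (inverse h) * exp (- inverse h)) \<longlongrightarrow> 0) (at_right 0)"
      by (rule filterlim_compose[OF _ filterlim_inverse_at_top_right])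
    then have "((\<lambda>h. flat k h / h) \<longlongrightarrow> 0) (at_right 0)"
      by (rule Lim_transform_eventually)
        (auto simp: eventually_at_right_field flat_def field_simps intro!: exI[of _ 1])
    moreover have "((\<lambda>h. flat k h / h) \<longlongrightarrow> 0) (at_left 0)"
      by (rule Lim_transform_eventually[OF tendsto_const])
        (auto simp: eventually_at_left_field flat_def intro!: exI[of _ "-1"])
    ultimately have "((\<lambda>h. flat k h / h) \<longlongrightarrow> 0) (at 0)"
      by (simp add: filterlim_at_split)
    then show ?thesis
      using 3 by (simp add: DERIV_def flat_def)
  qed
qed

text \<open>All partial derivatives of functions in this class belong to the class again, which yields
  \<^const>\<open>smooth_fun\<close> without any Leibniz formula for higher derivatives.\<close>

inductive smooth_alg :: "('a::euclidean_space \<Rightarrow> real) \<Rightarrow> bool" where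
  lin: "smooth_alg (\<lambda>z. z \<bullet> b)"
| dist: "smooth_alg (\<lambda>z. (z - c) \<bullet> (z - c))"
| const: "smooth_alg (\<lambda>z. r)"
| add: "smooth_alg f \<Longrightarrow> smooth_alg g \<Longrightarrow> smooth_alg (\<lambda>z. f z + g z)"
| mult: "smooth_alg f \<Longrightarrow> smooth_alg g \<Longrightarrow> smooth_alg (\<lambda>z. f z * g z)"
| flat: "smooth_alg f \<Longrightarrow> smooth_alg (\<lambda>z. flat k (f z))"

lemma smooth_alg_derivative:
  assumes "smooth_alg f"
  shows "\<exists>f'. (\<forall>z. (f has_derivative f' z) (at z)) \<and> (\<forall>v. smooth_alg (\<lambda>z. f' z v))"
  using assms
proof induction
  case (lin b)
  have "((\<lambda>z. z \<bullet> b) has_derivative (\<lambda>v. v \<bullet> b)) (at z)" for z :: 'a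
    by (auto intro!: derivative_eq_intros)
  then show ?case
    by (intro exI[of _ "\<lambda>z v. v \<bullet> b"]) (auto intro: smooth_alg.intros)
next
  case (dist c)
  \<comment> \<open>The derivative is written as an inner product with \<open>z\<close> plus a
    constant, so that for fixed \<open>v\<close> it is built from \<open>lin\<close>,
    \<open>const\<close> and \<open>add\<close>.\<close>
  have "((\<lambda>z. (z - c) \<bullet> (z - c)) has_derivative (\<lambda>v. z \<bullet> (2 *\<^sub>R v) + (- 2 * (c \<bullet> v)))) (at z)" for z :: 'a
    by (auto intro!: derivative_eq_intros simp: fun_eq_iff inner_diff_left inner_diff_right inner_commute)
  then show ?case
    by (intro exI[of _ "\<lambda>z v. z \<bullet> (2 *\<^sub>R v) + (- 2 * (c \<bullet> v))"])
       (intro conjI allI smooth_alg.add smooth_alg.lin smooth_alg.const, blast)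
next
  case (const r)
  then show ?case
    by (intro exI[of _ "\<lambda>z v. 0"]) (auto intro: smooth_alg.intros)
next
  case (add f g)
  then obtain f' g' where f': "\<And>z. (f has_derivative f' z) (at z)" "\<And>v. smooth_alg (\<lambda>z. f' z v)"
    "\<And>z. (g has_derivative g' z) (at z)" "\<And>v. smooth_alg (\<lambda>z. g' z v)" by blast
  then show ?case
    by (intro exI[of _ "\<lambda>z v. f' z v + g' z v"])
      (auto intro: smooth_alg.intros has_derivative_add)
next
  case (mult f g)
  then obtain f' g' where f': "\<And>z. (f has_derivative f' z) (at z)" "\<And>v. smooth_alg (\<lambda>z. f' z v)"
    "\<And>z. (g has_derivative g' z) (at z)" "\<And>v. smooth_alg (\<lambda>z. g' z v)" by blast
  then show ?case
    using mult.hyps by (intro exI[of _ "\<lambda>z v. f z * g' z v + f' z v * g z"])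
      (auto intro!: smooth_alg.add smooth_alg.mult has_derivative_mult)
next
  case (flat f k)
  then obtain f' where f': "\<And>z. (f has_derivative f' z) (at z)" "\<And>v. smooth_alg (\<lambda>z. f' z v)"
    by blast
  have "((\<lambda>z. flat k (f z)) has_derivative (\<lambda>v. f' z v * flat (Suc k) (f z))) (at z)" for z
    using has_derivative_compose[OF f'(1) flat_has_real_derivative[unfolded has_field_derivative_def]]
    by (simp add: mult.commute[of "f' z _"])
  then show ?case
    using flat.hyps f' by (intro exI[of _ "\<lambda>z v. f' z v * flat (Suc k) (f z)"])
      (auto intro: smooth_alg.intros)
qed

lemma smooth_alg_differentiable:
  assumes "smooth_alg f"
  shows "f differentiable at z" "continuous_on UNIV f"
    "smooth_alg (\<lambda>z. frechet_derivative f (at z) v)"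
proof -
  from smooth_alg_derivative[OF assms] obtain f'
    where f': "\<And>z. (f has_derivative f' z) (at z)" "\<And>v. smooth_alg (\<lambda>z. f' z v)" by blast
  show "f differentiable at z"
    using f' by (auto simp: differentiable_def)
  show "continuous_on UNIV f"
    using f'(1) has_derivative_continuous by (metis continuous_at_imp_continuous_on)
  have "frechet_derivative f (at z) = f' z" for z
    using frechet_derivative_at[OF f'(1)] by simp
  then show "smooth_alg (\<lambda>z. frechet_derivative f (at z) v)"
    using f' by simp
qed

lemma smooth_alg_smooth_fun:
  assumes "smooth_alg f"
  shows "smooth_fun f"
proof -
  have "smooth_alg (deriv_iter vs f)" for vs
    by (induction vs) (auto simp: assms smooth_alg_differentiable)
  then show ?thesis
    by (auto simp: smooth_fun_def smooth_alg_differentiable)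
qed

text \<open>The classical bump: \<open>exp (- 1 / (1 - (norm z / r)^2))\<close> inside the ball of
  radius \<open>r\<close>, and 0 outside.\<close>

definition bump :: "real \<Rightarrow> 'a::euclidean_space \<Rightarrow> real" where
  "bump r z = flat 0 (1 - (z \<bullet> z) / r\<^sup>2)"

definition mollifier :: "real \<Rightarrow> 'a::euclidean_space \<Rightarrow> real" where
  "mollifier r z = bump r z / (LINT y|lborel. bump r (y :: 'a))"

lemma smooth_alg_mollifier: "smooth_alg (\<lambda>z. mollifier r (c - z))"
proof -
  have "mollifier r (c - z) = flat 0 (1 + (- (1 / r\<^sup>2)) * ((z - c) \<bullet> (z - c)))
      * (1 / (LINT y|lborel. bump r (y :: 'a)))" for z
  proof -
    have "1 - ((c - z) \<bullet> (c - z)) / r\<^sup>2 = 1 + (- (1 / r\<^sup>2)) * ((z - c) \<bullet> (z - c))"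
      by (simp add: inner_diff inner_commute)
    then show ?thesis by (simp only: mollifier_def bump_def) simp
  qed
  then show ?thesis
    by (simp only:) (intro smooth_alg.intros)
qed

lemma mollifier_minus [simp]: "mollifier r (- z) = mollifier r z"
  by (simp add: mollifier_def bump_def)

lemma mollifier_sym: "mollifier r (c - z) = mollifier r (z - c)"
  using mollifier_minus[of r "z - c"] by simp

lemma smooth_alg_mollifier': "smooth_alg (mollifier r)"
  using smooth_alg_mollifier[of r 0] by simp

lemma flat0_nonneg: "0 \<le> flat 0 s" and flat0_le: "flat 0 s \<le> 1"
  by (auto simp: flat_def)

lemma bump_nonneg: "0 \<le> bump r z" and bump_le: "bump r z \<le> 1"
  by (simp_all add: bump_def flat0_nonneg flat0_le)

lemma bump_eq_0:
  assumes "r > 0" "norm z \<ge> r"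
  shows "bump r z = 0"
proof -
  have "\<not> (norm z)\<^sup>2 < r\<^sup>2"
    using assms power_mono[of r "norm z" 2] by linarith
  then show ?thesis
    using assms by (simp add: bump_def flat_def dot_square_norm)
qed

lemma bump_pos: "r > 0 \<Longrightarrow> norm z < r \<Longrightarrow> bump r z > 0"
  using power_strict_mono[of "norm z" r 2] by (simp add: bump_def flat_def dot_square_norm)

lemma bump_measurable [measurable]: "bump r \<in> borel_measurable borel"
proof -
  have [measurable]: "flat 0 \<in> borel_measurable borel"
    by (intro borel_measurable_continuous_onI continuous_at_imp_continuous_on)
       (auto intro: DERIV_isCont flat_has_real_derivative)
  show ?thesis
    unfolding bump_def by measurable
qed

lemma mollifier_measurable [measurable]: "mollifier r \<in> borel_measurable borel"
  unfolding mollifier_def by measurable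

lemma bump_integrable:
  fixes r :: real
  assumes "r > 0"
  shows "integrable lborel (bump r :: 'a::euclidean_space \<Rightarrow> real)"
proof (rule Bochner_Integration.integrable_bound)
  show "integrable lborel (indicat_real (cball (0::'a) r))"
    using emeasure_lborel_cball_finite[of "0::'a" r] by simp
  show "AE z in lborel. norm (bump r z) \<le> norm (indicat_real (cball (0::'a) r) z)"
    using assms by (intro AE_I2) (auto simp: bump_nonneg indicator_def bump_le bump_eq_0)
qed simp

lemma bump_integral_pos:
  fixes r :: real
  assumes "r > 0"
  shows "(LINT y|lborel. bump r (y :: 'a::euclidean_space)) > 0"
proof -
  have "\<not> (AE z in lborel. bump r (z::'a) = 0)"
  proof
    assume "AE z in lborel. bump r (z::'a) = 0"
    then have "AE z in lborel. z \<notin> ball (0::'a) r"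
      by eventually_elim (use bump_pos[OF assms] in force)
    then have "ball (0::'a) r \<in> null_sets lborel"
      by (subst (asm) AE_iff_null_sets[symmetric]) auto
    then show False
      using assms content_ball_pos[of r "0::'a"] by (simp add: null_sets_def measure_def)
  qed
  then have "(LINT y|lborel. bump r (y :: 'a)) \<noteq> 0"
    using bump_integrable[OF assms]
    by (subst integral_nonneg_eq_0_iff_AE) (auto simp: bump_nonneg)
  moreover have "(LINT y|lborel. bump r (y :: 'a)) \<ge> 0"
    by (intro Bochner_Integration.integral_nonneg bump_nonneg)
  ultimately show ?thesis by linarith
qed

context
  fixes r :: real
  assumes r: "r > 0"
begin

lemma mollifier_nonneg: "0 \<le> mollifier r z"
  using bump_integral_pos[OF r] by (simp add: mollifier_def bump_nonneg less_imp_le)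

lemma mollifier_eq_0: "norm z \<ge> r \<Longrightarrow> mollifier r z = 0"
  by (simp add: mollifier_def bump_eq_0[OF r])

lemma mollifier_integrable: "integrable lborel (mollifier r :: 'a::euclidean_space \<Rightarrow> real)"
  unfolding mollifier_def[abs_def] using bump_integrable[OF r, where 'a='a] by simp

lemma mollifier_integral: "(LINT z|lborel. mollifier r (z::'a::euclidean_space)) = 1"
  unfolding mollifier_def using bump_integral_pos[OF r, where 'a='a] by simp

lemma nn_integral_mollifier: "(\<integral>\<^sup>+z. ennreal (mollifier r (z::'a::euclidean_space)) \<partial>lborel) = 1"
  by (subst nn_integral_eq_integral[OF mollifier_integrable])
     (auto simp: mollifier_nonneg mollifier_integral)

lemma continuous_mollifier: "continuous_on UNIV (mollifier r)"
  by (rule smooth_alg_differentiable[OF smooth_alg_mollifier'])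

end

section \<open>Convolution with a mollifier\<close>

definition conv :: "('a::euclidean_space \<Rightarrow> real) \<Rightarrow> ('a \<Rightarrow> real) \<Rightarrow> 'a \<Rightarrow> real" where
  "conv k f z = (LINT y|lborel. f y * k (z - y))"

lemma conv_integrable:
  fixes f k :: "'a::euclidean_space \<Rightarrow> real"
  assumes f: "integrable lborel f" and k: "continuous_on UNIV k" "\<And>z. \<bar>k z\<bar> \<le> M"
  shows "integrable lborel (\<lambda>y. f y * k (z - y))"
proof (rule Bochner_Integration.integrable_bound)
  have [measurable]: "k \<in> borel_measurable borel"
    using k by (intro borel_measurable_continuous_onI)
  show "integrable lborel (\<lambda>y. M * f y)" using f by simp
  show "(\<lambda>y. f y * k (z - y)) \<in> borel_measurable lborel"
    using f by measurable
  show "AE y in lborel. norm (f y * k (z - y)) \<le> norm (M * f y)"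
    using k(2) by (intro AE_I2)
      (auto simp: abs_mult mult.commute[of M] intro!: mult_left_mono order_trans[OF k(2) abs_ge_self])
qed

lemma conv_continuous:
  fixes f k :: "'a::euclidean_space \<Rightarrow> real"
  assumes f: "integrable lborel f" and k: "continuous_on UNIV k" "\<And>z. \<bar>k z\<bar> \<le> M"
  shows "continuous_on UNIV (conv k f)"
proof (intro continuous_at_imp_continuous_on ballI continuous_at_sequentiallyI)
  fix z :: 'a and u assume u: "u \<longlonglongrightarrow> z"
  have [measurable]: "k \<in> borel_measurable borel" "f \<in> borel_measurable borel"
    using k f by (auto intro: borel_measurable_continuous_onI)
  show "(\<lambda>n. conv k f (u n)) \<longlonglongrightarrow> conv k f z"
    unfolding conv_def
  proof (rule integral_dominated_convergence)
    show "integrable lborel (\<lambda>y. M * \<bar>f y\<bar>)" using f by simp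
    show "AE y in lborel. (\<lambda>n. f y * k (u n - y)) \<longlonglongrightarrow> f y * k (z - y)"
      using u by (intro AE_I2 tendsto_intros continuous_on_tendsto_compose[OF k(1)]) auto
    show "AE y in lborel. norm (f y * k (u n - y)) \<le> M * \<bar>f y\<bar>" for n
      using k(2) by (intro AE_I2) (auto simp: abs_mult mult.commute[of M] intro!: mult_left_mono)
  qed measurable
qed

lemma conv_abs_le:
  fixes f k :: "'a::euclidean_space \<Rightarrow> real"
  assumes f: "integrable lborel f" and k: "continuous_on UNIV k" "\<And>z. \<bar>k z\<bar> \<le> M"
  shows "\<bar>conv k f z\<bar> \<le> M * (LINT y|lborel. \<bar>f y\<bar>)"
proof -
  have "\<bar>conv k f z\<bar> \<le> (LINT y|lborel. M * \<bar>f y\<bar>)"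
    unfolding conv_def using f k
    by (intro integral_abs_bound[THEN order_trans] integral_mono integrable_abs conv_integrable[OF f k])
      (auto simp: abs_mult mult.commute[of M] intro!: mult_left_mono)
  then show ?thesis by simp
qed

text \<open>Differentiation under the integral by dominated convergence. The mean value inequality
  along \<open>v\<close> bounds the difference quotients of the kernel by \<open>M'\<close>, so
  \<open>M' * \<bar>f y\<bar>\<close> dominates; \<open>f\<close> need only be integrable.\<close>

lemma conv_has_real_derivative:
  fixes f k k' :: "'a::euclidean_space \<Rightarrow> real"
  assumes f: "integrable lborel f"
    and k: "continuous_on UNIV k" "\<And>z. \<bar>k z\<bar> \<le> M"
    and k': "continuous_on UNIV k'" "\<And>z. \<bar>k' z\<bar> \<le> M'"
    and der: "\<And>z. ((\<lambda>s. k (z + s *\<^sub>R v)) has_real_derivative k' z) (at 0)"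
  shows "((\<lambda>s. conv k f (z + s *\<^sub>R v)) has_real_derivative conv k' f z) (at 0)"
proof -
  have [measurable]: "k \<in> borel_measurable borel" "k' \<in> borel_measurable borel" "f \<in> borel_measurable borel"
    using k k' f by (auto intro: borel_measurable_continuous_onI)
  have der': "((\<lambda>s. k (x + s *\<^sub>R v)) has_real_derivative k' (x + r *\<^sub>R v)) (at r)" for x r
  proof -
    have "((\<lambda>s. k (x + r *\<^sub>R v + s *\<^sub>R v)) has_real_derivative k' (x + r *\<^sub>R v)) (at (r - r))"
      using der by simp
    then have "((\<lambda>s. k (x + r *\<^sub>R v + (s - r) *\<^sub>R v)) has_real_derivative k' (x + r *\<^sub>R v) * 1) (at r)"
      by (rule DERIV_chain2) (auto intro!: derivative_eq_intros)
    then show ?thesis by (simp add: algebra_simps)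
  qed
  have lip: "\<bar>k (x + h *\<^sub>R v) - k x\<bar> \<le> M' * \<bar>h\<bar>" for x h
  proof -
    have "norm ((\<lambda>s. k (x + s *\<^sub>R v)) h - (\<lambda>s. k (x + s *\<^sub>R v)) 0) \<le> M' * norm (h - 0)"
      by (rule field_differentiable_bound[where S=UNIV]) (use der' k'(2) in auto)
    then show ?thesis by simp
  qed
  have "((\<lambda>h. (conv k f (z + h *\<^sub>R v) - conv k f z) / h) \<longlongrightarrow> conv k' f z) (at 0)"
    unfolding tendsto_at_iff_sequentially
  proof (intro allI impI)
    fix X :: "nat \<Rightarrow> real" assume X: "\<forall>i. X i \<in> UNIV - {0}" "X \<longlonglongrightarrow> 0"
    have eq: "(conv k f (z + X n *\<^sub>R v) - conv k f z) / X n
        = (LINT y|lborel. f y * ((k (z - y + X n *\<^sub>R v) - k (z - y)) / X n))" for n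
    proof -
      have "conv k f (z + X n *\<^sub>R v) - conv k f z
          = (LINT y|lborel. f y * k (z + X n *\<^sub>R v - y) - f y * k (z - y))"
        unfolding conv_def
        by (intro Bochner_Integration.integral_diff[symmetric] conv_integrable[OF f k])
      then have "(conv k f (z + X n *\<^sub>R v) - conv k f z) / X n
          = (LINT y|lborel. (f y * k (z + X n *\<^sub>R v - y) - f y * k (z - y)) / X n)"
        by simp
      then show ?thesis
        by (simp add: algebra_simps diff_divide_distrib)
    qed
    have "(\<lambda>n. LINT y|lborel. f y * ((k (z - y + X n *\<^sub>R v) - k (z - y)) / X n))
        \<longlonglongrightarrow> (LINT y|lborel. f y * k' (z - y))"
    proof (rule integral_dominated_convergence)
      show "integrable lborel (\<lambda>y. M' * \<bar>f y\<bar>)" using f by simp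
      show "AE y in lborel. (\<lambda>n. f y * ((k (z - y + X n *\<^sub>R v) - k (z - y)) / X n)) \<longlonglongrightarrow> f y * k' (z - y)"
      proof (intro AE_I2 tendsto_intros)
        fix y
        have "((\<lambda>h. (k (z - y + h *\<^sub>R v) - k (z - y)) / h) \<longlongrightarrow> k' (z - y)) (at 0)"
          using der[of "z - y"] by (simp add: DERIV_def)
        then show "(\<lambda>n. (k (z - y + X n *\<^sub>R v) - k (z - y)) / X n) \<longlonglongrightarrow> k' (z - y)"
          using X unfolding tendsto_at_iff_sequentially by (simp add: comp_def)
      qed
      show "AE y in lborel. norm (f y * ((k (z - y + X n *\<^sub>R v) - k (z - y)) / X n)) \<le> M' * \<bar>f y\<bar>" for n
      proof (intro AE_I2)
        fix y
        have "\<bar>f y\<bar> * \<bar>(k (z - y + X n *\<^sub>R v) - k (z - y)) / X n\<bar> \<le> \<bar>f y\<bar> * M'"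
          using lip[of "z - y" "X n"] X(1) by (intro mult_left_mono) (auto simp: pos_divide_le_eq)
        then show "norm (f y * ((k (z - y + X n *\<^sub>R v) - k (z - y)) / X n)) \<le> M' * \<bar>f y\<bar>"
          by (simp add: abs_mult mult.commute)
      qed
    qed measurable
    then show "((\<lambda>h. (conv k f (z + h *\<^sub>R v) - conv k f z) / h) \<circ> X) \<longlonglongrightarrow> conv k' f z"
      unfolding comp_def eq by (simp only: conv_def)
  qed
  then show ?thesis by (simp add: DERIV_def)
qed

section \<open>Directional derivatives of the mollifier\<close>

definition dmoll :: "real \<Rightarrow> 'a::euclidean_space \<Rightarrow> 'a \<Rightarrow> real" where
  "dmoll r v z = frechet_derivative (mollifier r) (at z) v"

lemma continuous_dmoll: "continuous_on UNIV (dmoll r v)"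
  unfolding dmoll_def
  by (intro smooth_alg_differentiable smooth_alg_mollifier')

lemma mollifier_has_derivative: "(mollifier r has_derivative (\<lambda>v. dmoll r v z)) (at z)"
  unfolding dmoll_def
  by (rule frechet_derivative_works[THEN iffD1]) (rule smooth_alg_differentiable[OF smooth_alg_mollifier'])

lemma mollifier_line_derivative:
  "((\<lambda>s. mollifier r (z + s *\<^sub>R v)) has_real_derivative dmoll r v z) (at 0)"
proof -
  have "((\<lambda>s::real. z + s *\<^sub>R v) has_derivative (\<lambda>s. s *\<^sub>R v)) (at 0)"
    by (auto intro!: derivative_eq_intros)
  moreover have "(mollifier r has_derivative (\<lambda>v. dmoll r v z)) (at (z + 0 *\<^sub>R v))"
    using mollifier_has_derivative by simp
  ultimately have "((\<lambda>s::real. mollifier r (z + s *\<^sub>R v)) has_derivative (\<lambda>s. dmoll r (s *\<^sub>R v) z)) (at 0)"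
    by (rule has_derivative_compose)
  moreover have "dmoll r (s *\<^sub>R v) z = dmoll r v z * s" for s
    using linear_scale[OF has_derivative_linear[OF mollifier_has_derivative[of r z]], of s v] by simp
  ultimately show ?thesis
    by (simp add: has_field_derivative_def)
qed

lemma dmoll_eq_0:
  assumes "r > 0" "norm z > r"
  shows "dmoll r v z = 0"
proof -
  have "((\<lambda>z. 0::real) has_derivative (\<lambda>v. 0)) (at z)" by simp
  then have "(mollifier r has_derivative (\<lambda>v. 0)) (at z)"
  proof (rule has_derivative_transform_within_open)
    show "open (- cball 0 r :: 'a set)" by auto
      fix x :: 'a assume "x \<in> - cball 0 r"
    then show "0 = mollifier r x"
      using mollifier_eq_0[OF assms(1), of x] by auto
  qed (use assms in auto)
  from has_derivative_unique[OF mollifier_has_derivative this] show ?thesis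
    by (simp add: fun_eq_iff)
qed

lemma compact_support_bounded:
  fixes k :: "'a::euclidean_space \<Rightarrow> real"
  assumes "continuous_on UNIV k" "\<And>z. norm z > r \<Longrightarrow> k z = 0"
  shows "\<exists>M\<ge>0. \<forall>z. \<bar>k z\<bar> \<le> M"
proof -
  have "compact (k ` cball 0 r)"
    using assms by (intro compact_continuous_image) (auto intro: continuous_on_subset)
  then obtain M where M: "\<And>z. z \<in> cball 0 r \<Longrightarrow> \<bar>k z\<bar> \<le> M"
    using compact_imp_bounded by (force simp: bounded_iff)
  have "\<bar>k z\<bar> \<le> \<bar>M\<bar>" for z
  proof (cases "z \<in> cball 0 r")
    case True
    then show ?thesis using M[of z] by linarith
  qed (use assms(2)[of z] in auto)
  then show ?thesis by (intro exI[of _ "\<bar>M\<bar>"]) auto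
qed

lemma dmoll_bounded:
  assumes "r > 0"
  shows "\<exists>M\<ge>0. \<forall>z. \<bar>dmoll r v z\<bar> \<le> M"
  by (rule compact_support_bounded[OF continuous_dmoll]) (rule dmoll_eq_0[OF assms])

lemma mollifier_bounded:
  assumes "r > 0"
  shows "\<exists>M\<ge>0. \<forall>z. \<bar>mollifier r z\<bar> \<le> M"
  by (rule compact_support_bounded[where r=r, OF continuous_mollifier[OF assms]])
     (rule mollifier_eq_0[OF assms less_imp_le])

section \<open>Mollification does not increase Lebesgue norms\<close>

lemma nn_integral_lborel_shift:
  assumes [measurable]: "f \<in> borel_measurable borel"
  shows "(\<integral>\<^sup>+z. f (z - y) \<partial>lborel) = (\<integral>\<^sup>+z. f (z :: 'a::euclidean_space) \<partial>lborel)"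
proof -
  have "(\<integral>\<^sup>+z. f z \<partial>lborel) = (\<integral>\<^sup>+z. f z \<partial>distr lborel borel ((+) (- y)))"
    by (simp add: lborel_distr_plus)
  also have "\<dots> = (\<integral>\<^sup>+z. f (z - y) \<partial>lborel)"
    by (subst nn_integral_distr) (auto simp: add.commute)
  finally show ?thesis by simp
qed

context
  fixes r :: real
  assumes r: "r > 0"
begin

lemma nn_integral_mollifier_shift:
  "(\<integral>\<^sup>+z. ennreal (mollifier r (z - y :: 'a::euclidean_space)) \<partial>lborel) = 1"
  using nn_integral_lborel_shift[of "\<lambda>z::'a. ennreal (mollifier r z)" y] nn_integral_mollifier[OF r]
  by simp

text \<open>Jensen's inequality for the probability density \<open>mollifier r (z - y)\<close>. For
  \<open>q > 1\<close> it is Hoelder's inequality after splitting the density into its powers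
  \<open>1 / q\<close> and \<open>1 - 1 / q\<close>.\<close>

lemma conv_mollifier_powr_le:
  fixes f :: "'a::euclidean_space \<Rightarrow> real"
  assumes [measurable]: "f \<in> borel_measurable borel" and q: "q \<ge> 1"
  shows "ennreal (\<bar>conv (mollifier r) f z\<bar> powr q)
    \<le> (\<integral>\<^sup>+y. ennreal (\<bar>f y\<bar> powr q) * ennreal (mollifier r (z - y)) \<partial>lborel)"
proof -
  have le: "ennreal \<bar>conv (mollifier r) f z\<bar> \<le> (\<integral>\<^sup>+y. ennreal \<bar>f y\<bar> * ennreal (mollifier r (z - y)) \<partial>lborel)"
  \<comment> \<open>If the integrand is not integrable, \<open>conv\<close> has the default value 0
    and the bound is trivial; hence \<open>f\<close> is only assumed measurable.\<close>
  proof (cases "integrable lborel (\<lambda>y. f y * mollifier r (z - y))")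
    case True
    from integral_norm_bound_ennreal[OF this] show ?thesis
      by (simp add: conv_def abs_mult mollifier_nonneg[OF r] ennreal_mult)
  qed (simp add: conv_def not_integrable_integral_eq)
  show ?thesis
  proof (cases "q = 1")
    case True
    then show ?thesis using le by simp
  next
    case False
    with q have q: "q > 1" by simp
    have "(\<integral>\<^sup>+y. ennreal \<bar>f y\<bar> * ennreal (mollifier r (z - y)) \<partial>lborel)
      = (\<integral>\<^sup>+y. epow (ennreal (\<bar>f y\<bar> powr q) * ennreal (mollifier r (z - y))) (1 / q)
          * epow (ennreal (mollifier r (z - y))) (1 - 1 / q) \<partial>lborel)"
    proof (intro nn_integral_cong)
      fix y
      have "mollifier r (z - y) powr (1 / q) * mollifier r (z - y) powr (1 - 1 / q) = mollifier r (z - y)"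
        using mollifier_nonneg[OF r, of "z - y"] by (simp add: powr_add[symmetric])
      then show "ennreal \<bar>f y\<bar> * ennreal (mollifier r (z - y)) =
          epow (ennreal (\<bar>f y\<bar> powr q) * ennreal (mollifier r (z - y))) (1 / q)
          * epow (ennreal (mollifier r (z - y))) (1 - 1 / q)"
        using q by (simp add: epow_mult epow_ennreal mollifier_nonneg[OF r] powr_powr powr_mult mult.assoc
            flip: ennreal_mult)
    qed
    also have "\<dots> \<le> epow (\<integral>\<^sup>+y. ennreal (\<bar>f y\<bar> powr q) * ennreal (mollifier r (z - y)) \<partial>lborel) (1 / q)
          * epow (\<integral>\<^sup>+y. ennreal (mollifier r (z - y)) \<partial>lborel) (1 - 1 / q)"
      using q by (intro holder2_nn_integral) auto
    also have "\<dots> = epow (\<integral>\<^sup>+y. ennreal (\<bar>f y\<bar> powr q) * ennreal (mollifier r (z - y)) \<partial>lborel) (1 / q)"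
      by (simp add: mollifier_sym[of r z] nn_integral_mollifier_shift)
    finally have "epow (ennreal \<bar>conv (mollifier r) f z\<bar>) q \<le>
        epow (epow (\<integral>\<^sup>+y. ennreal (\<bar>f y\<bar> powr q) * ennreal (mollifier r (z - y)) \<partial>lborel) (1 / q)) q"
      using le q by (intro epow_mono) auto
    then show ?thesis
      using q by (simp add: epow_epow epow_ennreal)
  qed
qed

lemma nn_integral_conv_mollifier_le:
  fixes f :: "'a::euclidean_space \<Rightarrow> real"
  assumes [measurable]: "f \<in> borel_measurable borel" and q: "q \<ge> 1"
  shows "(\<integral>\<^sup>+z. ennreal (\<bar>conv (mollifier r) f z\<bar> powr q) \<partial>lborel)
    \<le> (\<integral>\<^sup>+y. ennreal (\<bar>f y\<bar> powr q) \<partial>lborel)"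
proof -
  have "(\<integral>\<^sup>+z. ennreal (\<bar>conv (mollifier r) f z\<bar> powr q) \<partial>lborel)
    \<le> (\<integral>\<^sup>+z. (\<integral>\<^sup>+y. ennreal (\<bar>f y\<bar> powr q) * ennreal (mollifier r (z - y)) \<partial>lborel) \<partial>lborel)"
    by (intro nn_integral_mono conv_mollifier_powr_le[OF assms])
  also have "\<dots> = (\<integral>\<^sup>+y. (\<integral>\<^sup>+z. ennreal (\<bar>f y\<bar> powr q) * ennreal (mollifier r (z - y)) \<partial>lborel) \<partial>lborel)"
    by (rule lborel_pair.Fubini') measurable
  also have "\<dots> = (\<integral>\<^sup>+y. ennreal (\<bar>f y\<bar> powr q) \<partial>lborel)"
    by (subst nn_integral_cmult) (auto simp: nn_integral_mollifier_shift)
  finally show ?thesis .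
qed

text \<open>A slice of the mollified function is controlled by an average of the slices of
  \<open>f\<close>, in which the time \<open>s\<close> has the weight \<open>K s\<close>, the mass
  of the mollifier at time offset \<open>t - s\<close>. The weights have integral 1, so a bound on
  almost every slice of \<open>f\<close> becomes a bound at every \<open>t\<close>.\<close>

lemma nn_integral_conv_mollifier_slice_le:
  fixes f :: "'a::euclidean_space \<times> 'b::euclidean_space \<Rightarrow> real"
  assumes [measurable]: "f \<in> borel_measurable borel" and q: "q \<ge> 1"
    and B: "AE t in lborel. (\<integral>\<^sup>+x. ennreal (\<bar>f (x, t)\<bar> powr q) \<partial>lborel) \<le> B"
  shows "(\<integral>\<^sup>+x. ennreal (\<bar>conv (mollifier r) f (x, t)\<bar> powr q) \<partial>lborel) \<le> B"
proof -
  have [measurable]: "f \<in> borel_measurable (lborel \<Otimes>\<^sub>M lborel)"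
    "mollifier r \<in> borel_measurable ((lborel :: 'a measure) \<Otimes>\<^sub>M (lborel :: 'b measure))"
    by (simp_all add: lborel_prod)
  let ?m = "\<lambda>x y s. ennreal (mollifier r (x - y :: 'a, t - s :: 'b))"
  let ?f = "\<lambda>y s. ennreal (\<bar>f (y, s)\<bar> powr q)"
  define K where "K s = (\<integral>\<^sup>+x. ?m x 0 s \<partial>lborel)" for s
  have K: "(\<integral>\<^sup>+x. ?m x y s \<partial>lborel) = K s" for y s
    using nn_integral_lborel_shift[of "\<lambda>x. ?m x 0 s" y] by (simp add: K_def)
  have [measurable]: "K \<in> borel_measurable borel"
  proof -
    have "(\<lambda>(s, x). ?m x 0 s) \<in> borel_measurable (lborel \<Otimes>\<^sub>M lborel)"
      by measurable
    then show ?thesis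
      unfolding K_def[abs_def] using lborel.borel_measurable_nn_integral by fastforce
  qed
  have "(\<integral>\<^sup>+x. ennreal (\<bar>conv (mollifier r) f (x, t)\<bar> powr q) \<partial>lborel)
    \<le> (\<integral>\<^sup>+x. (\<integral>\<^sup>+z. ennreal (\<bar>f z\<bar> powr q) * ennreal (mollifier r ((x, t) - z)) \<partial>lborel) \<partial>lborel)"
    by (intro nn_integral_mono conv_mollifier_powr_le) (use q in auto)
  also have "\<dots> = (\<integral>\<^sup>+x. (\<integral>\<^sup>+s. (\<integral>\<^sup>+y. ?f y s * ?m x y s \<partial>lborel) \<partial>lborel) \<partial>lborel)"
  proof (intro nn_integral_cong)
    fix x
    have "(\<integral>\<^sup>+z. ennreal (\<bar>f z\<bar> powr q) * ennreal (mollifier r ((x, t) - z)) \<partial>lborel)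
        = (\<integral>\<^sup>+z. ennreal (\<bar>f z\<bar> powr q) * ennreal (mollifier r ((x, t) - z)) \<partial>(lborel \<Otimes>\<^sub>M lborel))"
      by (simp add: lborel_prod)
    also have "\<dots> = (\<integral>\<^sup>+s. (\<integral>\<^sup>+y. ?f y s * ennreal (mollifier r ((x, t) - (y, s))) \<partial>lborel) \<partial>lborel)"
      by (rule lborel_pair.nn_integral_snd[symmetric]) (simp add: lborel_prod)
    finally show "(\<integral>\<^sup>+z. ennreal (\<bar>f z\<bar> powr q) * ennreal (mollifier r ((x, t) - z)) \<partial>lborel)
        = (\<integral>\<^sup>+s. (\<integral>\<^sup>+y. ?f y s * ?m x y s \<partial>lborel) \<partial>lborel)" by simp
  qed
  also have "\<dots> = (\<integral>\<^sup>+s. (\<integral>\<^sup>+x. (\<integral>\<^sup>+y. ?f y s * ?m x y s \<partial>lborel) \<partial>lborel) \<partial>lborel)"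
    by (rule lborel_pair.Fubini') measurable
  also have "\<dots> = (\<integral>\<^sup>+s. (\<integral>\<^sup>+y. (\<integral>\<^sup>+x. ?f y s * ?m x y s \<partial>lborel) \<partial>lborel) \<partial>lborel)"
    by (intro nn_integral_cong lborel_pair.Fubini') measurable
  also have "\<dots> = (\<integral>\<^sup>+s. (\<integral>\<^sup>+y. ?f y s * K s \<partial>lborel) \<partial>lborel)"
    by (intro nn_integral_cong, subst nn_integral_cmult) (auto simp: K)
  also have "\<dots> = (\<integral>\<^sup>+s. (\<integral>\<^sup>+y. ?f y s \<partial>lborel) * K s \<partial>lborel)"
    by (intro nn_integral_cong nn_integral_multc) measurable
  also have "\<dots> \<le> (\<integral>\<^sup>+s. B * K s \<partial>lborel)"
    using B by (intro nn_integral_mono_AE) (auto elim!: eventually_mono intro: mult_right_mono)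
  also have "\<dots> = B * (\<integral>\<^sup>+s. K s \<partial>lborel)"
    by (intro nn_integral_cmult) measurable
  also have "(\<integral>\<^sup>+s. K s \<partial>lborel) = 1"
  proof -
    have "(\<integral>\<^sup>+s. K s \<partial>lborel) = (\<integral>\<^sup>+z. ennreal (mollifier r (fst z :: 'a, t - snd z)) \<partial>(lborel \<Otimes>\<^sub>M lborel))"
      unfolding K_def by (subst lborel_pair.nn_integral_snd[symmetric]) (auto intro!: nn_integral_cong)
    also have "\<dots> = (\<integral>\<^sup>+z. ennreal (mollifier r (z - (0 :: 'a, t))) \<partial>lborel)"
    proof -
      have "mollifier r (fst z :: 'a, t - snd z) = mollifier r (z - (0 :: 'a, t))" for z
        by (simp only: mollifier_def bump_def inner_prod_def)
           (simp add: inner_diff inner_commute add.commute)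
      then show ?thesis by (simp add: lborel_prod)
    qed
    finally show ?thesis by (simp add: nn_integral_mollifier_shift)
  qed
  finally show ?thesis by simp
qed

end

section \<open>Almost everywhere convergence of mollifications\<close>

lemma integrable_compact_support:
  fixes h :: "'a::euclidean_space \<Rightarrow> real"
  assumes h: "continuous_on UNIV h" "\<And>z. norm z > R \<Longrightarrow> h z = 0"
  shows "integrable lborel h"
proof -
  obtain M where M: "\<And>z. \<bar>h z\<bar> \<le> M"
    using compact_support_bounded[OF h] by blast
  show ?thesis
  proof (rule Bochner_Integration.integrable_bound)
    show "integrable lborel (\<lambda>z. M * indicat_real (cball (0::'a) R) z)"
      using emeasure_lborel_cball_finite[of "0::'a" R] by simp
    show "h \<in> borel_measurable lborel"
      using h(1) by (simp add: borel_measurable_continuous_onI)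
    show "AE z in lborel. norm (h z) \<le> norm (M * indicat_real (cball (0::'a) R) z)"
      using M h(2) by (intro AE_I2) (force simp: indicator_def intro: order_trans[OF M abs_ge_self])
  qed
qed

text \<open>\<open>f\<close> is clipped at height \<open>k\<close> and multiplied by a continuous
  hat function \<open>X k\<close>; then \<open>f\<close> inside the clipping is replaced by
  continuous functions converging to it almost everywhere. Clipping and hat function give the second
  limit an integrable bound.\<close>

lemma L1_dense_continuous_compact_support:
  fixes f :: "'a::euclidean_space \<Rightarrow> real"
  assumes f: "integrable lborel f" and e: "e > 0"
  shows "\<exists>h R. continuous_on UNIV h \<and> (\<forall>z. norm z > R \<longrightarrow> h z = 0) \<and> (LINT z|lborel. \<bar>f z - h z\<bar>) < e"
proof -
  have [measurable]: "f \<in> borel_measurable borel" using f by auto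
  define X where "X k z = max 0 (min 1 (real k + 1 - norm z))" for k and z :: 'a
  define cl where "cl k y = max (- real k) (min (real k) y)" for k and y :: real
  have X01: "0 \<le> X k z" "X k z \<le> 1" for k z by (auto simp: X_def)
  have Xc: "continuous_on A (X k)" for k A
    unfolding X_def by (intro continuous_intros)
  have [measurable]: "X k \<in> borel_measurable borel" for k
    using Xc by (intro borel_measurable_continuous_onI)
  have [measurable]: "cl k \<in> borel_measurable borel" for k
    unfolding cl_def by measurable
  define F where "F k z = X k z * cl k (f z)" for k z
  have [measurable]: "F k \<in> borel_measurable borel" for k
    unfolding F_def by measurable
  have cl_le: "\<bar>cl k y\<bar> \<le> \<bar>y\<bar>" "\<bar>cl k y\<bar> \<le> real k" for k y by (auto simp: cl_def)
  have F_le: "\<bar>F k z\<bar> \<le> \<bar>f z\<bar>" for k z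
    using mult_mono[OF X01(2)[of k z] cl_le(1)[of k "f z"]] X01(1)[of k z] by (simp add: F_def abs_mult)
  have "(\<lambda>k. LINT z|lborel. \<bar>f z - F k z\<bar>) \<longlonglongrightarrow> (LINT z|lborel. (\<lambda>_::'a. 0::real) z)"
  proof (rule integral_dominated_convergence)
    show "integrable lborel (\<lambda>z. 2 * \<bar>f z\<bar>)" using f by simp
    show "AE z in lborel. norm \<bar>f z - F k z\<bar> \<le> 2 * \<bar>f z\<bar>" for k
    proof (intro AE_I2)
      fix z
      show "norm \<bar>f z - F k z\<bar> \<le> 2 * \<bar>f z\<bar>"
        using F_le[of k z] by (auto simp: abs_if split: if_splits)
    qed
    show "AE z in lborel. (\<lambda>k. \<bar>f z - F k z\<bar>) \<longlonglongrightarrow> 0"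
    proof (intro AE_I2 tendsto_eventually)
      fix z
      obtain K :: nat where K: "real K \<ge> norm z + \<bar>f z\<bar>" using real_arch_simple by blast
      show "\<forall>\<^sub>F k in sequentially. \<bar>f z - F k z\<bar> = 0"
      proof (rule eventually_sequentiallyI)
        fix k assume "K \<le> k"
        then have k: "real k \<ge> norm z + \<bar>f z\<bar>" using K by linarith
        then have "X k z = 1"
          using norm_ge_zero[of z] by (simp add: X_def)
        moreover have "cl k (f z) = f z"
          using order_trans[OF _ k, of "\<bar>f z\<bar>"] by (auto simp: cl_def abs_le_iff)
        ultimately show "\<bar>f z - F k z\<bar> = 0" by (simp add: F_def)
      qed
    qed
  qed measurable
  then have "eventually (\<lambda>k. (LINT z|lborel. \<bar>f z - F k z\<bar>) < e / 2) sequentially"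
    using e by (intro order_tendstoD(2)[where y=0]) auto
  then obtain k where k: "(LINT z|lborel. \<bar>f z - F k z\<bar>) < e / 2"
    by (auto simp: eventually_sequentially)
  \<comment> \<open>Unfolding this notion provides continuous functions that converge to
    \<open>f\<close> outside a negligible set.\<close>
  have "f measurable_on UNIV"
    by (intro lebesgue_measurable_imp_measurable_on measurable_completion) auto
  then obtain N g where N: "negligible N" and g: "\<And>n. continuous_on UNIV (g n)"
    and lim: "\<And>z. z \<notin> N \<Longrightarrow> (\<lambda>n. g n z) \<longlonglongrightarrow> f z"
    unfolding measurable_on_def by auto
  have AEN: "AE z in lborel. z \<notin> N"
    using N unfolding negligible_iff_null_sets
    by (subst AE_completion_iff[symmetric]) (rule AE_not_in)
  define h where "h n z = X k z * cl k (g n z)" for n z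
  have hc: "continuous_on UNIV (h n)" for n
    unfolding h_def cl_def by (intro continuous_intros Xc g)
  have [measurable]: "h n \<in> borel_measurable borel" for n
    using hc by (intro borel_measurable_continuous_onI)
  have h0: "h n z = 0" if "norm z > real k + 1" for n z
    using that by (simp add: h_def X_def)
  have "(\<lambda>n. LINT z|lborel. \<bar>F k z - h n z\<bar>) \<longlonglongrightarrow> (LINT z|lborel. (\<lambda>_::'a. 0::real) z)"
  proof (rule integral_dominated_convergence)
    show "integrable lborel (\<lambda>z. (2 * real k) * indicat_real (cball (0::'a) (real k + 1)) z)"
      using emeasure_lborel_cball_finite[of "0::'a" "real k + 1"] by simp
    show "AE z in lborel. norm \<bar>F k z - h n z\<bar> \<le> (2 * real k) * indicat_real (cball (0::'a) (real k + 1)) z" for n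
    proof (intro AE_I2)
      fix z :: 'a
      have "\<bar>F k z - h n z\<bar> = X k z * \<bar>cl k (f z) - cl k (g n z)\<bar>"
        using X01(1)[of k z] by (simp add: F_def h_def abs_mult flip: right_diff_distrib)
      also have "\<dots> \<le> X k z * (2 * real k)"
        using X01(1)[of k z] cl_le(2)[of k "f z"] cl_le(2)[of k "g n z"]
        by (intro mult_left_mono) linarith+
      also have "\<dots> \<le> (2 * real k) * indicat_real (cball (0::'a) (real k + 1)) z"
        using X01(2)[of k z] by (auto simp: indicator_def X_def mult_left_le_one_le)
      finally show "norm \<bar>F k z - h n z\<bar> \<le> (2 * real k) * indicat_real (cball (0::'a) (real k + 1)) z"
        by simp
    qed
    show "AE z in lborel. (\<lambda>n. \<bar>F k z - h n z\<bar>) \<longlonglongrightarrow> 0"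
      using AEN
    proof eventually_elim
      case (elim z)
      have "(\<lambda>n. \<bar>F k z - h n z\<bar>) \<longlonglongrightarrow> \<bar>F k z - F k z\<bar>"
        unfolding h_def F_def cl_def by (intro tendsto_intros lim elim)
      then show ?case by simp
    qed
  qed measurable
  then have "eventually (\<lambda>n. (LINT z|lborel. \<bar>F k z - h n z\<bar>) < e / 2) sequentially"
    using e by (intro order_tendstoD(2)[where y=0]) auto
  then obtain n where n: "(LINT z|lborel. \<bar>F k z - h n z\<bar>) < e / 2"
    by (auto simp: eventually_sequentially)
  have hi: "integrable lborel (h n)"
    by (rule integrable_compact_support[OF hc h0])
  have Fi: "integrable lborel (F k)"
    by (rule Bochner_Integration.integrable_bound[OF f]) (auto simp: F_le)
  have "(LINT z|lborel. \<bar>f z - h n z\<bar>) \<le> (LINT z|lborel. \<bar>f z - F k z\<bar> + \<bar>F k z - h n z\<bar>)"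
    using f Fi hi by (intro integral_mono) auto
  also have "\<dots> = (LINT z|lborel. \<bar>f z - F k z\<bar>) + (LINT z|lborel. \<bar>F k z - h n z\<bar>)"
    using f Fi hi by (intro Bochner_Integration.integral_add) auto
  finally have "(LINT z|lborel. \<bar>f z - h n z\<bar>) < e" using k n by linarith
  then show ?thesis
    using hc h0 by blast
qed

lemma mollifier_shift_integral:
  fixes z :: "'a::euclidean_space"
  assumes r: "r > 0"
  shows "integrable lborel (\<lambda>y. mollifier r (z - y))" "(LINT y|lborel. mollifier r (z - y)) = 1"
proof -
  have nn: "(\<integral>\<^sup>+y. ennreal (mollifier r (z - y)) \<partial>lborel) = 1"
    using nn_integral_mollifier_shift[OF r, of z] by (simp add: mollifier_sym[of r z])
  then show "integrable lborel (\<lambda>y. mollifier r (z - y))"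
    by (intro integrableI_nonneg) (auto simp: mollifier_nonneg[OF r])
  show "(LINT y|lborel. mollifier r (z - y)) = 1"
    using nn by (subst integral_eq_nn_integral) (auto simp: mollifier_nonneg[OF r])
qed

lemma conv_mollifier_uniform:
  fixes h :: "'a::euclidean_space \<Rightarrow> real"
  assumes h: "continuous_on UNIV h" "\<And>z. norm z > R \<Longrightarrow> h z = 0" and e: "e > 0"
  shows "\<exists>d>0. \<forall>r z. 0 < r \<and> r < d \<longrightarrow> \<bar>conv (mollifier r) h z - h z\<bar> \<le> e"
proof -
  \<comment> \<open>Of two points closer than 1, either both lie in the ball of radius
    \<open>R + 1\<close>, or both lie outside the ball of radius \<open>R\<close>, where
    \<open>h\<close> vanishes.\<close>
  have "uniformly_continuous_on (cball 0 (R + 1)) h"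
    by (intro compact_uniformly_continuous continuous_on_subset[OF h(1)]) auto
  then obtain d where d: "d > 0"
    "\<And>x y. x \<in> cball 0 (R + 1) \<Longrightarrow> y \<in> cball 0 (R + 1) \<Longrightarrow> dist y x < d \<Longrightarrow> dist (h y) (h x) < e"
    using e unfolding uniformly_continuous_on_def by metis
  have uc: "\<bar>h y - h z\<bar> \<le> e" if yz: "norm (z - y) < min d 1" for y z
  proof (cases "norm z \<le> R + 1 \<and> norm y \<le> R + 1")
    case True
    then show ?thesis
      using d(2)[of z y] yz by (simp add: dist_norm norm_minus_commute)
  next
    case False
    then have "norm z > R" "norm y > R"
      using yz norm_triangle_ineq2[of z y] norm_triangle_ineq2[of y z] by (auto simp: norm_minus_commute)
    then show ?thesis using h(2) e by simp
  qed
  have "\<bar>conv (mollifier r) h z - h z\<bar> \<le> e" if r: "0 < r" "r < min d 1" for r z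
  proof -
    have hi: "integrable lborel (\<lambda>y. h y * mollifier r (z - y))"
    proof -
      obtain M where M: "\<And>z::'a. \<bar>mollifier r z\<bar> \<le> M" using mollifier_bounded[OF r(1)] by blast
      show ?thesis
        by (rule conv_integrable[OF integrable_compact_support continuous_mollifier[OF r(1)] M]) (fact h)+
    qed
    note mi = mollifier_shift_integral[OF r(1), of z]
    have "conv (mollifier r) h z - h z = (LINT y|lborel. h y * mollifier r (z - y) - h z * mollifier r (z - y))"
      unfolding conv_def using hi mi by (subst Bochner_Integration.integral_diff) auto
    then have "\<bar>conv (mollifier r) h z - h z\<bar>
        \<le> (LINT y|lborel. \<bar>h y * mollifier r (z - y) - h z * mollifier r (z - y)\<bar>)"
      using integral_abs_bound by metis
    also have "\<dots> \<le> (LINT y|lborel. e * mollifier r (z - y))"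
    proof (intro integral_mono)
      fix y
      show "\<bar>h y * mollifier r (z - y) - h z * mollifier r (z - y)\<bar> \<le> e * mollifier r (z - y)"
      proof (cases "norm (z - y) < min d 1")
        case True
        then show ?thesis
          using uc[of z y] mollifier_nonneg[OF r(1), of "z - y"]
          by (simp add: abs_mult mult_right_mono flip: left_diff_distrib)
      next
        case False
        then have "mollifier r (z - y) = 0"
          using r by (intro mollifier_eq_0) auto
        then show ?thesis by simp
      qed
    qed (use hi mi in auto)
    also have "\<dots> = e" using mi by simp
    finally show ?thesis .
  qed
  then show ?thesis using d(1) by (intro exI[of _ "min d 1"]) auto
qed

lemma conv_mollifier_continuous:
  fixes f :: "'a::euclidean_space \<Rightarrow> real"
  assumes "r > 0" "integrable lborel f"
  shows "continuous_on UNIV (conv (mollifier r) f)"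
proof -
  obtain M where "\<And>z::'a. \<bar>mollifier r z\<bar> \<le> M" using mollifier_bounded[OF assms(1)] by blast
  then show ?thesis
    by (rule conv_continuous[OF assms(2) continuous_mollifier[OF assms(1)]])
qed

lemma conv_mollifier_integrable:
  fixes f :: "'a::euclidean_space \<Rightarrow> real"
  assumes r: "r > 0" and f: "integrable lborel f"
  shows "integrable lborel (conv (mollifier r) f)"
    "(LINT z|lborel. \<bar>conv (mollifier r) f z\<bar>) \<le> (LINT z|lborel. \<bar>f z\<bar>)"
proof -
  have [measurable]: "conv (mollifier r) f \<in> borel_measurable borel"
    by (intro borel_measurable_continuous_onI conv_mollifier_continuous assms)
  have "(\<integral>\<^sup>+z. ennreal \<bar>conv (mollifier r) f z\<bar> \<partial>lborel) \<le> (\<integral>\<^sup>+z. ennreal \<bar>f z\<bar> \<partial>lborel)"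
    using nn_integral_conv_mollifier_le[OF r, of f 1] f by auto
  also have "\<dots> = ennreal (LINT z|lborel. \<bar>f z\<bar>)"
    using f by (intro nn_integral_eq_integral) auto
  finally have le: "(\<integral>\<^sup>+z. ennreal \<bar>conv (mollifier r) f z\<bar> \<partial>lborel) \<le> ennreal (LINT z|lborel. \<bar>f z\<bar>)" .
  then show i: "integrable lborel (conv (mollifier r) f)"
    by (intro integrableI_bounded) (auto intro: le_less_trans)
  have "ennreal (LINT z|lborel. \<bar>conv (mollifier r) f z\<bar>) \<le> ennreal (LINT z|lborel. \<bar>f z\<bar>)"
    using le i by (subst nn_integral_eq_integral[symmetric]) auto
  then show "(LINT z|lborel. \<bar>conv (mollifier r) f z\<bar>) \<le> (LINT z|lborel. \<bar>f z\<bar>)"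
    by (subst (asm) ennreal_le_iff) auto
qed

lemma conv_mollifier_support:
  assumes r: "r > 0" and h: "\<And>z. norm z > R \<Longrightarrow> h z = 0" and z: "norm z > R + r"
  shows "conv (mollifier r) h z = 0"
proof -
  have "h y * mollifier r (z - y) = 0" for y
  proof (cases "norm y > R")
    case False
    then have "norm (z - y) \<ge> r"
      using z norm_triangle_ineq2[of z y] by linarith
    then show ?thesis by (simp add: mollifier_eq_0[OF r])
  qed (simp add: h)
  then show ?thesis
    unfolding conv_def by (simp only:) simp
qed

lemma conv_diff:
  fixes f h :: "'a::euclidean_space \<Rightarrow> real"
  assumes r: "r > 0" and f: "integrable lborel f" and h: "integrable lborel h"
  shows "conv (mollifier r) (\<lambda>z. f z - h z) z = conv (mollifier r) f z - conv (mollifier r) h z"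
proof -
  obtain M where M: "\<And>z::'a. \<bar>mollifier r z\<bar> \<le> M" using mollifier_bounded[OF r] by blast
  note i = conv_integrable[OF _ continuous_mollifier[OF r] M]
  show ?thesis
    unfolding conv_def left_diff_distrib
    by (intro Bochner_Integration.integral_diff i f h)
qed

text \<open>For a continuous \<open>h\<close> with bounded support the convergence is uniform, on a
  ball of fixed radius \<open>R + 1\<close>. The error \<open>f - h\<close> is small in norm and
  stays small because mollification is a contraction.\<close>

lemma conv_mollifier_L1_tendsto:
  fixes f :: "'a::euclidean_space \<Rightarrow> real"
  assumes f: "integrable lborel f" and rr: "\<And>n. rr n > 0" "rr \<longlonglongrightarrow> 0"
  shows "(\<lambda>n. LINT z|lborel. norm (conv (mollifier (rr n)) f z - f z)) \<longlonglongrightarrow> 0"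
proof (rule LIMSEQ_I)
  fix e :: real assume e: "e > 0"
  obtain h R where h: "continuous_on UNIV h" "\<And>z. norm z > R \<Longrightarrow> h z = 0"
    and fh: "(LINT z|lborel. \<bar>f z - h z\<bar>) < e / 3"
    using L1_dense_continuous_compact_support[OF f, of "e / 3"] e by auto
  have hi: "integrable lborel h" by (rule integrable_compact_support[OF h])
  define V where "V = measure lborel (cball (0::'a) (R + 1))"
  have V: "V \<ge> 0" by (simp add: V_def)
  \<comment> \<open>Makes the uniform error times the volume \<open>V\<close> smaller than
    \<open>e / 3\<close>; the \<open>+ 1\<close> keeps the denominator positive.\<close>
  define e' where "e' = e / (3 * (V + 1))"
  have e': "e' > 0" using e V by (simp add: e'_def)
  have e'V: "e' * V < e / 3"
    using e V by (simp add: e'_def field_simps)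
  obtain d where d: "d > 0" "\<And>r z. 0 < r \<Longrightarrow> r < d \<Longrightarrow> \<bar>conv (mollifier r) h z - h z\<bar> \<le> e'"
    using conv_mollifier_uniform[OF h e'] by blast
  obtain n0 where n0: "\<And>n. n \<ge> n0 \<Longrightarrow> rr n < min d 1"
    using order_tendstoD(2)[OF rr(2), of "min d 1"] d(1) by (auto simp: eventually_sequentially)
  have "norm ((LINT z|lborel. norm (conv (mollifier (rr n)) f z - f z)) - 0) < e" if n: "n \<ge> n0" for n
  proof -
    define r where "r = rr n"
    have r: "r > 0" "r < d" "r < 1" using rr(1) n0[OF n] by (auto simp: r_def)
    have cf: "integrable lborel (conv (mollifier r) f)" and ch: "integrable lborel (conv (mollifier r) h)"
      and cfh: "integrable lborel (conv (mollifier r) (\<lambda>z. f z - h z))"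
      using conv_mollifier_integrable[OF r(1)] f hi by auto
    have pt: "\<bar>conv (mollifier r) h z - h z\<bar> \<le> e' * indicat_real (cball 0 (R + 1)) z" for z
    proof (cases "norm z > R + 1")
      case True
      then have "conv (mollifier r) h z = 0" "h z = 0"
        using r by (auto intro!: conv_mollifier_support[OF r(1), where R=R] h(2))
      then show ?thesis using e' by simp
    qed (use d(2)[OF r(1,2)] in auto)
    have "(LINT z|lborel. norm (conv (mollifier r) f z - f z))
      \<le> (LINT z|lborel. \<bar>conv (mollifier r) (\<lambda>z. f z - h z) z\<bar> + \<bar>f z - h z\<bar>
          + e' * indicat_real (cball 0 (R + 1)) z)"
    proof (intro integral_mono)
      fix z
      have "norm (conv (mollifier r) f z - f z) \<le>
          \<bar>conv (mollifier r) f z - conv (mollifier r) h z\<bar> + \<bar>f z - h z\<bar> + \<bar>conv (mollifier r) h z - h z\<bar>"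
        by simp
      then show "norm (conv (mollifier r) f z - f z) \<le> \<bar>conv (mollifier r) (\<lambda>z. f z - h z) z\<bar>
          + \<bar>f z - h z\<bar> + e' * indicat_real (cball 0 (R + 1)) z"
        using pt[of z] conv_diff[OF r(1) f hi, where z=z] by linarith
    qed (use f hi cf cfh emeasure_lborel_cball_finite[of "0::'a" "R + 1"] in auto)
    also have "\<dots> = (LINT z|lborel. \<bar>conv (mollifier r) (\<lambda>z. f z - h z) z\<bar>)
        + (LINT z|lborel. \<bar>f z - h z\<bar>) + e' * V"
      using f hi cfh emeasure_lborel_cball_finite[of "0::'a" "R + 1"] by (simp add: V_def)
    also have "\<dots> < e"
      using conv_mollifier_integrable(2)[OF r(1), of "\<lambda>z. f z - h z"] f hi fh e'V by auto
    finally show ?thesis by (simp add: r_def)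
  qed
  then show "\<exists>n0. \<forall>n\<ge>n0. norm ((LINT z|lborel. norm (conv (mollifier (rr n)) f z - f z)) - 0) < e"
    by blast
qed

text \<open>Convergence in mean implies convergence almost everywhere along a subsequence, and a
  subsequence is enough for Fatou's lemma.\<close>

theorem conv_mollifier_AE_subseq:
  fixes f :: "'a::euclidean_space \<Rightarrow> real"
  assumes f: "integrable lborel f" and rr: "\<And>n. rr n > 0" "rr \<longlonglongrightarrow> 0"
  shows "\<exists>s. strict_mono s \<and> (AE z in lborel. (\<lambda>n. conv (mollifier (rr (s n))) f z) \<longlonglongrightarrow> f z)"
proof -
  have "\<exists>s. strict_mono s \<and> (AE z in lborel. (\<lambda>n. conv (mollifier (rr (s n))) f z - f z) \<longlonglongrightarrow> 0)"
    using conv_mollifier_integrable(1)[OF rr(1) f] f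
    by (intro tendsto_L1_AE_subseq conv_mollifier_L1_tendsto assms) auto
  then show ?thesis
    by (auto elim!: eventually_mono dest: LIM_zero_cancel)
qed

section \<open>The estimate for localised mollifications\<close>

definition cutoff :: "real \<Rightarrow> 'a::euclidean_space \<Rightarrow> real" where
  "cutoff R x = max 0 (1 - (x \<bullet> x) / R\<^sup>2)"

lemma cutoff_nonneg: "0 \<le> cutoff R x" and cutoff_le: "cutoff R x \<le> 1"
  by (auto simp: cutoff_def)

lemma cutoff_eq_0:
  assumes "R > 0" "norm x \<ge> R"
  shows "cutoff R x = 0"
proof -
  have "R\<^sup>2 \<le> (norm x)\<^sup>2"
    using assms by (intro power_mono) auto
  then show ?thesis
    using assms by (simp add: cutoff_def dot_square_norm)
qed

lemma continuous_cutoff [continuous_intros]: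
  "continuous_on A f \<Longrightarrow> continuous_on A (\<lambda>x. cutoff R (f x))"
  unfolding cutoff_def divide_inverse by (intro continuous_intros)

lemma max_0_power_has_real_derivative:
  fixes y :: real
  assumes "m \<ge> 2"
  shows "((\<lambda>y. max 0 y ^ m) has_real_derivative real m * max 0 y ^ (m - 1)) (at y)"
proof -
  consider "y > 0" | "y < 0" | "y = 0" by linarith
  then show ?thesis
  proof cases
    case 1
    have "((\<lambda>y. y ^ m) has_real_derivative real m * max 0 y ^ (m - 1)) (at y)"
      using 1 by (auto intro!: derivative_eq_intros)
    then show ?thesis
      by (rule has_field_derivative_transform_within_open[of _ _ _ "{0<..}"]) (use 1 in auto)
  next
    case 2
    have "((\<lambda>y. 0) has_real_derivative real m * max 0 y ^ (m - 1)) (at y)"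
      using 2 assms by (simp add: max_def power_0_left)
    then show ?thesis
      by (rule has_field_derivative_transform_within_open[of _ _ _ "{..<0}"]) (use 2 assms in auto)
  next
    case 3
    have "((\<lambda>h. \<bar>h::real\<bar> ^ (m - 1)) \<longlongrightarrow> \<bar>0\<bar> ^ (m - 1)) (at 0)"
      by (intro tendsto_intros)
    then have "((\<lambda>h. \<bar>h::real\<bar> ^ (m - 1)) \<longlongrightarrow> 0) (at 0)"
      using assms by (simp only: power_0_left abs_zero) (simp split: if_splits)
    then have "((\<lambda>h::real. max 0 h ^ m / h) \<longlongrightarrow> 0) (at 0)"
    proof (rule tendsto_0_le[where K=1], intro always_eventually allI)
      fix h :: real
      have "h ^ m = h * h ^ (m - 1)"
        using assms by (cases m) auto
      then show "norm (max 0 h ^ m / h) \<le> norm (\<bar>h\<bar> ^ (m - 1)) * 1"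
        using assms by (cases "h > 0") (auto simp: max_def power_0_left)
    qed
    then show ?thesis
      using 3 assms by (simp add: DERIV_def power_0_left)
  qed
qed

definition dcutoff :: "real \<Rightarrow> nat \<Rightarrow> 'n \<Rightarrow> real^'n::finite \<Rightarrow> real" where
  "dcutoff R m i x = real m * cutoff R x ^ (m - 1) * (- 2 * x $ i / R\<^sup>2)"

lemma cutoff_line_derivative:
  fixes x :: "real^'n::finite"
  assumes "m \<ge> 2"
  shows "((\<lambda>s. cutoff R (x + s *\<^sub>R axis i 1) ^ m) has_real_derivative dcutoff R m i x) (at 0)"
proof -
  have sq: "(x + s *\<^sub>R axis i 1) \<bullet> (x + s *\<^sub>R axis i 1) = x \<bullet> x + 2 * s * x $ i + s\<^sup>2" for s
    by (simp add: inner_add_left inner_add_right inner_axis inner_axis' inner_commute power2_eq_square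
        algebra_simps)
  have "((\<lambda>s. 1 - (x \<bullet> x + 2 * s * x $ i + s\<^sup>2) * inverse (R\<^sup>2)) has_real_derivative
      (- 2 * x $ i * inverse (R\<^sup>2))) (at 0)"
    by (auto intro!: derivative_eq_intros)
  then have "((\<lambda>s. 1 - (x \<bullet> x + 2 * s * x $ i + s\<^sup>2) / R\<^sup>2) has_real_derivative (- 2 * x $ i / R\<^sup>2)) (at 0)"
    by (simp add: divide_inverse)
  from DERIV_chain2[OF max_0_power_has_real_derivative[OF assms] this]
  show ?thesis
    by (simp add: cutoff_def sq dcutoff_def)
qed

lemma continuous_dcutoff: "continuous_on A (dcutoff R m i)"
  unfolding dcutoff_def divide_inverse by (intro continuous_intros)

text \<open>Inside the ball \<open>\<bar>x $ i\<bar> \<le> R \<le> R * R\<close>, so the inner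
  derivative is at most 2; outside, both sides vanish because \<open>m - 1 > 0\<close>.\<close>

lemma dcutoff_le:
  fixes x :: "real^'n::finite"
  assumes R: "R \<ge> 1" and "m \<ge> 2"
  shows "\<bar>dcutoff R m i x\<bar> \<le> 2 * real m * cutoff R x ^ (m - 1)"
proof (cases "norm x \<ge> R")
  case True
  then show ?thesis
    using cutoff_eq_0[of R x] assms by (simp add: dcutoff_def power_0_left)
next
  case False
  have "\<bar>x $ i\<bar> \<le> R * R"
    using component_le_norm_cart[of x i] False R mult_left_mono[of 1 R R] by linarith
  then have "\<bar>- 2 * x $ i / R\<^sup>2\<bar> \<le> 2"
    using R by (simp add: abs_mult power2_eq_square divide_le_eq)
  then have "real m * cutoff R x ^ (m - 1) * \<bar>- 2 * x $ i / R\<^sup>2\<bar> \<le> real m * cutoff R x ^ (m - 1) * 2"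
    by (intro mult_left_mono) (auto simp: cutoff_nonneg)
  then show ?thesis
    by (simp add: dcutoff_def abs_mult cutoff_nonneg)
qed

abbreviation space_dir :: "'n \<Rightarrow> (real^'n::finite) \<times> real" where
  "space_dir i \<equiv> (axis i 1, 0)"

definition cut_moll :: "real \<Rightarrow> nat \<Rightarrow> real \<Rightarrow> ((real^'n::finite) \<times> real \<Rightarrow> real) \<Rightarrow> (real^'n) \<times> real \<Rightarrow> real" where
  "cut_moll R m r f z = cutoff R (fst z) ^ m * conv (mollifier r) f z"

text \<open>The product rule for the derivative of \<open>cut_moll R m r f\<close> in direction
  \<open>i\<close>. The derivative of the convolution is placed on the kernel, so it makes sense for
  every integrable \<open>f\<close>.\<close>

definition dcut_moll :: "real \<Rightarrow> nat \<Rightarrow> real \<Rightarrow> ((real^'n::finite) \<times> real \<Rightarrow> real) \<Rightarrow> 'n \<Rightarrow> (real^'n) \<times> real \<Rightarrow> real" where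
  "dcut_moll R m r f i z = cutoff R (fst z) ^ m * conv (dmoll r (space_dir i)) f z
     + dcutoff R m i (fst z) * conv (mollifier r) f z"

lemma conv_dmoll_continuous:
  fixes f :: "'a::euclidean_space \<Rightarrow> real"
  assumes "r > 0" "integrable lborel f"
  shows "continuous_on UNIV (conv (dmoll r v) f)"
proof -
  obtain M where "\<And>z. \<bar>dmoll r v z\<bar> \<le> M" using dmoll_bounded[OF assms(1)] by blast
  then show ?thesis
    by (rule conv_continuous[OF assms(2) continuous_dmoll])
qed

lemma conv_mollifier_line_derivative:
  fixes f :: "'a::euclidean_space \<Rightarrow> real"
  assumes r: "r > 0" and f: "integrable lborel f"
  shows "((\<lambda>s. conv (mollifier r) f (z + s *\<^sub>R v)) has_real_derivative conv (dmoll r v) f z) (at 0)"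
proof -
  obtain M where M: "\<And>z. \<bar>dmoll r v z\<bar> \<le> M" using dmoll_bounded[OF r] by blast
  obtain M' where M': "\<And>z::'a. \<bar>mollifier r z\<bar> \<le> M'" using mollifier_bounded[OF r] by blast
  show ?thesis
    by (rule conv_has_real_derivative[OF f continuous_mollifier[OF r] M' continuous_dmoll M
          mollifier_line_derivative])
qed

lemma cut_moll_continuous:
  assumes "r > 0" "integrable lborel f"
  shows "continuous_on UNIV (cut_moll R m r f)" "continuous_on UNIV (dcut_moll R m r f i)"
  unfolding cut_moll_def dcut_moll_def
  by (intro continuous_intros conv_mollifier_continuous conv_dmoll_continuous assms
      continuous_on_compose2[OF continuous_dcutoff[of UNIV]] | simp)+

lemma cut_moll_lines_C1:
  fixes f :: "(real^'n::finite) \<times> real \<Rightarrow> real"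
  assumes r: "r > 0" and f: "integrable lborel f" and R: "R > 0" and m: "m \<ge> 2"
  shows "lines_C1 (\<lambda>x. cut_moll R m r f (x, t)) (\<lambda>i x. dcut_moll R m r f i (x, t))"
  unfolding lines_C1_def
proof (intro conjI allI)
  have c: "continuous_on UNIV (\<lambda>x::real^'n. (x, t))" by (intro continuous_intros)
  show "continuous_on UNIV (\<lambda>x. cut_moll R m r f (x, t))"
    by (rule continuous_on_compose2[OF cut_moll_continuous(1)[OF r f] c]) auto
  show "continuous_on UNIV (\<lambda>x. dcut_moll R m r f i (x, t))" for i
    by (rule continuous_on_compose2[OF cut_moll_continuous(2)[OF r f] c]) auto
  show "\<exists>R'. \<forall>x. norm x > R' \<longrightarrow> cut_moll R m r f (x, t) = 0"
    using m by (intro exI[of _ R]) (auto simp: cut_moll_def cutoff_eq_0[OF R])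
  show "((\<lambda>s. cut_moll R m r f (x + s *\<^sub>R axis i 1, t)) has_real_derivative dcut_moll R m r f i (x, t)) (at 0)" for i x
  proof -
    have "((\<lambda>s. conv (mollifier r) f (x + s *\<^sub>R axis i 1, t)) has_real_derivative
        conv (dmoll r (space_dir i)) f (x, t)) (at 0)"
      using conv_mollifier_line_derivative[OF r f, of "(x, t)" "space_dir i"] by simp
    from DERIV_mult[OF cutoff_line_derivative[OF m] this] show ?thesis
      by (simp add: cut_moll_def dcut_moll_def algebra_simps)
  qed
qed

section \<open>Extended Lebesgue norms and the estimate at a fixed mollification radius\<close>

definition Lnorm :: "real \<Rightarrow> ('a::euclidean_space \<Rightarrow> real) \<Rightarrow> ennreal" where
  "Lnorm q f = epow (\<integral>\<^sup>+z. ennreal (\<bar>f z\<bar> powr q) \<partial>lborel) (1 / q)"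

lemma Lnorm_mono:
  assumes "q > 0" "\<And>z. \<bar>f z\<bar> \<le> \<bar>g z\<bar>"
  shows "Lnorm q f \<le> Lnorm q g"
  unfolding Lnorm_def using assms
  by (intro epow_mono nn_integral_mono ennreal_leI powr_mono2) auto

lemma Lnorm_cmult:
  assumes "q > 0" "c \<ge> 0" "f \<in> borel_measurable borel"
  shows "Lnorm q (\<lambda>z. c * f z) = ennreal c * Lnorm q f"
proof -
  have "(\<integral>\<^sup>+z. ennreal (\<bar>c * f z\<bar> powr q) \<partial>lborel) = ennreal (c powr q) * (\<integral>\<^sup>+z. ennreal (\<bar>f z\<bar> powr q) \<partial>lborel)"
    using assms by (subst nn_integral_cmult[symmetric])
      (auto simp: abs_mult powr_mult ennreal_mult[symmetric])
  then show ?thesis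
    using assms by (simp add: Lnorm_def epow_mult epow_ennreal powr_powr)
qed

lemma epow_add_le:
  assumes "0 < a" "a \<le> 1"
  shows "epow (x + y) a \<le> 2 * (epow x a + epow y a)"
proof -
  have "epow (x + y) a \<le> epow (2 * max x y) a"
    using assms by (intro epow_mono) (auto simp: mult_2 add_mono)
  also have "\<dots> = epow 2 a * epow (max x y) a"
    by (rule epow_mult)
  also have "\<dots> \<le> 2 * (epow x a + epow y a)"
  proof (rule mult_mono)
    have "epow 2 a = ennreal (2 powr a)"
      using epow_ennreal[of 2 a] by simp
    also have "\<dots> \<le> ennreal (2 powr 1)"
      using assms by (intro ennreal_leI powr_mono) auto
    finally show "epow 2 a \<le> 2" by simp
    show "epow (max x y) a \<le> epow x a + epow y a"
      by (auto simp: max_def)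
  qed auto
  finally show ?thesis .
qed

text \<open>A quasi-triangle inequality suffices, as constants do not matter. One factor 2 comes
  from the pointwise bound of the power of a sum, the other from \<open>epow_add_le\<close>.\<close>

lemma Lnorm_add_le:
  assumes q: "q \<ge> 1" and [measurable]: "f \<in> borel_measurable borel" "g \<in> borel_measurable borel"
  shows "Lnorm q (\<lambda>z. \<bar>f z\<bar> + \<bar>g z\<bar>) \<le> 4 * (Lnorm q f + Lnorm q g)"
proof -
  have pt: "(\<bar>a\<bar> + \<bar>b\<bar>) powr q \<le> 2 powr q * (\<bar>a\<bar> powr q + \<bar>b\<bar> powr q)" for a b :: real
  proof -
    have "(\<bar>a\<bar> + \<bar>b\<bar>) powr q \<le> (2 * max \<bar>a\<bar> \<bar>b\<bar>) powr q"
      using q by (intro powr_mono2) auto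
    also have "\<dots> = 2 powr q * max \<bar>a\<bar> \<bar>b\<bar> powr q"
      by (simp add: powr_mult)
    also have "\<dots> \<le> 2 powr q * (\<bar>a\<bar> powr q + \<bar>b\<bar> powr q)"
      by (intro mult_left_mono) (auto simp: max_def)
    finally show ?thesis .
  qed
  have "(\<integral>\<^sup>+z. ennreal (\<bar>\<bar>f z\<bar> + \<bar>g z\<bar>\<bar> powr q) \<partial>lborel)
      \<le> (\<integral>\<^sup>+z. ennreal (2 powr q) * (ennreal (\<bar>f z\<bar> powr q) + ennreal (\<bar>g z\<bar> powr q)) \<partial>lborel)"
    using pt by (intro nn_integral_mono) (simp add: ennreal_leI flip: ennreal_plus ennreal_mult)
  also have "\<dots> = ennreal (2 powr q) * ((\<integral>\<^sup>+z. ennreal (\<bar>f z\<bar> powr q) \<partial>lborel)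
      + (\<integral>\<^sup>+z. ennreal (\<bar>g z\<bar> powr q) \<partial>lborel))"
    by (simp add: nn_integral_cmult nn_integral_add)
  finally have "Lnorm q (\<lambda>z. \<bar>f z\<bar> + \<bar>g z\<bar>) \<le> epow (ennreal (2 powr q) *
      ((\<integral>\<^sup>+z. ennreal (\<bar>f z\<bar> powr q) \<partial>lborel) + (\<integral>\<^sup>+z. ennreal (\<bar>g z\<bar> powr q) \<partial>lborel))) (1 / q)"
    unfolding Lnorm_def using q by (intro epow_mono) auto
  also have "\<dots> = 2 * epow ((\<integral>\<^sup>+z. ennreal (\<bar>f z\<bar> powr q) \<partial>lborel) + (\<integral>\<^sup>+z. ennreal (\<bar>g z\<bar> powr q) \<partial>lborel)) (1 / q)"
    using q by (simp add: epow_mult epow_ennreal powr_powr)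
  also have "\<dots> \<le> 2 * (2 * (Lnorm q f + Lnorm q g))"
    unfolding Lnorm_def using q by (intro mult_left_mono epow_add_le) auto
  finally show ?thesis by (simp add: mult.assoc[symmetric])
qed

lemma conv_measurable [measurable]:
  fixes f :: "'a::euclidean_space \<Rightarrow> real"
  assumes [measurable]: "f \<in> borel_measurable borel"
  shows "conv (mollifier r) f \<in> borel_measurable borel"
proof -
  have "(\<lambda>(z, y). f y * mollifier r (z - y)) \<in> borel_measurable (lborel \<Otimes>\<^sub>M lborel)"
    by measurable
  then show ?thesis
    unfolding conv_def[abs_def] using lborel.borel_measurable_lebesgue_integral by fastforce
qed

lemma Lnorm_conv_le:
  assumes "r > 0" "q \<ge> 1" "f \<in> borel_measurable borel"
  shows "Lnorm q (conv (mollifier r) f) \<le> Lnorm q f"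
  unfolding Lnorm_def using assms by (intro epow_mono nn_integral_conv_mollifier_le) auto

abbreviation on_times :: "real set \<Rightarrow> ('a \<times> real \<Rightarrow> real) \<Rightarrow> 'a \<times> real \<Rightarrow> real" where
  "on_times S f \<equiv> \<lambda>z. indicator S (snd z) * f z"

lemma nn_integral_on_times:
  "q > 0 \<Longrightarrow> (\<integral>\<^sup>+z. ennreal (\<bar>on_times S f z\<bar> powr q) \<partial>lborel)
    = (\<integral>\<^sup>+z\<in>UNIV \<times> S. ennreal (\<bar>f z\<bar> powr q) \<partial>lborel)"
  by (intro nn_integral_cong) (auto simp: indicator_def split: if_splits)

lemma on_times_measurable [measurable]:
  fixes h :: "'a::euclidean_space \<times> real \<Rightarrow> real"
  assumes [measurable]: "h \<in> borel_measurable borel" "S \<in> sets borel"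
  shows "on_times S h \<in> borel_measurable borel"
proof -
  have "(snd :: 'a \<times> real \<Rightarrow> real) \<in> borel_measurable borel"
    by (intro borel_measurable_continuous_onI continuous_intros)
  then have "(\<lambda>z :: 'a \<times> real. indicator S (snd z) :: real) \<in> borel_measurable borel"
    by measurable
  then show ?thesis by measurable
qed

text \<open>The root of order \<open>ps\<close> of the bound in \<open>slab_interpolation\<close> is
  a product of norms with weights adding up to 1, and the arithmetic-geometric mean turns it into a
  sum. The last sum is the contribution of the derivative of the cutoff.\<close>

theorem cut_moll_estimate:
  fixes p :: "'n::finite \<Rightarrow> real"
  assumes p: "\<forall>i. p i > 1" and pN: "pbar p < real CARD('n)" and \<sigma>: "\<sigma> \<ge> 1"
  defines "ps \<equiv> pbar p * (1 + \<sigma> / real CARD('n))"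
  obtains C where "0 \<le> C" and "\<And>m R r f fi S B.
    \<lbrakk>m \<ge> 2; R \<ge> 1; r > 0; integrable lborel f; \<And>i. fi i \<in> borel_measurable borel; S \<in> sets borel;
     \<And>i x t. norm x \<le> R \<Longrightarrow> t \<in> S \<Longrightarrow>
       conv (dmoll r (space_dir i)) f (x, t) = conv (mollifier r) (fi i) (x, t);
     AE t in lborel. (\<integral>\<^sup>+x. ennreal (\<bar>f (x, t)\<bar> powr \<sigma>) \<partial>lborel) \<le> B\<rbrakk> \<Longrightarrow>
    Lnorm ps (on_times S (cut_moll R m r f)) \<le> ennreal C * (epow B (1 / \<sigma>) +
      (\<Sum>i\<in>UNIV. Lnorm (p i) (fi i)) +
      ennreal (2 * real m) * (\<Sum>i\<in>UNIV. Lnorm (p i) (on_times S (cut_moll R (m - 1) r f))))"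
proof (rule slab_interpolation[OF p pN \<sigma>], goal_cases)
  case (1 C)
  note C = 1(2)
  define N where "N = real CARD('n)"
  define P where "P = pbar p"
  have P1: "P > 1" using pbar_gt_1[OF p] by (simp add: P_def)
  have PN: "P < N" using pN by (simp add: P_def N_def)
  have N0: "N > 0" using P1 PN by simp
  have ps: "ps = P * (1 + \<sigma> / N)" by (simp add: ps_def P_def N_def)
  have ps0: "ps > 0" unfolding ps using P1 N0 \<sigma> by (intro mult_pos_pos add_pos_pos) auto
  have p1: "p i > 1" for i using p by simp
  have p0: "p i > 0" for i using p1[of i] by simp
  note int = 1(3)[folded ps_def, folded N_def P_def]
  define C1 where "C1 = C powr (1 / ps)"
  \<comment> \<open>The weights after taking the root of order \<open>ps\<close>:
    \<open>None\<close> stands for the factor \<open>epow B (1 / \<sigma>)\<close> and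
    \<open>Some i\<close> for the norm of the \<open>i\<close>-th derivative.\<close>
  define a :: "'n option \<Rightarrow> real" where
    "a j = (case j of None \<Rightarrow> \<sigma> * P / (N * ps) | Some i \<Rightarrow> P / (N * ps))" for j
  have UNIVo: "(UNIV :: 'n option set) = insert None (range Some)"
    by (simp add: UNIV_option_conv)
  have a0: "a j > 0" for j
    using P1 N0 ps0 \<sigma> by (cases j) (auto simp: a_def)
  have suma: "sum a UNIV = 1"
  proof -
    have "sum a UNIV = \<sigma> * P / (N * ps) + N * (P / (N * ps))"
      by (simp add: UNIVo sum.reindex a_def N_def)
    also have "\<dots> = P * (1 + \<sigma> / N) / ps"
      using N0 ps0 by (simp add: field_simps)
    also have "\<dots> = 1" using ps0 by (simp add: ps[symmetric])
    finally show ?thesis .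
  qed
  have a_le: "a j \<le> 1" for j
    using suma member_le_sum[of j UNIV a] a0 by (auto simp: less_imp_le)
  have main: "Lnorm ps (on_times S (cut_moll R m r f)) \<le> ennreal (4 * C1) * (epow B (1 / \<sigma>) +
      (\<Sum>i\<in>UNIV. Lnorm (p i) (fi i)) +
      ennreal (2 * real m) * (\<Sum>i\<in>UNIV. Lnorm (p i) (on_times S (cut_moll R (m - 1) r f))))"
    if m: "m \<ge> 2" and R: "R \<ge> 1" and r: "r > 0" and f: "integrable lborel f"
      and [measurable]: "\<And>i. fi i \<in> borel_measurable borel" "S \<in> sets borel"
      and weak: "\<And>i x t. norm x \<le> R \<Longrightarrow> t \<in> S \<Longrightarrow>
       conv (dmoll r (space_dir i)) f (x, t) = conv (mollifier r) (fi i) (x, t)"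
      and B: "AE t in lborel. (\<integral>\<^sup>+x. ennreal (\<bar>f (x, t)\<bar> powr \<sigma>) \<partial>lborel) \<le> B"
    for m R r f fi S B
  proof -
    define w where "w = cut_moll R m r f"
    define D where "D = dcut_moll R m r f"
    define v where "v = cut_moll R (m - 1) r f"
    have R0: "R > 0" using R by simp
    have [measurable]: "f \<in> borel_measurable borel" using f by auto
    have [measurable]: "w \<in> borel_measurable borel" "D i \<in> borel_measurable borel" "v \<in> borel_measurable borel" for i
      unfolding w_def D_def v_def by (intro borel_measurable_continuous_onI cut_moll_continuous r f)+
    \<comment> \<open>For times in \<open>S\<close> and inside the ball, the term with
      \<open>dmoll\<close> is the mollified \<open>fi i\<close>, whose norm is at most that of
      \<open>fi i\<close>. The term with \<open>dcutoff\<close> is at most \<open>2 * m\<close>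
      times \<open>v\<close>.\<close>
    have Di: "Lnorm (p i) (on_times S (D i)) \<le> 4 * (Lnorm (p i) (fi i) + ennreal (2 * real m) * Lnorm (p i) (on_times S v))" for i
    proof -
      let ?c = "conv (mollifier r) (fi i)"
      have "Lnorm (p i) (on_times S (D i)) \<le> Lnorm (p i) (\<lambda>z. \<bar>?c z\<bar> + \<bar>2 * real m * on_times S v z\<bar>)"
      proof (rule Lnorm_mono[OF p0])
        fix z :: "(real^'n) \<times> real"
        obtain x t where z: "z = (x, t)" by (cases z)
        show "\<bar>on_times S (D i) z\<bar> \<le> \<bar>\<bar>?c z\<bar> + \<bar>2 * real m * on_times S v z\<bar>\<bar>"
        proof (cases "t \<in> S")
          case True
          have "\<bar>cutoff R x ^ m * conv (dmoll r (space_dir i)) f (x, t)\<bar> \<le> \<bar>?c z\<bar>"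
          proof (cases "norm x \<le> R")
            case True
            then show ?thesis
              using weak[OF True \<open>t \<in> S\<close>, of i] z
              by (auto simp: abs_mult cutoff_nonneg cutoff_le power_le_one mult_left_le_one_le)
          next
            case False
            then show ?thesis using m by (simp add: cutoff_eq_0[OF R0] power_0_left)
          qed
          moreover have "\<bar>dcutoff R m i x * conv (mollifier r) f (x, t)\<bar> \<le> \<bar>2 * real m * v z\<bar>"
          proof -
            have "\<bar>dcutoff R m i x\<bar> * \<bar>conv (mollifier r) f (x, t)\<bar>
                \<le> (2 * real m * cutoff R x ^ (m - 1)) * \<bar>conv (mollifier r) f (x, t)\<bar>"
              by (intro mult_right_mono dcutoff_le R m) auto
            then show ?thesis
              by (simp add: v_def cut_moll_def z abs_mult cutoff_nonneg mult.assoc)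
          qed
          ultimately show ?thesis
            using True z by (simp add: D_def dcut_moll_def)
        qed (simp add: z)
      qed
      also have "\<dots> \<le> 4 * (Lnorm (p i) ?c + Lnorm (p i) (\<lambda>z. 2 * real m * on_times S v z))"
        using p1[of i] by (intro Lnorm_add_le) auto
      also have "\<dots> \<le> 4 * (Lnorm (p i) (fi i) + ennreal (2 * real m) * Lnorm (p i) (on_times S v))"
        using p1[of i] by (subst Lnorm_cmult) (auto intro!: mult_left_mono add_mono Lnorm_conv_le r)
      finally show ?thesis .
    qed
    have "(\<integral>\<^sup>+z\<in>UNIV \<times> S. ennreal (\<bar>w z\<bar> powr ps) \<partial>lborel)
     \<le> ennreal C * (epow B (P / N) *
          (\<Prod>i\<in>UNIV. epow (\<integral>\<^sup>+z\<in>UNIV \<times> S. ennreal (\<bar>D i z\<bar> powr p i) \<partial>lborel) (P / (N * p i))))"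
    proof (rule int)
      show "lines_C1 (\<lambda>x. w (x, t)) (\<lambda>i x. D i (x, t))" for t
        unfolding w_def D_def by (rule cut_moll_lines_C1[OF r f R0 m])
      fix t
      have "(\<integral>\<^sup>+x. ennreal (\<bar>w (x, t)\<bar> powr \<sigma>) \<partial>lborel)
          \<le> (\<integral>\<^sup>+x. ennreal (\<bar>conv (mollifier r) f (x, t)\<bar> powr \<sigma>) \<partial>lborel)"
        using \<sigma> by (intro nn_integral_mono ennreal_leI powr_mono2)
          (auto simp: w_def cut_moll_def abs_mult cutoff_nonneg cutoff_le power_le_one mult_left_le_one_le)
      also have "\<dots> \<le> B"
        using \<sigma> B by (intro nn_integral_conv_mollifier_slice_le r) auto
      finally show "(\<integral>\<^sup>+x. ennreal (\<bar>w (x, t)\<bar> powr \<sigma>) \<partial>lborel) \<le> B" .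
    qed measurable
    then have "Lnorm ps (on_times S w) \<le> epow (ennreal C * (epow B (P / N) *
          (\<Prod>i\<in>UNIV. epow (\<integral>\<^sup>+z\<in>UNIV \<times> S. ennreal (\<bar>D i z\<bar> powr p i) \<partial>lborel) (P / (N * p i))))) (1 / ps)"
      unfolding Lnorm_def nn_integral_on_times[OF ps0] using ps0 by (intro epow_mono) auto
    also have "\<dots> = ennreal C1 * (epow (epow B (1 / \<sigma>)) (a None) *
        (\<Prod>i\<in>UNIV. epow (Lnorm (p i) (on_times S (D i))) (a (Some i))))"
    proof -
      have "P / (N * p i) * (1 / ps) = 1 / p i * a (Some i)" for i
        by (simp add: a_def)
      moreover have "P / N * (1 / ps) = 1 / \<sigma> * a None"
        using \<sigma> by (simp add: a_def)
      ultimately show ?thesis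
        using C by (simp only: epow_mult epow_prod epow_epow epow_ennreal Lnorm_def
            nn_integral_on_times[OF p0] C1_def)
    qed
    also have "\<dots> = ennreal C1 * (\<Prod>j\<in>UNIV. epow (case j of None \<Rightarrow> epow B (1 / \<sigma>)
          | Some i \<Rightarrow> Lnorm (p i) (on_times S (D i))) (a j))"
      by (simp add: UNIVo prod.reindex)
    also have "\<dots> \<le> ennreal C1 * (\<Sum>j\<in>UNIV. ennreal (a j) * (case j of None \<Rightarrow> epow B (1 / \<sigma>)
          | Some i \<Rightarrow> Lnorm (p i) (on_times S (D i))))"
      using a0 suma by (intro mult_left_mono weighted_amgm) auto
    also have "\<dots> \<le> ennreal C1 * (\<Sum>j\<in>UNIV. 1 * (case j of None \<Rightarrow> epow B (1 / \<sigma>)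
          | Some i \<Rightarrow> Lnorm (p i) (on_times S (D i))))"
      using a_le by (intro mult_left_mono sum_mono mult_right_mono) auto
    also have "\<dots> = ennreal C1 * (epow B (1 / \<sigma>) + (\<Sum>i\<in>UNIV. Lnorm (p i) (on_times S (D i))))"
      by (simp add: UNIVo sum.reindex)
    also have "\<dots> \<le> ennreal C1 * (4 * epow B (1 / \<sigma>) +
        (\<Sum>i\<in>UNIV. 4 * (Lnorm (p i) (fi i) + ennreal (2 * real m) * Lnorm (p i) (on_times S v))))"
    proof (intro mult_left_mono add_mono sum_mono Di)
      have "1 * epow B (1 / \<sigma>) \<le> 4 * epow B (1 / \<sigma>)"
        by (intro mult_right_mono) auto
      then show "epow B (1 / \<sigma>) \<le> 4 * epow B (1 / \<sigma>)" by simp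
    qed auto
    also have "\<dots> = ennreal C1 * (4 * (epow B (1 / \<sigma>) + (\<Sum>i\<in>UNIV. Lnorm (p i) (fi i)) +
      ennreal (2 * real m) * (\<Sum>i\<in>UNIV. Lnorm (p i) (on_times S v))))"
      by (simp add: sum.distrib sum_distrib_left distrib_left add.assoc)
    also have "\<dots> = ennreal (4 * C1) * (epow B (1 / \<sigma>) + (\<Sum>i\<in>UNIV. Lnorm (p i) (fi i)) +
      ennreal (2 * real m) * (\<Sum>i\<in>UNIV. Lnorm (p i) (on_times S v)))"
    proof -
      have "ennreal (4 * C1) = 4 * ennreal C1"
        by (simp add: C1_def ennreal_mult)
      then show ?thesis by (simp only: mult_ac)
    qed
    finally show ?thesis by (simp add: w_def v_def)
  qed
  show ?case
    by (rule that[of "4 * C1", OF _ main]) (simp add: C1_def)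
qed

text \<open>What the estimates need to know about \<open>u\<close>: \<open>f\<close> stands for
  \<open>u\<close> set to 0 outside a ball of radius \<open>R + 1\<close>, and the
  \<open>fi i\<close> stand for its weak derivatives. The margin 1 between the radii makes room for
  mollifiers with \<open>r \<le> 1\<close>.\<close>

definition moll_data :: "real \<Rightarrow> real \<Rightarrow> real \<Rightarrow> ((real^'n::finite) \<times> real \<Rightarrow> real)
    \<Rightarrow> ('n \<Rightarrow> (real^'n) \<times> real \<Rightarrow> real) \<Rightarrow> ennreal \<Rightarrow> bool" where
  "moll_data R T \<sigma> f fi B \<longleftrightarrow> integrable lborel f \<and> (\<forall>i. fi i \<in> borel_measurable borel) \<and>
     (\<forall>z. z \<notin> cball 0 (R + 1) \<times> {0<..<T} \<longrightarrow> f z = 0) \<and>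
     (\<forall>r i x t. 0 < r \<and> r \<le> 1 \<and> norm x \<le> R \<and> r < t \<and> t < T - r \<longrightarrow>
        conv (dmoll r (space_dir i)) f (x, t) = conv (mollifier r) (fi i) (x, t)) \<and>
     (AE t in lborel. (\<integral>\<^sup>+x. ennreal (\<bar>f (x, t)\<bar> powr \<sigma>) \<partial>lborel) \<le> B)"

text \<open>Fatou's lemma applies because \<open>A\<close> does not depend on \<open>r\<close>. A
  time strictly between 0 and \<open>T\<close> lies in the shrunken interval for all small
  \<open>r\<close>, and at other times \<open>f\<close> is 0.\<close>

lemma Lnorm_cutoff_le_of_mollified:
  assumes d: "moll_data R T \<sigma> f fi B" and m: "m > 0" and ps: "ps > 0"
    and le: "\<And>r. 0 < r \<Longrightarrow> r \<le> 1 \<Longrightarrow> Lnorm ps (on_times {r<..<T - r} (cut_moll R m r f)) \<le> A"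
  shows "Lnorm ps (\<lambda>z. cutoff R (fst z) ^ m * f z) \<le> A"
proof -
  have f: "integrable lborel f" and f0: "\<And>z. z \<notin> cball 0 (R + 1) \<times> {0<..<T} \<Longrightarrow> f z = 0"
    using d unfolding moll_data_def by blast+
  define rr where "rr n = 1 / real (Suc n)" for n
  have rr: "rr n > 0" "rr n \<le> 1" for n by (auto simp: rr_def)
  have rr0: "rr \<longlonglongrightarrow> 0"
    unfolding rr_def by (rule LIMSEQ_Suc[OF lim_1_over_n])
  obtain s where s: "strict_mono s" "AE z in lborel. (\<lambda>n. conv (mollifier (rr (s n))) f z) \<longlonglongrightarrow> f z"
    using conv_mollifier_AE_subseq[OF f rr(1) rr0] by blast
  have rs0: "(\<lambda>n. rr (s n)) \<longlonglongrightarrow> 0"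
    using LIMSEQ_subseq_LIMSEQ[OF rr0 s(1)] by (simp add: comp_def)
  define w where "w n = on_times {rr (s n)<..<T - rr (s n)} (cut_moll R m (rr (s n)) f)" for n
  have [measurable]: "w n \<in> borel_measurable borel" for n
    unfolding w_def
    by (intro on_times_measurable borel_measurable_continuous_onI cut_moll_continuous rr f) auto
  have "(\<integral>\<^sup>+z. ennreal (\<bar>cutoff R (fst z) ^ m * f z\<bar> powr ps) \<partial>lborel)
      \<le> (\<integral>\<^sup>+z. liminf (\<lambda>n. ennreal (\<bar>w n z\<bar> powr ps)) \<partial>lborel)"
  proof (rule nn_integral_mono_AE, use s(2) in eventually_elim)
    case (elim z)
    show ?case
    proof (cases "snd z \<in> {0<..<T}")
      case True
      then have "eventually (\<lambda>n. rr (s n) < snd z \<and> rr (s n) < T - snd z) sequentially"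
        using order_tendstoD(2)[OF rs0] by (intro eventually_conj) auto
      then have "eventually (\<lambda>n. cutoff R (fst z) ^ m * conv (mollifier (rr (s n))) f z = w n z) sequentially"
        by eventually_elim (auto simp: w_def cut_moll_def)
      moreover have "(\<lambda>n. cutoff R (fst z) ^ m * conv (mollifier (rr (s n))) f z) \<longlonglongrightarrow> cutoff R (fst z) ^ m * f z"
        by (intro tendsto_intros elim)
      ultimately have "(\<lambda>n. w n z) \<longlonglongrightarrow> cutoff R (fst z) ^ m * f z"
        by (rule Lim_transform_eventually[rotated])
      then have "(\<lambda>n. ennreal (\<bar>w n z\<bar> powr ps)) \<longlonglongrightarrow> ennreal (\<bar>cutoff R (fst z) ^ m * f z\<bar> powr ps)"
        using ps by (intro tendsto_ennrealI tendsto_powr2 tendsto_rabs tendsto_const) auto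
      from lim_imp_Liminf[OF _ this] show ?thesis by simp
    next
      case False
      then have "f z = 0" by (intro f0) (auto simp: mem_Times_iff)
      then show ?thesis by simp
    qed
  qed
  also have "\<dots> \<le> liminf (\<lambda>n. \<integral>\<^sup>+z. ennreal (\<bar>w n z\<bar> powr ps) \<partial>lborel)"
    by (rule nn_integral_liminf) measurable
  also have "\<dots> \<le> liminf (\<lambda>n. epow A ps)"
  proof (intro Liminf_mono always_eventually allI)
    fix n
    have "epow (Lnorm ps (w n)) ps \<le> epow A ps"
      unfolding w_def using ps by (intro epow_mono le rr) auto
    then show "(\<integral>\<^sup>+z. ennreal (\<bar>w n z\<bar> powr ps) \<partial>lborel) \<le> epow A ps"
      using ps by (simp add: Lnorm_def epow_epow)
  qed
  finally have "Lnorm ps (\<lambda>z. cutoff R (fst z) ^ m * f z) \<le> epow (epow A ps) (1 / ps)"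
    unfolding Lnorm_def using ps by (intro epow_mono) (auto simp: Liminf_const)
  then show ?thesis using ps by (simp add: epow_epow)
qed

section \<open>Control of the term produced by the cutoff\<close>

lemma Lnorm_support_le:
  assumes pq: "0 < p" "p \<le> q" and [measurable]: "f \<in> borel_measurable borel" "Q \<in> sets borel"
    and f0: "\<And>z. z \<notin> Q \<Longrightarrow> f z = 0" and V: "emeasure lborel Q = ennreal V" "V > 0"
  shows "Lnorm p f \<le> ennreal (V powr (1 / p - 1 / q)) * Lnorm q f"
proof (cases "p = q")
  case True
  then show ?thesis using V by simp
next
  case False
  with pq have pq: "0 < p" "p < q" by auto
  have "(\<integral>\<^sup>+z. ennreal (\<bar>f z\<bar> powr p) \<partial>lborel)
    = (\<integral>\<^sup>+z. epow (ennreal (\<bar>f z\<bar> powr q)) (p / q) * epow (indicator Q z) (1 - p / q) \<partial>lborel)"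
    using pq f0 by (intro nn_integral_cong) (auto simp: indicator_def epow_ennreal powr_powr)
  also have "\<dots> \<le> epow (\<integral>\<^sup>+z. ennreal (\<bar>f z\<bar> powr q) \<partial>lborel) (p / q)
      * epow (\<integral>\<^sup>+z. indicator Q z \<partial>lborel) (1 - p / q)"
    using pq by (intro holder2_nn_integral) auto
  finally have "Lnorm p f \<le> epow (epow (\<integral>\<^sup>+z. ennreal (\<bar>f z\<bar> powr q) \<partial>lborel) (p / q)
      * epow (ennreal V) (1 - p / q)) (1 / p)"
    unfolding Lnorm_def using pq V by (intro epow_mono) auto
  also have "\<dots> = Lnorm q f * ennreal (V powr ((1 - p / q) * (1 / p)))"
    using pq V by (simp add: epow_mult epow_epow epow_ennreal Lnorm_def powr_powr)
  also have "(1 - p / q) * (1 / p) = 1 / p - 1 / q"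
    using pq by (simp add: field_simps)
  finally show ?thesis by (simp add: mult.commute)
qed

text \<open>The weighted arithmetic-geometric mean of \<open>\<epsilon> * x\<close> and
  \<open>\<delta> * y\<close>, where \<open>\<delta> = \<epsilon> powr (- (real m - 1))\<close> is
  chosen so that \<open>\<epsilon> powr \<theta> * \<delta> powr (1 - \<theta>) = 1\<close>.\<close>

lemma young_eps:
  assumes \<epsilon>: "\<epsilon> > 0" and m: "m \<ge> (2::nat)"
  defines "\<theta> \<equiv> (real m - 1) / real m"
  shows "epow x \<theta> * epow y (1 - \<theta>) \<le> ennreal \<epsilon> * x + ennreal (\<epsilon> powr (- (real m - 1))) * y"
proof -
  have \<theta>: "0 < \<theta>" "\<theta> < 1" "1 - \<theta> = 1 / real m"
    using m by (auto simp: \<theta>_def field_simps)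
  define \<delta> where "\<delta> = \<epsilon> powr (- (real m - 1))"
  have "\<epsilon> powr \<theta> * \<delta> powr (1 - \<theta>) = 1"
  proof -
    have "\<epsilon> powr \<theta> * \<delta> powr (1 - \<theta>) = \<epsilon> powr (\<theta> + (- (real m - 1)) * (1 / real m))"
      by (simp add: \<delta>_def powr_powr powr_add \<theta>(3))
    also have "\<theta> + (- (real m - 1)) * (1 / real m) = 0"
      using m by (simp add: \<theta>_def field_simps)
    finally show ?thesis using \<epsilon> by simp
  qed
  then have one: "epow (ennreal \<epsilon>) \<theta> * epow (ennreal \<delta>) (1 - \<theta>) = 1"
    using \<epsilon> by (simp add: epow_ennreal \<delta>_def flip: ennreal_mult)
  have "epow x \<theta> * epow y (1 - \<theta>) = (epow (ennreal \<epsilon>) \<theta> * epow (ennreal \<delta>) (1 - \<theta>)) * (epow x \<theta> * epow y (1 - \<theta>))"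
    by (simp add: one)
  also have "\<dots> = (\<Prod>b\<in>UNIV. epow (if b then ennreal \<epsilon> * x else ennreal \<delta> * y) (if b then \<theta> else 1 - \<theta>))"
    by (simp add: UNIV_bool epow_mult mult_ac)
  also have "\<dots> \<le> (\<Sum>b\<in>UNIV. ennreal (if b then \<theta> else 1 - \<theta>) * (if b then ennreal \<epsilon> * x else ennreal \<delta> * y))"
    using \<theta>(1,2) by (intro weighted_amgm) (auto simp: UNIV_bool)
  also have "\<dots> \<le> (\<Sum>b\<in>UNIV. 1 * (if b then ennreal \<epsilon> * x else ennreal \<delta> * y))"
    using \<theta> by (intro sum_mono mult_right_mono) auto
  finally show ?thesis
    by (simp add: UNIV_bool \<delta>_def add.commute)
qed

text \<open>With \<open>F\<close> the mollified \<open>f\<close>, \<open>v\<close> the cutoff power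
  \<open>m - 1\<close> times \<open>F\<close> and \<open>w\<close> the power \<open>m\<close> times
  \<open>F\<close>, the identity \<open>\<bar>v\<bar> = \<bar>w\<bar> powr \<theta> * \<bar>F\<bar>
  powr (1 - \<theta>)\<close> holds. Hoelder's inequality has three factors: \<open>w\<close> with
  exponent \<open>ps\<close>, \<open>F\<close> with exponent 1, and the indicator of
  \<open>Q\<close>, which takes the remaining weight.\<close>

lemma Lnorm_cut_moll_interpolation:
  fixes f :: "(real^'n::finite) \<times> real \<Rightarrow> real"
  assumes r: "r > 0" and f: "integrable lborel f" and R: "R > 0" and m: "m \<ge> (2::nat)"
    and S: "S \<in> sets borel" and Q: "Q \<in> sets borel" "emeasure lborel Q = ennreal V" "V > 0"
    and SQ: "cball (0 :: real^'n) R \<times> S \<subseteq> Q" and q: "q \<ge> 1" and ps: "q < ps" and mq: "q / real m < 1 - q / ps"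
  defines "\<theta> \<equiv> (real m - 1) / real m"
  shows "Lnorm q (on_times S (cut_moll R (m - 1) r f)) \<le>
    ennreal (V powr ((1 - \<theta> * q / ps - (1 - \<theta>) * q) / q)) *
    (epow (Lnorm ps (on_times S (cut_moll R m r f))) \<theta> * epow (Lnorm 1 f) (1 - \<theta>))"
proof -
  define F where "F = conv (mollifier r) f"
  define v where "v = on_times S (cut_moll R (m - 1) r f)"
  define w where "w = on_times S (cut_moll R m r f)"
  note S[measurable] Q(1)[measurable]
  have [measurable]: "f \<in> borel_measurable borel" using f by auto
  have [measurable]: "F \<in> borel_measurable borel" unfolding F_def by measurable
  have [measurable]: "v \<in> borel_measurable borel" "w \<in> borel_measurable borel"
    unfolding v_def w_def
    by (intro on_times_measurable borel_measurable_continuous_onI cut_moll_continuous r f S)+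
  have \<theta>: "0 < \<theta>" "\<theta> < 1" "1 - \<theta> = 1 / real m"
    using m by (auto simp: \<theta>_def field_simps)
  define a where "a = \<theta> * q / ps"
  define b where "b = (1 - \<theta>) * q"
  define c where "c = 1 - a - b"
  have a0: "a > 0" and b0: "b > 0" using \<theta>(1,2) q ps by (auto simp: a_def b_def)
  have "a \<le> q / ps"
    using \<theta> q ps by (simp add: a_def divide_right_mono mult_left_le_one_le)
  \<comment> \<open>The lower bound on \<open>m\<close> enters here: since \<open>b = q / m\<close>,
    the hypothesis \<open>mq\<close> leaves a positive weight for the indicator of
    \<open>Q\<close>.\<close>
  then have c0: "c > 0"
    using mq by (simp add: c_def b_def \<theta>(3))
  have pt: "ennreal (\<bar>v z\<bar> powr q) \<le> epow (ennreal (\<bar>w z\<bar> powr ps)) a * epow (ennreal \<bar>F z\<bar>) b * epow (indicator Q z) c" for z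
  \<comment> \<open>Strictly inside the ball the cutoff is positive, so its integer powers can be
    written with \<open>powr\<close>; in the other case \<open>v\<close> vanishes because
    \<open>m - 1 > 0\<close>.\<close>
  proof (cases "snd z \<in> S \<and> norm (fst z) < R")
    case False
    then have "v z = 0"
      using m R cutoff_eq_0[of R "fst z"] by (auto simp: v_def cut_moll_def indicator_def)
    then show ?thesis by simp
  next
    case True
    then have zQ: "z \<in> Q" using SQ by (auto simp: mem_Times_iff)
    let ?\<zeta> = "cutoff R (fst z)"
    have pos: "?\<zeta> > 0"
    proof -
      have "(norm (fst z))\<^sup>2 < R\<^sup>2" using True by (intro power_strict_mono) auto
      then show ?thesis using R by (simp add: cutoff_def dot_square_norm)
    qed
    have vz: "\<bar>v z\<bar> = ?\<zeta> ^ (m - 1) * \<bar>F z\<bar>" and wz: "\<bar>w z\<bar> = ?\<zeta> ^ m * \<bar>F z\<bar>"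
      using True by (auto simp: v_def w_def cut_moll_def F_def abs_mult cutoff_nonneg)
    have "?\<zeta> ^ (m - 1) = (?\<zeta> ^ m) powr \<theta>"
    proof -
      have "(?\<zeta> ^ m) powr \<theta> = ?\<zeta> powr (real m * \<theta>)"
        using pos by (simp add: powr_powr flip: powr_realpow)
      also have "real m * \<theta> = real (m - 1)"
        using m by (simp add: \<theta>_def of_nat_diff)
      finally show ?thesis using pos by (simp add: powr_realpow)
    qed
    then have "\<bar>v z\<bar> = \<bar>w z\<bar> powr \<theta> * \<bar>F z\<bar> powr (1 - \<theta>)"
      by (simp add: vz wz powr_mult mult.assoc flip: powr_add)
    then have "\<bar>v z\<bar> powr q = (\<bar>w z\<bar> powr ps) powr a * \<bar>F z\<bar> powr b"
      using ps q by (simp add: powr_mult powr_powr a_def b_def)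
    then show ?thesis
      using zQ by (simp add: epow_ennreal flip: ennreal_mult)
  qed
  let ?a = "\<lambda>k::nat. if k = 0 then a else if k = 1 then b else c"
  let ?f = "\<lambda>k::nat. if k = 0 then (\<lambda>z. ennreal (\<bar>w z\<bar> powr ps)) else if k = 1 then (\<lambda>z. ennreal \<bar>F z\<bar>) else indicator Q"
  have "(\<integral>\<^sup>+z. ennreal (\<bar>v z\<bar> powr q) \<partial>lborel) \<le> (\<integral>\<^sup>+z. (\<Prod>k\<in>{0,1,2}. epow (?f k z) (?a k)) \<partial>lborel)"
    using pt by (intro nn_integral_mono) (simp add: mult.assoc)
  also have "\<dots> \<le> (\<Prod>k\<in>{0,1,2}. epow (\<integral>\<^sup>+z. ?f k z \<partial>lborel) (?a k))"
    using a0 b0 c0 by (intro holder_nn_integral) (auto simp: c_def)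
  also have "\<dots> = epow (\<integral>\<^sup>+z. ennreal (\<bar>w z\<bar> powr ps) \<partial>lborel) a * epow (\<integral>\<^sup>+z. ennreal \<bar>F z\<bar> \<partial>lborel) b * epow (ennreal V) c"
    by (simp add: Q mult.assoc)
  finally have "Lnorm q v \<le> epow (epow (\<integral>\<^sup>+z. ennreal (\<bar>w z\<bar> powr ps) \<partial>lborel) a
      * epow (\<integral>\<^sup>+z. ennreal \<bar>F z\<bar> \<partial>lborel) b * epow (ennreal V) c) (1 / q)"
    unfolding Lnorm_def using q by (intro epow_mono) auto
  also have "\<dots> = epow (Lnorm ps w) \<theta> * epow (Lnorm 1 F) (1 - \<theta>) * ennreal (V powr (c / q))"
  proof -
    have "a * (1 / q) = 1 / ps * \<theta>" "b * (1 / q) = 1 - \<theta>"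
      using q by (auto simp: a_def b_def)
    then show ?thesis
      using Q by (simp add: epow_mult epow_epow Lnorm_def epow_ennreal powr_powr)
  qed
  also have "\<dots> \<le> epow (Lnorm ps w) \<theta> * epow (Lnorm 1 f) (1 - \<theta>) * ennreal (V powr (c / q))"
    using \<theta> unfolding F_def by (intro mult_right_mono mult_left_mono epow_mono Lnorm_conv_le r) auto
  finally show ?thesis
    by (simp add: v_def w_def c_def a_def b_def mult_ac)
qed

lemma slab_measure:
  fixes R T :: real
  assumes "R > 0" "T > 0"
  shows "cball (0 :: real^'n::finite) R \<times> {0<..<T} \<in> sets borel"
    "\<exists>V>0. emeasure lborel (cball (0 :: real^'n) R \<times> {0<..<T}) = ennreal V"
proof -
  let ?Q = "cball (0 :: real^'n) R \<times> {0<..<T}"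
  show Q: "?Q \<in> sets borel" by (intro borel_Times) auto
  have "bounded ?Q" by (intro bounded_Times) auto
  then have fin: "emeasure lborel ?Q < \<infinity>" by (rule emeasure_bounded_finite)
  have "\<not> emeasure lborel ?Q = 0"
  proof
    assume "emeasure lborel ?Q = 0"
    moreover have "open (ball (0 :: real^'n) R \<times> {0<..<T})" by (intro open_Times) auto
    moreover have "ball (0 :: real^'n) R \<times> {0<..<T} \<subseteq> ?Q" by auto
    ultimately have "emeasure lborel (ball (0 :: real^'n) R \<times> {0<..<T}) = 0"
      using emeasure_mono[of "ball (0 :: real^'n) R \<times> {0<..<T}" ?Q lborel] Q by auto
    then have "ball (0 :: real^'n) R \<times> {0<..<T} = {}"
      using \<open>open (ball 0 R \<times> {0<..<T})\<close> by (metis open_not_negligible negligible_iff_null_sets null_setsI null_sets_completionI sets_lborel borel_open)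
    then show False using assms by auto
  qed
  with fin show "\<exists>V>0. emeasure lborel ?Q = ennreal V"
    by (cases "emeasure lborel ?Q") (auto simp: less_le)
qed

lemma Lnorm_cut_moll_le:
  assumes "r > 0" "f \<in> borel_measurable borel" "q \<ge> 1"
  shows "Lnorm q (on_times S (cut_moll R m r f)) \<le> Lnorm q f"
proof -
  have "Lnorm q (on_times S (cut_moll R m r f)) \<le> Lnorm q (conv (mollifier r) f)"
    using assms by (intro Lnorm_mono)
      (auto simp: indicator_def cut_moll_def abs_mult cutoff_nonneg cutoff_le power_le_one mult_left_le_one_le)
  then show ?thesis
    using Lnorm_conv_le[OF assms(1,3,2)] by (rule order_trans)
qed

text \<open>A mollified integrable function is bounded by a constant depending on \<open>r\<close>.
  The value of the bound is irrelevant: finiteness alone permits the absorption of this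
  norm.\<close>

lemma cut_moll_Lnorm_finite:
  fixes f :: "(real^'n::finite) \<times> real \<Rightarrow> real"
  assumes r: "r > 0" and f: "integrable lborel f" and R: "R > 0" and m: "m > 0"
    and S: "S \<in> sets borel" and Q: "Q \<in> sets borel" "emeasure lborel Q = ennreal V"
    and SQ: "cball (0 :: real^'n) R \<times> S \<subseteq> Q" and q: "q > 0"
  shows "Lnorm q (on_times S (cut_moll R m r f)) < top"
proof -
  obtain M where M: "\<And>z::(real^'n) \<times> real. \<bar>mollifier r z\<bar> \<le> M" using mollifier_bounded[OF r] by blast
  define A where "A = \<bar>M * (LINT y|lborel. \<bar>f y\<bar>)\<bar>"
  have F: "\<bar>conv (mollifier r) f z\<bar> \<le> A" for z
    using conv_abs_le[OF f continuous_mollifier[OF r] M, of z] by (simp add: A_def)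
  have "(\<integral>\<^sup>+z. ennreal (\<bar>on_times S (cut_moll R m r f) z\<bar> powr q) \<partial>lborel)
      \<le> (\<integral>\<^sup>+z. ennreal (A powr q) * indicator Q (z :: (real^'n) \<times> real) \<partial>lborel)"
  proof (intro nn_integral_mono)
    fix z :: "(real^'n) \<times> real"
    show "ennreal (\<bar>on_times S (cut_moll R m r f) z\<bar> powr q) \<le> ennreal (A powr q) * indicator Q z"
    proof (cases "z \<in> cball 0 R \<times> S")
      case True
      have "\<bar>cutoff R (fst z) ^ m * conv (mollifier r) f z\<bar> \<le> 1 * A"
        unfolding abs_mult by (intro mult_mono F) (auto simp: cutoff_nonneg cutoff_le power_le_one)
      moreover have "z \<in> Q" using True SQ by blast
      ultimately show ?thesis
        using True q by (auto simp: cut_moll_def mem_Times_iff intro!: ennreal_leI powr_mono2)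
    next
      case False
      then have "on_times S (cut_moll R m r f) z = 0"
        using m R cutoff_eq_0[of R "fst z"] by (auto simp: cut_moll_def indicator_def mem_Times_iff)
      then show ?thesis by (simp only:) simp
    qed
  qed
  also have "\<dots> < top"
    using Q by (simp add: nn_integral_cmult_indicator ennreal_mult_less_top)
  finally show ?thesis
    unfolding Lnorm_def less_top[symmetric] by simp
qed

text \<open>Finiteness of \<open>x\<close> is essential: for \<open>x = top\<close> the second
  hypothesis would say nothing about \<open>y\<close>.\<close>

lemma ennreal_absorb_half:
  fixes x y :: ennreal
  assumes "x < top" "x \<le> y + ennreal (1 / 2) * x"
  shows "x \<le> 2 * y"
proof (cases y)
  case (real b)
  obtain a where a: "x = ennreal a" "a \<ge> 0"
    using assms(1) by (cases x) auto
  have "y + ennreal (1 / 2) * x = ennreal (b + 1 / 2 * a)"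
    using real a by (simp only: ennreal_mult[symmetric] ennreal_plus[symmetric] zero_le_divide_1_iff
        zero_le_numeral mult_nonneg_nonneg)
  then have "ennreal a \<le> ennreal (b + 1 / 2 * a)"
    using assms(2) a by simp
  then have "a \<le> b + 1 / 2 * a"
    using real a by (subst (asm) ennreal_le_iff) auto
  then have "ennreal a \<le> ennreal (2 * b)"
    by (intro ennreal_leI) simp
  then show ?thesis
    using real a by (simp add: ennreal_mult)
qed (simp add: ennreal_mult_top)

lemma local_bound:
  fixes p :: "'n::finite \<Rightarrow> real"
  assumes p: "\<forall>i. p i > 1" and pN: "pbar p < real CARD('n)" and \<sigma>: "\<sigma> \<ge> 1"
    and T: "T > 0" and R: "R \<ge> 1" and le: "\<And>i. p i \<le> pmax"
  defines "ps \<equiv> pbar p * (1 + \<sigma> / real CARD('n))"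
  shows "\<exists>m C. m > 0 \<and> 0 \<le> C \<and> (\<forall>f fi B. moll_data R T \<sigma> f fi B \<longrightarrow>
    Lnorm ps (\<lambda>z. cutoff R (fst z) ^ m * f z) \<le>
      ennreal C * (epow B (1 / \<sigma>) + (\<Sum>i\<in>UNIV. Lnorm (p i) (fi i)) + Lnorm pmax f))"
proof (rule cut_moll_estimate[OF p pN \<sigma>], goal_cases)
  case (1 C)
  note C = 1(1) and est = 1(2)[folded ps_def]
  define Q where "Q = cball (0 :: real^'n) (R + 1) \<times> {0<..<T}"
  have Q: "Q \<in> sets borel"
    unfolding Q_def using R T by (intro slab_measure) auto
  obtain V where V: "V > 0" "emeasure lborel Q = ennreal V"
    unfolding Q_def using slab_measure(2)[of "R + 1" T] R T by auto
  have ps: "ps > 0"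
    using pbar_gt_1[OF p] \<sigma> unfolding ps_def by (intro mult_pos_pos add_pos_nonneg) auto
  have p1: "p i > 1" for i using p by simp
  define D where "D = (\<Sum>i\<in>UNIV. V powr (1 / p i - 1 / pmax))"
  have D0: "D \<ge> 0" by (auto simp: D_def intro!: sum_nonneg)
  show ?case
  \<comment> \<open>The smallest power that \<open>est\<close> admits; the 4 in the constant is
    \<open>2 * m\<close>.\<close>
  proof (intro exI[of _ "2::nat"] exI[of _ "C * (1 + 4 * D)"] conjI allI impI)
    show "0 \<le> C * (1 + 4 * D)" using C D0 by simp
    fix f :: "(real^'n) \<times> real \<Rightarrow> real" and fi B
    assume d: "moll_data R T \<sigma> f fi B"
    then have f: "integrable lborel f" and fi: "\<And>i. fi i \<in> borel_measurable borel"
      and f0: "\<And>z. z \<notin> Q \<Longrightarrow> f z = 0"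
      and weak: "\<And>r i x t. 0 < r \<Longrightarrow> r \<le> 1 \<Longrightarrow> norm x \<le> R \<Longrightarrow> r < t \<Longrightarrow> t < T - r \<Longrightarrow>
        conv (dmoll r (space_dir i)) f (x, t) = conv (mollifier r) (fi i) (x, t)"
      and B: "AE t in lborel. (\<integral>\<^sup>+x. ennreal (\<bar>f (x, t)\<bar> powr \<sigma>) \<partial>lborel) \<le> B"
      unfolding moll_data_def Q_def by blast+
    have [measurable]: "f \<in> borel_measurable borel" using f by auto
    let ?G = "\<Sum>i\<in>UNIV. Lnorm (p i) (fi i)"
    show "Lnorm ps (\<lambda>z. cutoff R (fst z) ^ 2 * f z) \<le>
      ennreal (C * (1 + 4 * D)) * (epow B (1 / \<sigma>) + ?G + Lnorm pmax f)"
    proof (rule Lnorm_cutoff_le_of_mollified[OF d _ ps])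
      fix r :: real assume r: "0 < r" "r \<le> 1"
      let ?S = "{r<..<T - r}"
      have "Lnorm ps (on_times ?S (cut_moll R 2 r f)) \<le> ennreal C * (epow B (1 / \<sigma>) + ?G +
          ennreal (2 * real 2) * (\<Sum>i\<in>UNIV. Lnorm (p i) (on_times ?S (cut_moll R (2 - 1) r f))))"
        using r R f fi B weak by (intro est) auto
      also have "\<dots> \<le> ennreal C * (epow B (1 / \<sigma>) + ?G +
          ennreal 4 * (\<Sum>i\<in>UNIV. ennreal (V powr (1 / p i - 1 / pmax)) * Lnorm pmax f))"
      proof (intro mult_left_mono add_left_mono mult_mono sum_mono)
        fix i
        have "Lnorm (p i) (on_times ?S (cut_moll R (2 - 1) r f)) \<le> Lnorm (p i) f"
          using p1[of i] r by (intro Lnorm_cut_moll_le) auto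
        also have "\<dots> \<le> ennreal (V powr (1 / p i - 1 / pmax)) * Lnorm pmax f"
          using less_trans[OF zero_less_one p1[of i]] by (intro Lnorm_support_le[where Q=Q] le Q V f0) auto
        finally show "Lnorm (p i) (on_times ?S (cut_moll R (2 - 1) r f))
          \<le> ennreal (V powr (1 / p i - 1 / pmax)) * Lnorm pmax f" .
      qed auto
      also have "(\<Sum>i\<in>UNIV. ennreal (V powr (1 / p i - 1 / pmax)) * Lnorm pmax f) = ennreal D * Lnorm pmax f"
        unfolding D_def by (simp add: sum_distrib_right[symmetric] sum_ennreal)
      also have "ennreal C * (epow B (1 / \<sigma>) + ?G + ennreal 4 * (ennreal D * Lnorm pmax f))
          \<le> ennreal C * (ennreal (1 + 4 * D) * (epow B (1 / \<sigma>) + ?G + Lnorm pmax f))"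
      proof (intro mult_left_mono)
        have "ennreal 4 * (ennreal D * Lnorm pmax f) = ennreal (4 * D) * Lnorm pmax f"
          using D0 by (simp add: ennreal_mult mult.assoc)
        also have "\<dots> \<le> ennreal (1 + 4 * D) * Lnorm pmax f"
          by (intro mult_right_mono ennreal_leI) auto
        finally have 1: "ennreal 4 * (ennreal D * Lnorm pmax f) \<le> ennreal (1 + 4 * D) * Lnorm pmax f" .
        have "1 * (epow B (1 / \<sigma>) + ?G) \<le> ennreal (1 + 4 * D) * (epow B (1 / \<sigma>) + ?G)"
          using D0 ennreal_leI[of 1 "1 + 4 * D"] by (intro mult_right_mono) auto
        from add_mono[OF this 1]
        show "epow B (1 / \<sigma>) + ?G + ennreal 4 * (ennreal D * Lnorm pmax f)
            \<le> ennreal (1 + 4 * D) * (epow B (1 / \<sigma>) + ?G + Lnorm pmax f)"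
          by (simp add: distrib_left)
      qed auto
      also have "\<dots> = ennreal (C * (1 + 4 * D)) * (epow B (1 / \<sigma>) + ?G + Lnorm pmax f)"
        using C D0 by (simp add: ennreal_mult mult.assoc)
      finally show "Lnorm ps (on_times ?S (cut_moll R 2 r f))
          \<le> ennreal (C * (1 + 4 * D)) * (epow B (1 / \<sigma>) + ?G + Lnorm pmax f)" .
    qed simp
  qed simp
qed

text \<open>The gap between \<open>pmax\<close> and \<open>ps\<close> determines \<open>m\<close>,
  then \<open>m\<close> determines \<open>\<kappa>\<close>, and \<open>\<kappa>\<close> determines
  \<open>\<epsilon>\<close>. All of them are fixed before \<open>f\<close> and \<open>r\<close>, so
  the bound obtained by absorption is uniform in \<open>r\<close> and passes to the limit.\<close>

lemma local_bound_L1: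
  fixes p :: "'n::finite \<Rightarrow> real"
  assumes p: "\<forall>i. p i > 1" and pN: "pbar p < real CARD('n)" and \<sigma>: "\<sigma> \<ge> 1"
    and T: "T > 0" and R: "R \<ge> 1" and le: "\<And>i. p i \<le> pmax"
  defines "ps \<equiv> pbar p * (1 + \<sigma> / real CARD('n))"
  assumes ps_gt: "ps > pmax"
  shows "\<exists>m C. m > 0 \<and> 0 \<le> C \<and> (\<forall>f fi B. moll_data R T \<sigma> f fi B \<longrightarrow>
    Lnorm ps (\<lambda>z. cutoff R (fst z) ^ m * f z) \<le>
      ennreal C * (epow B (1 / \<sigma>) + (\<Sum>i\<in>UNIV. Lnorm (p i) (fi i)) + Lnorm 1 f))"
proof (rule cut_moll_estimate[OF p pN \<sigma>], goal_cases)
  case (1 C)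
  note C = 1(1) and est = 1(2)[folded ps_def]
  define Q where "Q = cball (0 :: real^'n) (R + 1) \<times> {0<..<T}"
  have Q: "Q \<in> sets borel"
    unfolding Q_def using R T by (intro slab_measure) auto
  obtain V where V: "V > 0" "emeasure lborel Q = ennreal V"
    unfolding Q_def using slab_measure(2)[of "R + 1" T] R T by auto
  have p1: "p i > 1" for i using p by simp
  have pmax: "pmax > 1" using p1[of undefined] le[of undefined] by linarith
  have ps: "ps > 0" using pmax ps_gt by simp
  define b where "b = 1 - pmax / ps"
  have b: "b > 0" using ps ps_gt by (simp add: b_def)
  \<comment> \<open>Large enough for \<open>pmax / m < 1 - pmax / ps\<close>, which gives the
    condition of the interpolation for all \<open>p i\<close> at once.\<close>
  obtain m0 :: nat where m0: "real m0 > pmax / b" using reals_Archimedean2 by blast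
  define m where "m = max 2 m0"
  have m2: "m \<ge> 2" by (simp add: m_def)
  have mq: "p i / real m < 1 - p i / ps" for i
  proof -
    have "pmax / b < real m" using m0 by (simp add: m_def)
    then have "pmax / real m < b"
      using b m2 by (simp add: field_simps)
    moreover have "p i / real m \<le> pmax / real m" "p i / ps \<le> pmax / ps"
      using le[of i] ps by (auto intro!: divide_right_mono)
    ultimately show ?thesis by (simp add: b_def)
  qed
  define \<theta> where "\<theta> = (real m - 1) / real m"
  define W where "W i = V powr ((1 - \<theta> * p i / ps - (1 - \<theta>) * p i) / p i)" for i
  define D where "D = (\<Sum>i\<in>UNIV. W i)"
  have D0: "D \<ge> 0" by (auto simp: D_def W_def intro!: sum_nonneg)
  \<comment> \<open>The total factor in front of
    \<open>\<epsilon> * x + \<delta> * Lnorm 1 f\<close> once all interpolations are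
    inserted.\<close>
  define \<kappa> where "\<kappa> = C * (2 * real m * D)"
  have \<kappa>: "\<kappa> \<ge> 0" using C D0 by (simp add: \<kappa>_def)
  \<comment> \<open>Makes the coefficient \<open>\<kappa> * \<epsilon>\<close> of the norm to be
    absorbed at most 1/2; the \<open>+ 1\<close> covers \<open>\<kappa> = 0\<close>.\<close>
  define \<epsilon> where "\<epsilon> = 1 / (2 * (\<kappa> + 1))"
  have \<epsilon>: "\<epsilon> > 0" and \<kappa>\<epsilon>: "\<kappa> * \<epsilon> \<le> 1 / 2"
    using \<kappa> by (auto simp: \<epsilon>_def field_simps)
  define \<delta> where "\<delta> = \<epsilon> powr (- (real m - 1))"
  have \<delta>: "\<delta> \<ge> 0" by (simp add: \<delta>_def)
  show ?case
  proof (intro exI[of _ m] exI[of _ "2 * (C + \<kappa> * \<delta>)"] conjI allI impI)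
    show "0 < m" using m2 by simp
    show "0 \<le> 2 * (C + \<kappa> * \<delta>)" using C \<kappa> \<delta> by simp
    fix f :: "(real^'n) \<times> real \<Rightarrow> real" and fi B
    assume d: "moll_data R T \<sigma> f fi B"
    then have f: "integrable lborel f" and fi: "\<And>i. fi i \<in> borel_measurable borel"
      and weak: "\<And>r i x t. 0 < r \<Longrightarrow> r \<le> 1 \<Longrightarrow> norm x \<le> R \<Longrightarrow> r < t \<Longrightarrow> t < T - r \<Longrightarrow>
        conv (dmoll r (space_dir i)) f (x, t) = conv (mollifier r) (fi i) (x, t)"
      and B: "AE t in lborel. (\<integral>\<^sup>+x. ennreal (\<bar>f (x, t)\<bar> powr \<sigma>) \<partial>lborel) \<le> B"
      unfolding moll_data_def by blast+
    let ?G = "\<Sum>i\<in>UNIV. Lnorm (p i) (fi i)"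
    let ?Z = "epow B (1 / \<sigma>) + ?G"
    let ?L = "Lnorm 1 f"
    show "Lnorm ps (\<lambda>z. cutoff R (fst z) ^ m * f z) \<le> ennreal (2 * (C + \<kappa> * \<delta>)) * (?Z + ?L)"
    proof (rule Lnorm_cutoff_le_of_mollified[OF d _ ps])
      show "0 < m" using m2 by simp
      fix r :: real assume r: "0 < r" "r \<le> 1"
      let ?S = "{r<..<T - r}"
      define x where "x = Lnorm ps (on_times ?S (cut_moll R m r f))"
      have SQ: "cball (0 :: real^'n) R \<times> ?S \<subseteq> Q"
        using r by (auto simp: Q_def)
      have x_fin: "x < top"
        unfolding x_def using r f R m2 Q V SQ ps by (intro cut_moll_Lnorm_finite[where Q=Q and V=V]) auto
      have "x \<le> ennreal C * (?Z +
          ennreal (2 * real m) * (\<Sum>i\<in>UNIV. Lnorm (p i) (on_times ?S (cut_moll R (m - 1) r f))))"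
        unfolding x_def using r R f fi B weak m2 by (intro est) auto
      also have "\<dots> \<le> ennreal C * (?Z +
          ennreal (2 * real m) * (\<Sum>i\<in>UNIV. ennreal (W i) * (ennreal \<epsilon> * x + ennreal \<delta> * ?L)))"
      proof (intro mult_left_mono add_left_mono sum_mono)
        fix i
        have "Lnorm (p i) (on_times ?S (cut_moll R (m - 1) r f))
            \<le> ennreal (W i) * (epow x \<theta> * epow ?L (1 - \<theta>))"
          unfolding W_def \<theta>_def x_def using r f R m2 Q V SQ p1[of i] mq[of i] le[of i] ps_gt
          by (intro Lnorm_cut_moll_interpolation[where Q=Q]) auto
        also have "\<dots> \<le> ennreal (W i) * (ennreal \<epsilon> * x + ennreal \<delta> * ?L)"
          unfolding \<theta>_def \<delta>_def by (intro mult_left_mono young_eps \<epsilon> m2) auto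
        finally show "Lnorm (p i) (on_times ?S (cut_moll R (m - 1) r f))
            \<le> ennreal (W i) * (ennreal \<epsilon> * x + ennreal \<delta> * ?L)" .
      qed auto
      also have "(\<Sum>i\<in>UNIV. ennreal (W i) * (ennreal \<epsilon> * x + ennreal \<delta> * ?L))
          = ennreal D * (ennreal \<epsilon> * x + ennreal \<delta> * ?L)"
        unfolding D_def by (simp add: sum_distrib_right[symmetric] sum_ennreal W_def)
      also have "ennreal C * (?Z + ennreal (2 * real m) * (ennreal D * (ennreal \<epsilon> * x + ennreal \<delta> * ?L)))
          = ennreal C * ?Z + ennreal \<kappa> * (ennreal \<epsilon> * x + ennreal \<delta> * ?L)"
        using C D0 by (simp add: \<kappa>_def distrib_left ennreal_mult mult_ac)
      also have "\<dots> = (ennreal C * ?Z + ennreal (\<kappa> * \<delta>) * ?L) + ennreal (\<kappa> * \<epsilon>) * x"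
        using \<kappa> \<delta> \<epsilon> by (simp add: distrib_left ennreal_mult mult.assoc add_ac)
      also have "\<dots> \<le> (ennreal C * ?Z + ennreal (\<kappa> * \<delta>) * ?L) + ennreal (1 / 2) * x"
        using \<kappa>\<epsilon> by (intro add_left_mono mult_right_mono ennreal_leI) auto
      finally have "x \<le> 2 * (ennreal C * ?Z + ennreal (\<kappa> * \<delta>) * ?L)"
        by (rule ennreal_absorb_half[OF x_fin])
      also have "\<dots> \<le> 2 * (ennreal (C + \<kappa> * \<delta>) * ?Z + ennreal (C + \<kappa> * \<delta>) * ?L)"
        using C \<kappa> \<delta> by (intro mult_left_mono add_mono mult_right_mono ennreal_leI) auto
      also have "\<dots> = ennreal (2 * (C + \<kappa> * \<delta>)) * (?Z + ?L)"
        using C \<kappa> \<delta> by (simp only: ennreal_mult[of 2] distrib_left[symmetric] mult.assoc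
            ennreal_numeral add_nonneg_nonneg mult_nonneg_nonneg zero_le_numeral)
      finally show "Lnorm ps (on_times ?S (cut_moll R m r f)) \<le> ennreal (2 * (C + \<kappa> * \<delta>)) * (?Z + ?L)"
        by (simp only: x_def)
    qed
  qed
qed

section \<open>Local Lebesgue norms and weak derivatives\<close>

text \<open>The minus sign from the reflection \<open>z - y\<close> cancels the one in the
  definition of the weak derivative.\<close>

lemma partial_x_mollifier:
  "partial_x i (\<lambda>y. mollifier r (z - y)) y = - dmoll r (space_dir i) (z - y)"
proof -
  have "((\<lambda>y. mollifier r (z - y)) has_derivative (\<lambda>h. dmoll r (- h) (z - y))) (at y)"
    by (rule has_derivative_compose[OF _ mollifier_has_derivative])
       (auto intro!: derivative_eq_intros)
  then have "partial_x i (\<lambda>y. mollifier r (z - y)) y = dmoll r (- space_dir i) (z - y)"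
    unfolding partial_x_def by (simp add: frechet_derivative_at[symmetric] del: uminus_Pair)
  then show ?thesis
    using linear_neg[OF has_derivative_linear[OF mollifier_has_derivative[of r "z - y"]], of "space_dir i"]
    by simp
qed

text \<open>The support lies in the closed ball of radius \<open>r\<close> about
  \<open>(x, t)\<close>, and the times occurring there stay strictly between 0 and
  \<open>T\<close>.\<close>

lemma test_fun_mollifier:
  fixes x :: "real^'n::finite"
  assumes r: "r > 0" "r < t" "t < T - r"
  shows "test_fun T (\<lambda>y. mollifier r ((x, t) - y))"
proof -
  have sub: "closure {y. mollifier r ((x, t) - y) \<noteq> 0} \<subseteq> cball (x, t) r"
  proof (rule closure_minimal)
    show "{y. mollifier r ((x, t) - y) \<noteq> 0} \<subseteq> cball (x, t) r"
      using mollifier_eq_0[OF r(1)] by (force simp: dist_norm)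
  qed simp
  have "cball (x, t) r \<subseteq> UNIV \<times> {0<..<T}"
  proof
    fix z assume "z \<in> cball (x, t) r"
    then have "dist t (snd z) \<le> r"
      using dist_snd_le[of "(x, t)" z] by auto
    then show "z \<in> UNIV \<times> {0<..<T}"
      using r by (auto simp: mem_Times_iff dist_real_def)
  qed
  moreover have "compact (closure {y. mollifier r ((x, t) - y) \<noteq> 0})"
    using sub by (meson bounded_cball bounded_subset closed_closure compact_eq_bounded_closed)
  ultimately show ?thesis
    unfolding test_fun_def using sub smooth_alg_smooth_fun[OF smooth_alg_mollifier] by blast
qed

text \<open>Tonelli's theorem for a Borel null set containing the exceptional set: almost all of its
  slices are null.\<close>

lemma AE_lborel_slices:
  fixes P :: "'a::euclidean_space \<times> 'b::euclidean_space \<Rightarrow> bool"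
  assumes "AE z in lborel. P z"
  shows "AE t in lborel. AE x in lborel. P (x, t)"
proof -
  obtain N where N: "{z. \<not> P z} \<subseteq> N" "emeasure lborel N = 0" and [measurable]: "N \<in> sets borel"
    using AE_E[OF assms] by auto
  have [measurable]: "(\<lambda>z. indicator N z :: ennreal) \<in> borel_measurable (lborel \<Otimes>\<^sub>M lborel)"
    by (simp add: lborel_prod)
  have "(\<lambda>(t, x). indicator N (x, t) :: ennreal) \<in> borel_measurable (lborel \<Otimes>\<^sub>M lborel)"
    by measurable
  then have [measurable]: "(\<lambda>t. \<integral>\<^sup>+x. indicator N (x, t) \<partial>lborel) \<in> borel_measurable lborel"
    using lborel.borel_measurable_nn_integral by fastforce
  have "(\<integral>\<^sup>+t. (\<integral>\<^sup>+x. indicator N (x, t) \<partial>lborel) \<partial>lborel) = (\<integral>\<^sup>+z. indicator N z \<partial>lborel)"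
    using nn_integral_slab[of "\<lambda>z. indicator N z" UNIV] by simp
  also have "\<dots> = 0" using N by simp
  finally have "AE t in lborel. (\<integral>\<^sup>+x. indicator N (x, t) \<partial>lborel) = 0"
    by (subst (asm) nn_integral_0_iff_AE) auto
  then show ?thesis
  proof eventually_elim
    case (elim t)
    have [measurable]: "(\<lambda>x. indicator N (x, t) :: ennreal) \<in> borel_measurable lborel"
      by measurable
    from elim have "AE x in lborel. indicator N (x, t) = (0 :: ennreal)"
      by (subst (asm) nn_integral_0_iff_AE) auto
    then show "AE x in lborel. P (x, t)"
      by eventually_elim (use N(1) in \<open>auto simp: indicator_def split: if_splits\<close>)
  qed
qed

text \<open>\<open>u\<close> is only Lebesgue measurable, and only on the slab. A Borel function
  that agrees with it almost everywhere on \<open>Q\<close> and vanishes elsewhere makes the results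
  on \<open>lborel\<close> applicable.\<close>

lemma slab_representative:
  fixes u :: "(real^'n::finite) \<times> real \<Rightarrow> real"
  assumes u: "meas_slab T u" and [measurable]: "Q \<in> sets borel" and Q: "Q \<subseteq> UNIV \<times> {0<..<T}"
  shows "\<exists>f \<in> borel_measurable borel. (\<forall>z. z \<notin> Q \<longrightarrow> f z = 0) \<and> (AE z in lborel. z \<in> Q \<longrightarrow> f z = u z)"
proof -
  obtain U where U: "U \<in> borel_measurable lborel"
    "AE z in lborel. indicator (UNIV \<times> {0<..<T}) z * u z = U z"
    using completion_ex_borel_measurable_real[OF u[unfolded meas_slab_def]] by blast
  note U(1)[measurable]
  show ?thesis
  proof (intro bexI[of _ "\<lambda>z. indicator Q z * U z"] conjI allI impI)
    show "AE z in lborel. z \<in> Q \<longrightarrow> indicator Q z * U z = u z"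
      using U(2) by eventually_elim (use Q in \<open>auto simp: indicator_def\<close>)
    show "(\<lambda>z. indicator Q z * U z) \<in> borel_measurable borel" by measurable
  qed simp_all
qed

text \<open>The extended counterpart of \<open>Lq_norm\<close>. The real-valued norm is 0 for an
  infinite integral, because of \<open>enn2real\<close>, so a bound that is to prove finiteness has
  to be derived for \<open>eLq\<close>.\<close>

definition eLq :: "(real^'n::finite) set \<Rightarrow> real \<Rightarrow> real \<Rightarrow> ((real^'n) \<times> real \<Rightarrow> real) \<Rightarrow> ennreal" where
  "eLq K T q u = epow (\<integral>\<^sup>+z\<in>K \<times> {0<..<T}. ennreal (\<bar>u z\<bar> powr q) \<partial>lebesgue) (1 / q)"

lemma eLq_representative:
  assumes ae: "AE z in lborel. z \<in> Q \<longrightarrow> f z = u z" and K: "K \<times> {0<..<T} \<subseteq> Q"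
  shows "eLq K T q u = epow (\<integral>\<^sup>+z\<in>K \<times> {0<..<T}. ennreal (\<bar>f z\<bar> powr q) \<partial>lborel) (1 / q)"
proof -
  have "(\<integral>\<^sup>+z\<in>K \<times> {0<..<T}. ennreal (\<bar>u z\<bar> powr q) \<partial>lborel)
      = (\<integral>\<^sup>+z\<in>K \<times> {0<..<T}. ennreal (\<bar>f z\<bar> powr q) \<partial>lborel)"
    using ae by (intro nn_integral_cong_AE, eventually_elim) (use K in \<open>auto simp: indicator_def\<close>)
  then show ?thesis by (simp add: eLq_def nn_integral_completion)
qed

lemma eLq_eq_Lnorm:
  assumes ae: "AE z in lborel. z \<in> K \<times> {0<..<T} \<longrightarrow> f z = u z"
    and f0: "\<And>z. z \<notin> K \<times> {0<..<T} \<Longrightarrow> f z = 0" and q: "q > 0"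
  shows "eLq K T q u = Lnorm q f"
proof -
  have "(\<integral>\<^sup>+z\<in>K \<times> {0<..<T}. ennreal (\<bar>f z\<bar> powr q) \<partial>lborel) = (\<integral>\<^sup>+z. ennreal (\<bar>f z\<bar> powr q) \<partial>lborel)"
  proof (intro nn_integral_cong)
    fix z
    show "ennreal (\<bar>f z\<bar> powr q) * indicator (K \<times> {0<..<T}) z = ennreal (\<bar>f z\<bar> powr q)"
      using f0[of z] by (cases "z \<in> K \<times> {0<..<T}") auto
  qed
  then show ?thesis
    using eLq_representative[OF ae order_refl] by (simp add: Lnorm_def)
qed

text \<open>Off the slab \<open>u\<close> may fail to be measurable; the factor
  \<open>\<psi>\<close>, which vanishes outside \<open>Q\<close>, removes those values.\<close>

lemma lebesgue_integral_representative:
  fixes u :: "(real^'n::finite) \<times> real \<Rightarrow> real"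
  assumes u: "meas_slab T u" and Q: "Q \<subseteq> UNIV \<times> {0<..<T}"
    and [measurable]: "f \<in> borel_measurable borel" "\<psi> \<in> borel_measurable borel"
    and ae: "AE z in lborel. z \<in> Q \<longrightarrow> f z = u z" and \<psi>0: "\<And>z. z \<notin> Q \<Longrightarrow> \<psi> z = 0"
  shows "(LINT z|lebesgue. u z * \<psi> z) = (LINT z|lborel. f z * \<psi> z)"
proof -
  have "(\<lambda>z. (indicator (UNIV \<times> {0<..<T}) z * u z) * \<psi> z) \<in> borel_measurable lebesgue"
    by (rule borel_measurable_times[OF u[unfolded meas_slab_def] measurable_completion]) simp
  moreover have "(\<lambda>z. (indicator (UNIV \<times> {0<..<T}) z * u z) * \<psi> z) = (\<lambda>z. u z * \<psi> z)"
  proof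
    fix z
    show "(indicator (UNIV \<times> {0<..<T}) z * u z) * \<psi> z = u z * \<psi> z"
      using \<psi>0[of z] Q by (cases "z \<in> Q") auto
  qed
  ultimately have m: "(\<lambda>z. u z * \<psi> z) \<in> borel_measurable lebesgue" by simp
  have "(LINT z|lebesgue. u z * \<psi> z) = (LINT z|lebesgue. f z * \<psi> z)"
  proof (rule integral_cong_AE[OF m])
    show "(\<lambda>z. f z * \<psi> z) \<in> borel_measurable lebesgue"
      by (intro measurable_completion) simp
    show "AE z in lebesgue. u z * \<psi> z = f z * \<psi> z"
      using AE_completion[OF ae] by eventually_elim (use \<psi>0 in auto)
  qed
  also have "\<dots> = (LINT z|lborel. f z * \<psi> z)"
    by (intro integral_completion) simp
  finally show ?thesis .
qed

text \<open>The reflected mollifier \<open>\<lambda>y. mollifier r (z - y)\<close> is the test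
  function in the weak derivative identity. The conditions on \<open>r\<close>, \<open>t\<close> and
  \<open>x\<close> keep the closed ball of radius \<open>r\<close> about \<open>z = (x, t)\<close>
  inside \<open>Q\<close>, where \<open>f\<close> and \<open>h\<close> represent \<open>u\<close>
  and \<open>g\<close>.\<close>

lemma conv_dmoll_eq_conv_weak_dx:
  fixes x :: "real^'n::finite"
  assumes weak: "weak_dx T i u g" and u: "meas_slab T u" and g: "meas_slab T g"
    and Q: "Q = cball 0 (R + 1) \<times> {0<..<T}"
    and [measurable]: "f \<in> borel_measurable borel" "h \<in> borel_measurable borel"
    and f: "AE z in lborel. z \<in> Q \<longrightarrow> f z = u z" and h: "AE z in lborel. z \<in> Q \<longrightarrow> h z = g z"
    and r: "0 < r" "r \<le> 1" "r < t" "t < T - r" and x: "norm x \<le> R"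
  shows "conv (dmoll r (space_dir i)) f (x, t) = conv (mollifier r) h (x, t)"
proof -
  define z where "z = (x, t)"
  have QT: "Q \<subseteq> UNIV \<times> {0<..<T}" by (auto simp: Q)
  have far: "norm (z - y) > r" if "y \<notin> Q" for y
  proof (rule ccontr)
    assume "\<not> norm (z - y) > r"
    then have d: "dist z y \<le> r" by (simp add: dist_norm)
    then have "dist x (fst y) \<le> r" "dist t (snd y) \<le> r"
      using dist_fst_le[of z y] dist_snd_le[of z y] by (auto simp: z_def)
    moreover have "norm (fst y) \<le> norm x + dist x (fst y)"
      using norm_triangle_sub[of "fst y" x] by (simp add: dist_norm norm_minus_commute)
    ultimately have "y \<in> Q"
      using r x by (auto simp: Q mem_Times_iff dist_real_def)
    with that show False by simp
  qed
  have [measurable]: "(\<lambda>y. dmoll r (space_dir i) (z - y)) \<in> borel_measurable borel"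
    by (intro borel_measurable_continuous_onI continuous_on_compose2[OF continuous_dmoll] continuous_intros) auto
  have "test_fun T (\<lambda>y. mollifier r (z - y))"
    unfolding z_def by (rule test_fun_mollifier) (use r in auto)
  then have "(LINT y|lebesgue. u y * partial_x i (\<lambda>y. mollifier r (z - y)) y)
      = - (LINT y|lebesgue. g y * mollifier r (z - y))"
    using weak unfolding weak_dx_def by blast
  then have "(LINT y|lebesgue. u y * - dmoll r (space_dir i) (z - y))
      = - (LINT y|lebesgue. g y * mollifier r (z - y))"
    by (simp only: partial_x_mollifier)
  also have "(LINT y|lebesgue. u y * - dmoll r (space_dir i) (z - y))
      = (LINT y|lborel. f y * - dmoll r (space_dir i) (z - y))"
    using dmoll_eq_0[OF r(1) far] by (intro lebesgue_integral_representative[OF u QT _ _ f]) auto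
  also have "(LINT y|lebesgue. g y * mollifier r (z - y)) = (LINT y|lborel. h y * mollifier r (z - y))"
    using mollifier_eq_0[OF r(1) less_imp_le[OF far]]
    by (intro lebesgue_integral_representative[OF g QT _ _ h]) auto
  finally show ?thesis by (simp add: conv_def z_def)
qed

definition eLinf :: "(real^'n::finite) set \<Rightarrow> real \<Rightarrow> real \<Rightarrow> ((real^'n) \<times> real \<Rightarrow> real) \<Rightarrow> ennreal" where
  "eLinf K T \<sigma> u = (SUP t\<in>{0<..<T}. \<integral>\<^sup>+x\<in>K. ennreal (\<bar>u (x, t)\<bar> powr \<sigma>) \<partial>lebesgue)"

text \<open>Translates the function spaces into the data of the estimates. Norms of the
  representatives are expressed through \<open>u\<close> and \<open>g\<close>, and the last clause
  reads off norms of \<open>u\<close> over smaller sets from \<open>f\<close>.\<close>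

lemma moll_data_of_aniso:
  fixes u :: "(real^'n::finite) \<times> real \<Rightarrow> real"
  assumes W: "aniso_W p T u g" and T: "T > 0" and R: "R \<ge> 1"
  shows "\<exists>f fi. moll_data R T \<sigma> f fi (eLinf (cball 0 (R + 1)) T \<sigma> u) \<and>
    (\<forall>q>0. Lnorm q f = eLq (cball 0 (R + 1)) T q u \<and>
       (\<forall>i. Lnorm q (fi i) = eLq (cball 0 (R + 1)) T q (g i))) \<and>
    (\<forall>K q. K \<subseteq> cball 0 (R + 1) \<longrightarrow>
       eLq K T q u = epow (\<integral>\<^sup>+z\<in>K \<times> {0<..<T}. ennreal (\<bar>f z\<bar> powr q) \<partial>lborel) (1 / q))"
proof -
  define K where "K = cball (0 :: real^'n) (R + 1)"
  define Q where "Q = K \<times> {0<..<T}"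
  have Q: "Q \<in> sets borel"
    unfolding Q_def K_def using R T by (intro slab_measure) auto
  have QT: "Q \<subseteq> UNIV \<times> {0<..<T}" by (auto simp: Q_def)
  have u: "meas_slab T u" and g: "\<And>i. meas_slab T (g i)" and weak: "\<And>i. weak_dx T i u (g i)"
    and u1: "(\<integral>\<^sup>+z\<in>K \<times> {0<..<T}. ennreal (\<bar>u z\<bar> powr 1) \<partial>lebesgue) < \<infinity>"
    using W by (auto simp: aniso_W_def Lq_loc_def K_def)
  obtain f where f[measurable]: "f \<in> borel_measurable borel" and f0: "\<And>z. z \<notin> Q \<Longrightarrow> f z = 0"
    and fu: "AE z in lborel. z \<in> Q \<longrightarrow> f z = u z"
    using slab_representative[OF u Q QT] by blast
  have "\<exists>h. h \<in> borel_measurable borel \<and> (\<forall>z. z \<notin> Q \<longrightarrow> h z = 0) \<and> (AE z in lborel. z \<in> Q \<longrightarrow> h z = g i z)" for i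
    using slab_representative[OF g[of i] Q QT] unfolding Bex_def .
  then have "\<exists>fi. \<forall>i. fi i \<in> borel_measurable borel \<and> (\<forall>z. z \<notin> Q \<longrightarrow> fi i z = 0) \<and>
      (AE z in lborel. z \<in> Q \<longrightarrow> fi i z = g i z)"
    by (intro choice allI)
  then obtain fi where fi[measurable]: "\<And>i. fi i \<in> borel_measurable borel"
    and fi0: "\<And>i z. z \<notin> Q \<Longrightarrow> fi i z = 0" and fig: "\<And>i. AE z in lborel. z \<in> Q \<longrightarrow> fi i z = g i z"
    by auto
  have nf: "Lnorm q f = eLq K T q u" if "q > 0" for q
    using fu f0 that unfolding Q_def by (intro eLq_eq_Lnorm[symmetric]) auto
  have nfi: "Lnorm q (fi i) = eLq K T q (g i)" if "q > 0" for q i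
    using fig[of i] fi0[of _ i] that unfolding Q_def by (intro eLq_eq_Lnorm[symmetric]) auto
  have "Lnorm 1 f < top"
    using u1 unfolding nf[OF zero_less_one] eLq_def less_top[symmetric] by simp
  then have int: "integrable lborel f"
    by (intro integrableI_bounded) (auto simp: Lnorm_def)
  \<comment> \<open>The supremum in \<open>eLinf\<close> is over all times, but slices of
    \<open>f\<close> and \<open>u\<close> agree almost everywhere only for almost every
    \<open>t\<close>; hence the exceptional set of times in \<open>moll_data\<close>.\<close>
  have "AE t in lborel. (\<integral>\<^sup>+x. ennreal (\<bar>f (x, t)\<bar> powr \<sigma>) \<partial>lborel) \<le> eLinf K T \<sigma> u"
    using AE_lborel_slices[OF fu]
  proof eventually_elim
    case (elim t)
    show ?case
    proof (cases "t \<in> {0<..<T}")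
      case True
      have "(\<integral>\<^sup>+x. ennreal (\<bar>f (x, t)\<bar> powr \<sigma>) \<partial>lborel) = (\<integral>\<^sup>+x\<in>K. ennreal (\<bar>u (x, t)\<bar> powr \<sigma>) \<partial>lborel)"
      proof (rule nn_integral_cong_AE, use elim in eventually_elim)
        case (elim x)
        then show ?case
          using True f0[of "(x, t)"] by (cases "x \<in> K") (auto simp: Q_def)
      qed
      also have "\<dots> = (\<integral>\<^sup>+x\<in>K. ennreal (\<bar>u (x, t)\<bar> powr \<sigma>) \<partial>lebesgue)"
        by (simp add: nn_integral_completion)
      also have "\<dots> \<le> eLinf K T \<sigma> u"
        unfolding eLinf_def using True by (rule SUP_upper)
      finally show ?thesis .
    next
      case False
      then have "f (x, t) = 0" for x by (intro f0) (auto simp: Q_def)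
      then show ?thesis by simp
    qed
  qed
  then have "moll_data R T \<sigma> f fi (eLinf K T \<sigma> u)"
    unfolding moll_data_def
    using int fi f0[unfolded Q_def K_def] conv_dmoll_eq_conv_weak_dx[OF weak u g Q_def[unfolded K_def] f fi fu fig]
    by (intro conjI allI impI) simp_all
  then show ?thesis
    using nf nfi eLq_representative[OF fu] unfolding Q_def K_def
    by (intro exI[of _ f] exI[of _ fi]) (auto simp: Sigma_mono)
qed

section \<open>The embedding over compact sets\<close>

lemma eLq_eq_Lq_norm:
  assumes "(\<integral>\<^sup>+z\<in>K \<times> {0<..<T}. ennreal (\<bar>u z\<bar> powr q) \<partial>lebesgue) < \<infinity>"
  shows "eLq K T q u = ennreal (Lq_norm K T q u)"
  using assms by (simp add: eLq_def Lq_norm_def epow_def)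

lemma Lq_norm_nonneg: "0 \<le> Lq_norm K T q u" and Linf_norm_nonneg: "0 \<le> Linf_norm K T q u"
  by (simp_all add: Lq_norm_def Linf_norm_def)

text \<open>Serves both inclusions, with auxiliary exponent \<open>q\<close> equal to the maximum of
  the \<open>p i\<close> or to 1. Finiteness is asserted beside the norm bound because the bound
  holds trivially when the integral is infinite and \<open>Lq_norm\<close> is 0.\<close>

lemma local_embedding:
  fixes p :: "'n::finite \<Rightarrow> real"
  assumes p: "\<forall>i. p i > 1" and T: "T > 0" and q: "q > 0" and ps: "ps > 0"
    and bound: "\<And>R. R \<ge> 1 \<Longrightarrow> \<exists>m C. m > 0 \<and> 0 \<le> C \<and> (\<forall>f fi B. moll_data R T \<sigma> f fi B \<longrightarrow>
      Lnorm ps (\<lambda>z. cutoff R (fst z) ^ m * f z) \<le>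
        ennreal C * (epow B (1 / \<sigma>) + (\<Sum>i\<in>UNIV. Lnorm (p i) (fi i)) + Lnorm q f))"
    and K: "compact K"
  shows "\<exists>K' C. compact K' \<and> 0 \<le> C \<and> (\<forall>u g. Lq_loc T q u \<and> aniso_W p T u g \<and> Linf_loc T \<sigma> u \<longrightarrow>
    (\<integral>\<^sup>+z\<in>K \<times> {0<..<T}. ennreal (\<bar>u z\<bar> powr ps) \<partial>lebesgue) < \<infinity> \<and>
    Lq_norm K T ps u \<le> C * (Lq_norm K' T q u + (\<Sum>i\<in>UNIV. Lq_norm K' T (p i) (g i)) + Linf_norm K' T \<sigma> u))"
proof -
  obtain b where b: "\<And>x. x \<in> K \<Longrightarrow> norm x \<le> b"
    using compact_imp_bounded[OF K] by (auto simp: bounded_iff)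
  \<comment> \<open>Places \<open>K\<close> in the ball of radius \<open>R / 2\<close>, where the
    cutoff is at least 1/2, and ensures \<open>R \<ge> 1\<close> for small \<open>K\<close>
    too.\<close>
  define R where "R = 2 * \<bar>b\<bar> + 1"
  have R: "R \<ge> 1" by (simp add: R_def)
  have KR: "norm x \<le> R / 2" if "x \<in> K" for x using b[OF that] by (simp add: R_def)
  define K' where "K' = cball (0 :: real^'n) (R + 1)"
  have KK': "K \<subseteq> K'" using KR R by (force simp: K'_def)
  obtain m C where m: "m > 0" and C: "0 \<le> C" and bd: "\<And>f fi B. moll_data R T \<sigma> f fi B \<Longrightarrow>
      Lnorm ps (\<lambda>z. cutoff R (fst z) ^ m * f z) \<le>
        ennreal C * (epow B (1 / \<sigma>) + (\<Sum>i\<in>UNIV. Lnorm (p i) (fi i)) + Lnorm q f)"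
    using bound[OF R] by blast
  have cut: "1 \<le> 2 ^ m * cutoff R x ^ m" if "x \<in> K" for x
  proof -
    have "(norm x)\<^sup>2 \<le> (R / 2)\<^sup>2" using KR[OF that] by (intro power_mono) auto
    then have "4 * (norm x)\<^sup>2 \<le> R\<^sup>2"
      by (simp add: power_divide)
    then have "2 * (norm x)\<^sup>2 \<le> R\<^sup>2"
      using zero_le_power2[of "norm x"] by linarith
    then have "(x \<bullet> x) / R\<^sup>2 \<le> 1 / 2"
      using R by (simp add: dot_square_norm divide_le_eq)
    moreover have "1 - (x \<bullet> x) / R\<^sup>2 \<le> cutoff R x" by (simp add: cutoff_def)
    ultimately have "1 \<le> 2 * cutoff R x" by linarith
    then have "1 \<le> (2 * cutoff R x) ^ m" by (rule one_le_power)
    then show ?thesis by (simp add: power_mult_distrib)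
  qed
  have main: "(\<integral>\<^sup>+z\<in>K \<times> {0<..<T}. ennreal (\<bar>u z\<bar> powr ps) \<partial>lebesgue) < \<infinity> \<and>
    Lq_norm K T ps u \<le> (2 ^ m * C) * (Lq_norm K' T q u + (\<Sum>i\<in>UNIV. Lq_norm K' T (p i) (g i)) + Linf_norm K' T \<sigma> u)"
    if uq: "Lq_loc T q u" and W: "aniso_W p T u g" and u\<sigma>: "Linf_loc T \<sigma> u" for u g
  proof -
    obtain f fi where d: "moll_data R T \<sigma> f fi (eLinf K' T \<sigma> u)"
      and nf: "\<And>q. q > 0 \<Longrightarrow> Lnorm q f = eLq K' T q u"
      and nfi: "\<And>i q. q > 0 \<Longrightarrow> Lnorm q (fi i) = eLq K' T q (g i)"
      and rep: "\<And>K q. K \<subseteq> K' \<Longrightarrow>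
       eLq K T q u = epow (\<integral>\<^sup>+z\<in>K \<times> {0<..<T}. ennreal (\<bar>f z\<bar> powr q) \<partial>lborel) (1 / q)"
      unfolding K'_def using moll_data_of_aniso[OF W T R, of \<sigma>] by blast
    have [measurable]: "f \<in> borel_measurable borel"
      using d by (auto simp: moll_data_def)
    have K'c: "compact K'" by (simp add: K'_def)
    have [measurable]: "(\<lambda>z. cutoff R (fst z) ^ m * f z) \<in> borel_measurable borel"
    proof -
      have "(\<lambda>z::(real^'n) \<times> real. cutoff R (fst z) ^ m) \<in> borel_measurable borel"
        by (intro borel_measurable_continuous_onI continuous_intros)
      then show ?thesis by measurable
    qed
    have p0: "p i > 0" for i using p[rule_format, of i] by simp
    have "eLq K T ps u \<le> Lnorm ps (\<lambda>z. 2 ^ m * (cutoff R (fst z) ^ m * f z))"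
      unfolding rep[OF KK'] Lnorm_def
    proof (intro epow_mono nn_integral_mono)
      fix z
      show "ennreal (\<bar>f z\<bar> powr ps) * indicator (K \<times> {0<..<T}) z
          \<le> ennreal (\<bar>2 ^ m * (cutoff R (fst z) ^ m * f z)\<bar> powr ps)"
      proof (cases "z \<in> K \<times> {0<..<T}")
        case True
        then have "1 * \<bar>f z\<bar> \<le> (2 ^ m * cutoff R (fst z) ^ m) * \<bar>f z\<bar>"
          by (intro mult_right_mono cut) auto
        then show ?thesis
          using True ps by (auto simp: abs_mult cutoff_nonneg mult.assoc intro!: ennreal_leI powr_mono2)
      qed simp
    qed (use ps in simp)
    also have "\<dots> = ennreal (2 ^ m) * Lnorm ps (\<lambda>z. cutoff R (fst z) ^ m * f z)"
      using ps by (intro Lnorm_cmult) auto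
    also have "\<dots> \<le> ennreal (2 ^ m) * (ennreal C * (epow (eLinf K' T \<sigma> u) (1 / \<sigma>) +
        (\<Sum>i\<in>UNIV. Lnorm (p i) (fi i)) + Lnorm q f))"
      by (intro mult_left_mono bd[OF d]) auto
    also have "epow (eLinf K' T \<sigma> u) (1 / \<sigma>) = ennreal (Linf_norm K' T \<sigma> u)"
    proof -
      have "eLinf K' T \<sigma> u < \<infinity>"
        using u\<sigma> K'c unfolding Linf_loc_def eLinf_def by blast
      then show ?thesis
        unfolding Linf_norm_def eLinf_def[symmetric] epow_def by auto
    qed
    also have "(\<Sum>i\<in>UNIV. Lnorm (p i) (fi i)) = ennreal (\<Sum>i\<in>UNIV. Lq_norm K' T (p i) (g i))"
    proof -
      have "Lnorm (p i) (fi i) = ennreal (Lq_norm K' T (p i) (g i))" for i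
        using W K'c unfolding nfi[OF p0] by (intro eLq_eq_Lq_norm) (auto simp: aniso_W_def Lq_loc_def)
      then show ?thesis by (simp add: sum_ennreal Lq_norm_nonneg)
    qed
    also have "Lnorm q f = ennreal (Lq_norm K' T q u)"
      using uq K'c unfolding nf[OF q] by (intro eLq_eq_Lq_norm) (auto simp: Lq_loc_def)
    also have "ennreal (2 ^ m) * (ennreal C * (ennreal (Linf_norm K' T \<sigma> u) +
        ennreal (\<Sum>i\<in>UNIV. Lq_norm K' T (p i) (g i)) + ennreal (Lq_norm K' T q u)))
      = ennreal ((2 ^ m * C) * (Lq_norm K' T q u + (\<Sum>i\<in>UNIV. Lq_norm K' T (p i) (g i)) + Linf_norm K' T \<sigma> u))"
    proof -
      let ?A = "Linf_norm K' T \<sigma> u" and ?B = "\<Sum>i\<in>UNIV. Lq_norm K' T (p i) (g i)" and ?C = "Lq_norm K' T q u"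
      have nn: "0 \<le> ?A" "0 \<le> ?B" "0 \<le> ?C"
        by (auto simp: Linf_norm_nonneg Lq_norm_nonneg intro!: sum_nonneg)
      then have "ennreal ?A + ennreal ?B + ennreal ?C = ennreal (?C + ?B + ?A)"
        by (simp add: ennreal_plus[symmetric] add_ac del: ennreal_plus)
      then show ?thesis
        using nn C by (simp add: ennreal_mult mult.assoc del: ennreal_plus)
    qed
    finally have le: "eLq K T ps u \<le> ennreal ((2 ^ m * C) *
        (Lq_norm K' T q u + (\<Sum>i\<in>UNIV. Lq_norm K' T (p i) (g i)) + Linf_norm K' T \<sigma> u))" .
    then have "eLq K T ps u < top"
      by (rule le_less_trans) simp
    then have fin: "(\<integral>\<^sup>+z\<in>K \<times> {0<..<T}. ennreal (\<bar>u z\<bar> powr ps) \<partial>lebesgue) < \<infinity>"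
      unfolding eLq_def less_top[symmetric] infinity_ennreal_def by simp
    have "0 \<le> (2 ^ m * C) * (Lq_norm K' T q u + (\<Sum>i\<in>UNIV. Lq_norm K' T (p i) (g i)) + Linf_norm K' T \<sigma> u)"
      using C by (intro mult_nonneg_nonneg add_nonneg_nonneg sum_nonneg) (auto simp: Lq_norm_nonneg Linf_norm_nonneg)
    then have "Lq_norm K T ps u \<le> (2 ^ m * C) *
        (Lq_norm K' T q u + (\<Sum>i\<in>UNIV. Lq_norm K' T (p i) (g i)) + Linf_norm K' T \<sigma> u)"
      using le unfolding eLq_eq_Lq_norm[OF fin] by (subst (asm) ennreal_le_iff) auto
    with fin show ?thesis by blast
  qed
  show ?thesis
    using C main by (intro exI[of _ K'] exI[of _ "2 ^ m * C"]) (auto simp: K'_def)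
qed

text \<open>Continuity is meant for the seminorms over compact sets: \<open>K'\<close> and
  \<open>C\<close> may depend on \<open>K\<close> but not on \<open>u\<close> or \<open>g\<close>.
  The weak derivatives \<open>g\<close> appear explicitly since the source seminorms involve
  them.\<close>

theorem theorem2p6:
  fixes p :: "'n::finite \<Rightarrow> real" and T \<sigma> :: real
  assumes p_gt1: "\<forall>i. p i > 1"
    and pbar_lt: "pbar p < real CARD('n)"
    and T_pos: "T > 0"
    and sigma: "1 \<le> \<sigma>" "\<sigma> \<le> pbar_star p"
  defines "pN \<equiv> Max (range p)"
    and "ps \<equiv> pbar p * (1 + \<sigma> / real CARD('n))"
  shows
    "(\<forall>u. Lq_loc T pN u \<and> aniso_W_space p T u \<and> Linf_loc T \<sigma> u \<longrightarrow> Lq_loc T ps u)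
     \<and> (\<forall>K. compact K \<longrightarrow> (\<exists>K' C. compact K' \<and>
          (\<forall>u g. Lq_loc T pN u \<and> aniso_W p T u g \<and> Linf_loc T \<sigma> u \<longrightarrow>
             Lq_norm K T ps u \<le> C * (Lq_norm K' T pN u + Lq_norm K' T 1 u
                + (\<Sum>i\<in>UNIV. Lq_norm K' T (p i) (g i)) + Linf_norm K' T \<sigma> u))))
     \<and> (ps > pN \<longrightarrow>
         (\<forall>u. aniso_W_space p T u \<and> Linf_loc T \<sigma> u \<longrightarrow> Lq_loc T ps u)
         \<and> (\<forall>K. compact K \<longrightarrow> (\<exists>K' C. compact K' \<and>
             (\<forall>u g. aniso_W p T u g \<and> Linf_loc T \<sigma> u \<longrightarrow>
                Lq_norm K T ps u \<le> C * (Lq_norm K' T 1 u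
                  + (\<Sum>i\<in>UNIV. Lq_norm K' T (p i) (g i)) + Linf_norm K' T \<sigma> u)))))"
proof -
  have le: "p i \<le> pN" for i by (auto simp: pN_def)
  have pN: "pN > 1" using p_gt1 le[of undefined] by (meson less_le_trans)
  have ps: "ps > 0"
    using pbar_gt_1[OF p_gt1] sigma(1) unfolding ps_def by (intro mult_pos_pos add_pos_nonneg) auto
  have emb: "\<exists>K' C. compact K' \<and> 0 \<le> C \<and> (\<forall>u g. Lq_loc T pN u \<and> aniso_W p T u g \<and> Linf_loc T \<sigma> u \<longrightarrow>
    (\<integral>\<^sup>+z\<in>K \<times> {0<..<T}. ennreal (\<bar>u z\<bar> powr ps) \<partial>lebesgue) < \<infinity> \<and>
    Lq_norm K T ps u \<le> C * (Lq_norm K' T pN u + (\<Sum>i\<in>UNIV. Lq_norm K' T (p i) (g i)) + Linf_norm K' T \<sigma> u))"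
    if "compact K" for K
    using pN unfolding ps_def
    by (intro local_embedding p_gt1 T_pos that local_bound pbar_lt sigma(1) le ps[unfolded ps_def]) auto
  \<comment> \<open>Here the auxiliary exponent is 1. The condition \<open>Lq_loc T 1 u\<close> is
    part of \<open>aniso_W\<close>, so this is no additional assumption on \<open>u\<close>.\<close>
  have emb1: "\<exists>K' C. compact K' \<and> 0 \<le> C \<and> (\<forall>u g. Lq_loc T 1 u \<and> aniso_W p T u g \<and> Linf_loc T \<sigma> u \<longrightarrow>
    (\<integral>\<^sup>+z\<in>K \<times> {0<..<T}. ennreal (\<bar>u z\<bar> powr ps) \<partial>lebesgue) < \<infinity> \<and>
    Lq_norm K T ps u \<le> C * (Lq_norm K' T 1 u + (\<Sum>i\<in>UNIV. Lq_norm K' T (p i) (g i)) + Linf_norm K' T \<sigma> u))"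
    if "compact K" "ps > pN" for K
    using that(2) unfolding ps_def
    by (intro local_embedding p_gt1 T_pos that(1) local_bound_L1[where pmax=pN] pbar_lt sigma(1) le ps[unfolded ps_def]) auto
  have L1: "Lq_loc T 1 u" if "aniso_W p T u g" for u g
    using that by (simp add: aniso_W_def)
  show ?thesis
  proof (intro conjI allI impI)
    fix u assume u: "Lq_loc T pN u \<and> aniso_W_space p T u \<and> Linf_loc T \<sigma> u"
    then obtain g where "aniso_W p T u g" by (auto simp: aniso_W_space_def)
    with u emb show "Lq_loc T ps u"
      unfolding Lq_loc_def[of T ps] by (meson Lq_loc_def)
  next
    fix K :: "(real^'n) set" assume "compact K"
    from emb[OF this] obtain K' C where K': "compact K'" "0 \<le> C" and
      bd: "\<And>u g. Lq_loc T pN u \<Longrightarrow> aniso_W p T u g \<Longrightarrow> Linf_loc T \<sigma> u \<Longrightarrow>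
        Lq_norm K T ps u \<le> C * (Lq_norm K' T pN u + (\<Sum>i\<in>UNIV. Lq_norm K' T (p i) (g i)) + Linf_norm K' T \<sigma> u)"
      by blast
    show "\<exists>K' C. compact K' \<and>
          (\<forall>u g. Lq_loc T pN u \<and> aniso_W p T u g \<and> Linf_loc T \<sigma> u \<longrightarrow>
             Lq_norm K T ps u \<le> C * (Lq_norm K' T pN u + Lq_norm K' T 1 u
                + (\<Sum>i\<in>UNIV. Lq_norm K' T (p i) (g i)) + Linf_norm K' T \<sigma> u))"
    proof (intro exI[of _ K'] exI[of _ C] conjI allI impI K')
      fix u g assume "Lq_loc T pN u \<and> aniso_W p T u g \<and> Linf_loc T \<sigma> u"
      then have "Lq_norm K T ps u \<le> C * (Lq_norm K' T pN u + (\<Sum>i\<in>UNIV. Lq_norm K' T (p i) (g i)) + Linf_norm K' T \<sigma> u)"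
        using bd by blast
      also have "\<dots> \<le> C * (Lq_norm K' T pN u + Lq_norm K' T 1 u
                + (\<Sum>i\<in>UNIV. Lq_norm K' T (p i) (g i)) + Linf_norm K' T \<sigma> u)"
        using K'(2) Lq_norm_nonneg[of K' T 1 u] by (intro mult_left_mono) auto
      finally show "Lq_norm K T ps u \<le> C * (Lq_norm K' T pN u + Lq_norm K' T 1 u
                + (\<Sum>i\<in>UNIV. Lq_norm K' T (p i) (g i)) + Linf_norm K' T \<sigma> u)" .
    qed
  next
    fix u assume gt: "ps > pN" and u: "aniso_W_space p T u \<and> Linf_loc T \<sigma> u"
    then obtain g where g: "aniso_W p T u g" by (auto simp: aniso_W_space_def)
    with u emb1[OF _ gt] L1[OF g] show "Lq_loc T ps u"
      unfolding Lq_loc_def[of T ps] by (meson Lq_loc_def)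
  next
    fix K :: "(real^'n) set" assume gt: "ps > pN" and "compact K"
    from emb1[OF this(2,1)] L1 show "\<exists>K' C. compact K' \<and>
             (\<forall>u g. aniso_W p T u g \<and> Linf_loc T \<sigma> u \<longrightarrow>
                Lq_norm K T ps u \<le> C * (Lq_norm K' T 1 u
                  + (\<Sum>i\<in>UNIV. Lq_norm K' T (p i) (g i)) + Linf_norm K' T \<sigma> u))"
      by meson
  qed
qed

end
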